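(* Let $(G_n)_{n\ge1}$, $|V(G_n)|=n$, be a sequence of locally tree-like random graphs with local limit $(G,o)$, and let $D_o$ be the degree of the root $o$ in $G$. Let $q\ge2$, $\beta\ge 0$, $w=e^\beta-1$, $B\ge0$, and set $$k=\frac14\log\Big(\frac{1+w}{1+w/(q-1)}\Big),\qquad \beta^*=\frac14\log\big((1+w)(1+w/(q-1))\big),\qquad h=\frac12\log\Big(\frac{e^B}{q-1}\Big).$$ Suppose that one of the following holds: (High external field regime) $B>\log(q-1)$; or (Low temperature regime) $q>2$, $d_{\min}\ge3$ and $$w>\frac{(q-1)^{2/d_{\min}}-1}{1-(q-1)^{2/d_{\min}-1}},$$ where $d_{\min}=\inf_{n\ge1}\min_{v\in V(G_n)}d_v$ and $d_v$ is the degree of $v$. Then the limit in probability $\varphi^{\mathrm{eIsing}}(\beta^*,k,h)=\lim_{n\to\infty}\frac1n\log Z^{\mathrm{eIsing}}_{G_n}(\beta^*,k,h)$ exists and $$\lim_{n\to\infty}\frac1n\log Z_{G_n}(q,w,B)=\frac{\beta^*}2\mathbb E[D_o]+\frac12\log\big(e^{-B}(q-1)\big)+\varphi^{\mathrm{eIsing}}(\beta^*,k,h)$$ in probability.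
   Context: For a finite graph $G$ and $\omega\in\{0,1\}^{E(G)}$, $\mathscr C(\omega)$ is the collection of connected components of $(V(G),\{e:\omega_e=1\})$ (isolated vertices are components), $|C|$ is the number of vertices of $C$, and $$Z_G(q,w,B)=\sum_{\omega\in\{0,1\}^{E(G)}}\prod_{e\in E(G)}w^{\omega_e}\prod_{C\in\mathscr C(\omega)}\big(1+(q-1)e^{-B|C|}\big).$$ The extended Ising partition function is $$Z^{\mathrm{eIsing}}_G(\beta,k,h)=\sum_{\sigma\in\{-1,1\}^{V(G)}}\exp\Big(\beta\sum_{\{u,v\}\in E(G)}\sigma_u\sigma_v+\sum_{v\in V(G)}(k d_v+h)\sigma_v\Big),$$ where $d_v$ is the degree of $v$ in $G$. The sequence $(G_n)$ is called locally tree-like when both of the following hold. (i) Uniform sparsity: the degree $D_n$ of a uniformly random vertex of $G_n$ satisfies $D_n\to D$ in distribution and $\mathbb E[D_n]\to\mathbb E[D]<\infty$ for some random variable $D$. (ii) $G_n$ converges locally in probability to a random rooted graph $(G,o)$ that is almost surely a tree, i.e., for every $r\ge 0$ and every finite rooted graph $H$, the proportion of vertices $v\in V(G_n)$ whose rooted $r$-neighbourhood in $G_n$ is isomorphic to $H$ converges in probability to the probability that the $r$-neighbourhood of $o$ in $G$ is isomorphic to $H$. *)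

theory Defs
  imports "HOL-Probability.Probability"
begin

text \<open>Multigraphs: the ends of an edge form a two-element multiset of vertices, so \<open>{#v, v#}\<close>
  is a loop at \<open>v\<close>. Loops and parallel edges are allowed, as in the configuration model. (With simple
  graphs, the graph on one vertex would force the minimal degree of a whole sequence
  \<open>(G\<^sub>n)\<close>, \<open>|V(G\<^sub>n)| = n \<ge> 1\<close>, to be 0.) Simple graphs are a special case.\<close>

record ('v, 'e) mgraph =
  verts :: "'v set"
  edges :: "'e set"
  ends  :: "'e \<Rightarrow> 'v multiset"

definition wf_graph :: "('v, 'e) mgraph \<Rightarrow> bool" where
  "wf_graph G \<longleftrightarrow> (\<forall>e\<in>edges G. size (ends G e) = 2 \<and> set_mset (ends G e) \<subseteq> verts G)"

definition finite_graph :: "('v, 'e) mgraph \<Rightarrow> bool" where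
  "finite_graph G \<longleftrightarrow> wf_graph G \<and> finite (verts G) \<and> finite (edges G)"

definition locally_finite :: "('v, 'e) mgraph \<Rightarrow> bool" where
  "locally_finite G \<longleftrightarrow> (\<forall>v\<in>verts G. finite {e \<in> edges G. v \<in># ends G e})"

text \<open>A loop contributes 2 to the degree.\<close>

definition degree :: "('v, 'e) mgraph \<Rightarrow> 'v \<Rightarrow> nat" where
  "degree G v = (\<Sum>e | e \<in> edges G \<and> v \<in># ends G e. count (ends G e) v)"

definition adj :: "('v, 'e) mgraph \<Rightarrow> 'e set \<Rightarrow> ('v \<times> 'v) set" where
  "adj G A = {(u, v). \<exists>e\<in>A. ends G e = {#u, v#}}"

definition components :: "('v, 'e) mgraph \<Rightarrow> 'e set \<Rightarrow> 'v set set" where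
  "components G A = verts G // ((adj G A)\<^sup>* \<inter> verts G \<times> verts G)"

definition connected_graph :: "('v, 'e) mgraph \<Rightarrow> bool" where
  "connected_graph G \<longleftrightarrow> (\<forall>u\<in>verts G. \<forall>v\<in>verts G. (u, v) \<in> (adj G (edges G))\<^sup>*)"

text \<open>A cycle of length 1 is a loop, a cycle of length 2 is a pair of parallel edges.\<close>

definition is_cycle :: "('v, 'e) mgraph \<Rightarrow> 'v list \<Rightarrow> 'e list \<Rightarrow> bool" where
  "is_cycle G vs es \<longleftrightarrow>
     vs \<noteq> [] \<and> length es = length vs \<and> distinct vs \<and> distinct es \<and>
     set vs \<subseteq> verts G \<and> set es \<subseteq> edges G \<and>
     (\<forall>i<length vs. ends G (es ! i) = {#vs ! i, vs ! (Suc i mod length vs)#})"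

definition is_tree :: "('v, 'e) mgraph \<Rightarrow> bool" where
  "is_tree G \<longleftrightarrow> verts G \<noteq> {} \<and> connected_graph G \<and> (\<nexists>vs es. is_cycle G vs es)"

definition Z_RC :: "real \<Rightarrow> real \<Rightarrow> real \<Rightarrow> ('v, 'e) mgraph \<Rightarrow> real" where
  "Z_RC q w B G =
     (\<Sum>\<omega> \<in> edges G \<rightarrow>\<^sub>E {0, 1::nat}.
        (\<Prod>e\<in>edges G. w ^ \<omega> e) *
        (\<Prod>C \<in> components G {e \<in> edges G. \<omega> e = 1}. 1 + (q - 1) * exp (- B * real (card C))))"

definition Z_eIsing :: "real \<Rightarrow> real \<Rightarrow> real \<Rightarrow> ('v, 'e) mgraph \<Rightarrow> real" where
  "Z_eIsing \<beta> k h G =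
     (\<Sum>\<sigma> \<in> verts G \<rightarrow>\<^sub>E {-1, 1::real}.
        exp (\<beta> * (\<Sum>e\<in>edges G. \<Prod>u\<in>#ends G e. \<sigma> u) +
             (\<Sum>v\<in>verts G. (k * real (degree G v) + h) * \<sigma> v)))"

text \<open>A random finite graph is represented by its law, a \<open>pmf\<close>: up to the choice of labels there are
  only countably many finite graphs. All modes of convergence below (in distribution, or in
  probability to a constant) depend on the law of each single \<open>G\<^sub>n\<close> only.\<close>

definition tendsto_in_prob :: "(nat \<Rightarrow> 'g pmf) \<Rightarrow> (nat \<Rightarrow> 'g \<Rightarrow> real) \<Rightarrow> real \<Rightarrow> bool" where
  "tendsto_in_prob G X c \<longleftrightarrow>
     (\<forall>\<epsilon>>0. (\<lambda>n. measure_pmf.prob (G n) {g. \<bar>X n g - c\<bar> > \<epsilon>}) \<longlonglongrightarrow> 0)"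

text \<open>Law of the degree of a uniformly chosen vertex, with respect to the joint randomness of
  the graph and the vertex.\<close>

definition degree_law :: "('v, 'e) mgraph pmf \<Rightarrow> nat pmf" where
  "degree_law p = do { g \<leftarrow> p; v \<leftarrow> pmf_of_set (verts g); return_pmf (degree g v) }"

text \<open>\<open>\<mu>\<close> is the law of the limit variable \<open>D\<close>. Expectations are taken in \<open>[0, \<infinity>]\<close>.\<close>

definition uniformly_sparse :: "(nat \<Rightarrow> ('v, 'e) mgraph pmf) \<Rightarrow> bool" where
  "uniformly_sparse G \<longleftrightarrow>
     (\<exists>\<mu>. real_distribution \<mu> \<and>
        weak_conv_m (\<lambda>n. distr (measure_pmf (degree_law (G n))) borel real) \<mu> \<and>
        (\<lambda>n. \<integral>\<^sup>+ d. ennreal (real d) \<partial>measure_pmf (degree_law (G n))) \<longlonglongrightarrow> (\<integral>\<^sup>+ x. ennreal x \<partial>\<mu>) \<and>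
        (\<integral>\<^sup>+ x. ennreal x \<partial>\<mu>) < \<infinity>)"

type_synonym ('v, 'e) rooted = "('v, 'e) mgraph \<times> 'v"

definition rooted_iso :: "('v, 'e) rooted \<Rightarrow> ('u, 'f) rooted \<Rightarrow> bool" where
  "rooted_iso R S \<longleftrightarrow>
     (\<exists>f g. bij_betw f (verts (fst R)) (verts (fst S)) \<and>
            bij_betw g (edges (fst R)) (edges (fst S)) \<and>
            (\<forall>e\<in>edges (fst R). ends (fst S) (g e) = image_mset f (ends (fst R) e)) \<and>
            f (snd R) = snd S)"

definition ball_verts :: "('v, 'e) mgraph \<Rightarrow> nat \<Rightarrow> 'v \<Rightarrow> 'v set" where
  "ball_verts G r v = {u \<in> verts G. \<exists>j\<le>r. (v, u) \<in> adj G (edges G) ^^ j}"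

definition nbhd :: "nat \<Rightarrow> ('v, 'e) rooted \<Rightarrow> ('v, 'e) rooted" where
  "nbhd r R = (case R of (G, v) \<Rightarrow>
     (\<lparr>verts = ball_verts G r v,
       edges = {e \<in> edges G. set_mset (ends G e) \<subseteq> ball_verts G r v},
       ends = ends G\<rparr>, v))"

text \<open>Finite test graphs; natural number labels suffice, as they are only used up to isomorphism.\<close>

definition finite_rooted :: "(nat, nat) rooted \<Rightarrow> bool" where
  "finite_rooted H \<longleftrightarrow> finite_graph (fst H) \<and> snd H \<in> verts (fst H)"

text \<open>A random connected locally finite rooted graph on the probability space \<open>P\<close>; measurability is
  with respect to the \<open>\<sigma>\<close>-algebra of the local topology.\<close>

definition random_rooted_graph :: "'a measure \<Rightarrow> ('a \<Rightarrow> ('u, 'f) rooted) \<Rightarrow> bool" where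
  "random_rooted_graph P R \<longleftrightarrow>
     prob_space P \<and>
     (\<forall>x\<in>space P. wf_graph (fst (R x)) \<and> locally_finite (fst (R x)) \<and>
        connected_graph (fst (R x)) \<and> snd (R x) \<in> verts (fst (R x))) \<and>
     (\<forall>r H. finite_rooted H \<longrightarrow> {x \<in> space P. rooted_iso (nbhd r (R x)) H} \<in> sets P)"

definition local_limit_in_prob ::
  "(nat \<Rightarrow> ('v, 'e) mgraph pmf) \<Rightarrow> 'a measure \<Rightarrow> ('a \<Rightarrow> ('u, 'f) rooted) \<Rightarrow> bool" where
  "local_limit_in_prob G P R \<longleftrightarrow>
     random_rooted_graph P R \<and>
     (\<forall>r H. finite_rooted H \<longrightarrow>
        tendsto_in_prob G
          (\<lambda>n g. real (card {v \<in> verts g. rooted_iso (nbhd r (g, v)) H}) / real (card (verts g)))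
          (measure P {x \<in> space P. rooted_iso (nbhd r (R x)) H}))"

definition locally_tree_like ::
  "(nat \<Rightarrow> ('v, 'e) mgraph pmf) \<Rightarrow> 'a measure \<Rightarrow> ('a \<Rightarrow> ('u, 'f) rooted) \<Rightarrow> bool" where
  "locally_tree_like G P R \<longleftrightarrow>
     uniformly_sparse G \<and> local_limit_in_prob G P R \<and> (AE x in P. is_tree (fst (R x)))"

text \<open>For random graphs the infimum also runs over the possible values of \<open>G\<^sub>n\<close>, i.e. it is the
  essential infimum of the minimal degrees.\<close>

definition d_min :: "(nat \<Rightarrow> ('v, 'e) mgraph pmf) \<Rightarrow> nat" where
  "d_min G = (INF n\<in>{1..}. INF g\<in>set_pmf (G n). Min (degree g ` verts g))"

end

theory Submission
  imports Defs
begin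

text \<open>
Expanding over the edge configurations, the Ising partition function equals, up to an explicit factor,
a random cluster sum in which a component \<open>C\<close> with \<open>m\<close> edges has the weight
\<open>1 + (q - 1)^(|C| - m) exp (- B |C|)\<close>. This is the true weight if \<open>C\<close> is a tree, and in general it lies
between \<open>1/q\<close> times the true weight and the true weight. At most \<open>n/L\<close> components have more than \<open>L\<close> vertices,
and small components that are not trees are rare in a locally tree-like graph, so the two free energies per vertex
have the same limit.

Both regimes bound the fields \<open>k d\<^sub>v + h\<close> of the Ising model below by a positive constant. The pressure is
recovered by adding a uniform field \<open>t\<close> and integrating the mean magnetization from \<open>t = 0\<close> to a large \<open>t\<close>,
where the all-plus configuration dominates. By Griffiths' inequalities, the magnetization of \<open>v\<close> lies between the
magnetizations of \<open>v\<close> in its ball of radius \<open>L\<close> with free and with plus boundary. On a tree these differ by \<open>O(1/L)\<close>,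
uniformly in the tree: the magnetization of the root is a concave function of positive fields, so plus boundary
conditions at level \<open>l\<close> gain at most a constant times what the free system gains from level \<open>l\<close> to level \<open>l + 1\<close>,
and these gains telescope. Hence the mean magnetization is approximated by local averages, which converge.
\<close>

section \<open>Cycles and breadth-first trees\<close>

text \<open>The colour of weight 1 becomes the spin +1, and the other \<open>q - 1\<close> colours
  are merged into the spin -1. A vertex of spin -1 has weight \<open>(q - 1) * exp (- B)\<close> and
  an open edge between two such vertices has weight \<open>w / (q - 1)\<close>: a tree then gets
  exactly \<open>q - 1\<close> from its powers of \<open>q - 1\<close>, and each further edge costs
  a factor \<open>q - 1\<close>. The parameters \<open>k\<close>, \<open>\<beta>s\<close> and
  \<open>h\<close> write these two-state weights as exponentials.

  Positive fields matter because the effective field of a leaf is concave only for positive fields,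
  and because the tree estimate carries a constant of order \<open>J / leaf_field J c\<close>, so
  \<open>c\<close> must be uniform. Degrees are unbounded, but this does no harm: free and plus
  boundary conditions both act through the number of children, and only their ratio per child
  enters.

  The uniform field is integrated, and not the temperature, because raising it keeps all fields
  above \<open>c\<close> and because the derivative of the pressure is then an average of one-vertex
  quantities. The large-field end is explicit in the mean degree. The degree is an unbounded local
  function, so its average needs uniform sparsity besides local convergence.\<close>

definition acyclic_graph :: "('v, 'e) mgraph \<Rightarrow> bool" where
  "acyclic_graph G \<longleftrightarrow> (\<nexists>vs es. is_cycle G vs es)"

lemma adj_sym: "(u, v) \<in> adj G A \<Longrightarrow> (v, u) \<in> adj G A"
  unfolding adj_def by (auto simp: add_mset_commute)

lemma adj_rtrancl_sym: "(u, v) \<in> (adj G A)\<^sup>* \<Longrightarrow> (v, u) \<in> (adj G A)\<^sup>*"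
  by (meson adj_sym symD symI sym_rtrancl)

lemma adj_mono: "A \<subseteq> B \<Longrightarrow> adj G A \<subseteq> adj G B"
  unfolding adj_def by blast

lemma size_two_obtain:
  assumes "size M = 2" obtains a b where "M = {#a, b#}"
proof -
  obtain a N where N: "M = add_mset a N" "size N = 1"
    using assms size_eq_Suc_imp_eq_union[of M 1] by (auto simp: numeral_2_eq_2)
  then obtain b where "N = {#b#}" using size_1_singleton_mset by metis
  with N that show ?thesis by blast
qed

lemma wf_edge_obtain:
  assumes "wf_graph G" "e \<in> edges G"
  obtains a b where "ends G e = {#a, b#}" "a \<in> verts G" "b \<in> verts G"
proof -
  have "size (ends G e) = 2" and sub: "set_mset (ends G e) \<subseteq> verts G"
    using assms by (auto simp: wf_graph_def)
  then obtain a b where "ends G e = {#a, b#}" by (metis size_two_obtain)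
  with sub show ?thesis by (intro that[of a b]) auto
qed

lemma adj_verts:
  assumes "wf_graph G" "A \<subseteq> edges G" "(u, v) \<in> adj G A"
  shows "u \<in> verts G" "v \<in> verts G"
  using assms unfolding adj_def wf_graph_def by force+

text \<open>A shortest path from \<open>a\<close> to \<open>b\<close> inside \<open>A\<close>
  repeats no vertex, hence no edge, and \<open>e\<close> lies outside \<open>A\<close>, so it closes
  the path to a cycle. Path length 0 is the case of a loop \<open>e\<close>, and length 1 that of an
  edge parallel to one of \<open>A\<close>.\<close>

lemma cycle_of_path:
  assumes wf: "wf_graph G" and A: "A \<subseteq> edges G" and e: "e \<in> edges G" "e \<notin> A"
    and ab: "ends G e = {#a, b#}" and path: "(a, b) \<in> (adj G A)\<^sup>*"
  shows "\<not> acyclic_graph G"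
proof -
  obtain n0 where "(a, b) \<in> adj G A ^^ n0" using path by (auto simp: rtrancl_power)
  define n where "n = (LEAST n. (a, b) \<in> adj G A ^^ n)"
  have n: "(a, b) \<in> adj G A ^^ n" unfolding n_def by (rule LeastI) fact
  have n_min: "n \<le> m" if "(a, b) \<in> adj G A ^^ m" for m
    unfolding n_def by (rule Least_le) fact
  obtain f where f: "f 0 = a" "f n = b" "\<And>i. i < n \<Longrightarrow> (f i, f (Suc i)) \<in> adj G A"
    using n unfolding relpow_fun_conv by auto
  have seg: "(f i, f (i + d)) \<in> adj G A ^^ d" if "i + d \<le> n" for i d
    unfolding relpow_fun_conv by (rule exI[of _ "\<lambda>j. f (i + j)"]) (use that f in auto)
  \<comment> \<open>Otherwise the stretch between two visits of the same vertex could be cut out,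
    against the minimality of \<open>n\<close>.\<close>
  have inj: "f i \<noteq> f j" if "i < j" "j \<le> n" for i j
  proof
    assume eq: "f i = f j"
    have "(a, f i) \<in> adj G A ^^ i" using seg[of 0 i] that f by simp
    moreover have "(f i, b) \<in> adj G A ^^ (n - j)" using seg[of j "n - j"] that f eq by simp
    ultimately have "(a, b) \<in> adj G A ^^ (i + (n - j))" by (auto simp: relpow_add)
    from n_min[OF this] that show False by simp
  qed
  have inj_on: "inj_on f {..n}"
    unfolding inj_on_def by (metis inj atMost_iff linorder_neqE_nat)
  have "\<exists>g. g \<in> A \<and> ends G g = {#f i, f (Suc i)#}" if "i < n" for i
    using f(3)[OF that] by (auto simp: adj_def)
  then obtain g where g: "\<And>i. i < n \<Longrightarrow> g i \<in> A" "\<And>i. i < n \<Longrightarrow> ends G (g i) = {#f i, f (Suc i)#}"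
    by metis
  have g_inj: "inj_on g {..<n}"
  proof (rule inj_onI)
    fix i j assume ij: "i \<in> {..<n}" "j \<in> {..<n}" "g i = g j"
    then have "{#f i, f (Suc i)#} = {#f j, f (Suc j)#}" using g(2) by (metis lessThan_iff)
    then have "(f i = f j \<and> f (Suc i) = f (Suc j)) \<or> (f i = f (Suc j) \<and> f (Suc i) = f j)"
      by (auto simp: add_eq_conv_ex)
    then show "i = j"
    proof
      assume "f i = f (Suc j) \<and> f (Suc i) = f j"
      then have "i = Suc j" "Suc i = j" using ij inj_onD[OF inj_on] by auto
      then show ?thesis by simp
    qed (use ij inj_onD[OF inj_on, of i j] in auto)
  qed
  define vs where "vs = map f [0..<Suc n]"
  define es where "es = map g [0..<n] @ [e]"
  have "f i \<in> verts G" if "i \<le> n" for i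
  proof (cases "i = n")
    case True then show ?thesis using f(2) wf e(1) ab by (auto simp: wf_graph_def)
  next
    case False then have "i < n" using that by simp
    from f(3)[OF this] show ?thesis using adj_verts[OF wf A] by blast
  qed
  then have "set vs \<subseteq> verts G" by (auto simp: vs_def simp del: upt_Suc)
  moreover have "set es \<subseteq> edges G" using g A e by (auto simp: es_def)
  moreover have "distinct vs" unfolding vs_def distinct_map
    using inj_on by (auto simp del: upt_Suc simp: atLeast0LessThan lessThan_Suc_atMost)
  moreover have "distinct es" unfolding es_def
    using g_inj g(1) e by (auto simp: distinct_map atLeast0LessThan)
  moreover have "ends G (es ! i) = {#vs ! i, vs ! (Suc i mod length vs)#}" if "i < length vs" for i
  proof (cases "i = n")
    case True
    then show ?thesis using ab f by (simp add: es_def vs_def nth_append add_mset_commute del: upt_Suc)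
  next
    case False
    with that have "i < n" by (simp add: vs_def)
    then show ?thesis using g(2)[of i] by (simp add: es_def vs_def nth_append del: upt_Suc)
  qed
  ultimately have "is_cycle G vs es" unfolding is_cycle_def by (simp add: vs_def es_def del: upt_Suc)
  then show ?thesis unfolding acyclic_graph_def by blast
qed

text \<open>Applied with \<open>dep\<close> the distance to \<open>r\<close>, in a component or in a ball.\<close>

lemma parent_structure:
  assumes wf: "wf_graph G" and A: "A \<subseteq> edges G"
    and down: "\<And>u. u \<in> C \<Longrightarrow> u \<noteq> r \<Longrightarrow> \<exists>p\<in>C. \<exists>e\<in>A. ends G e = {#p, u#} \<and> dep p < (dep u :: nat)"
  obtains par pe where
    "\<forall>u\<in>C. u \<noteq> r \<longrightarrow> par u \<in> C \<and> pe u \<in> A \<and> ends G (pe u) = {#par u, u#} \<and> dep (par u) < dep u"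
    "inj_on pe (C - {r})"
    "pe ` (C - {r}) \<subseteq> {e \<in> A. set_mset (ends G e) \<subseteq> C}"
    "r \<in> C \<and> (\<forall>vs es. set es \<subseteq> {e \<in> A. set_mset (ends G e) \<subseteq> C} \<longrightarrow> \<not> is_cycle G vs es) \<longrightarrow>
       pe ` (C - {r}) = {e \<in> A. set_mset (ends G e) \<subseteq> C}"
proof -
  from down have "\<forall>u. \<exists>p e. u \<in> C \<and> u \<noteq> r \<longrightarrow> p \<in> C \<and> e \<in> A \<and> ends G e = {#p, u#} \<and> dep p < dep u"
    by blast
  then obtain par pe where *: "\<And>u. u \<in> C \<Longrightarrow> u \<noteq> r \<Longrightarrow>
      par u \<in> C \<and> pe u \<in> A \<and> ends G (pe u) = {#par u, u#} \<and> dep (par u) < dep u"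
    by metis
  have inj: "inj_on pe (C - {r})"
  proof (rule inj_onI)
    fix u v assume uv: "u \<in> C - {r}" "v \<in> C - {r}" "pe u = pe v"
    then have "{#par u, u#} = {#par v, v#}" using * by (metis DiffD1 DiffD2 singletonI)
    \<comment> \<open>Two vertices cannot be each other's parents, since \<open>dep\<close>
      decreases strictly towards the parent.\<close>
    then have "u = v \<or> (par u = v \<and> par v = u)" by (auto simp: add_eq_conv_ex)
    then show "u = v" using * uv by (metis DiffD1 DiffD2 less_asym singletonI)
  qed
  have sub: "pe ` (C - {r}) \<subseteq> {e \<in> A. set_mset (ends G e) \<subseteq> C}" using * by auto
  have root: "(r, u) \<in> (adj G (pe ` (C - {r})))\<^sup>*" if "u \<in> C" for u
    using that
  proof (induction "dep u" arbitrary: u rule: less_induct)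
    case less
    show ?case
    proof (cases "u = r")
      case False
      then have "(r, par u) \<in> (adj G (pe ` (C - {r})))\<^sup>*" using less * by blast
      moreover have "(par u, u) \<in> adj G (pe ` (C - {r}))"
        unfolding adj_def using * less.prems False by blast
      ultimately show ?thesis by auto
    qed auto
  qed
  show ?thesis
  proof (rule that[OF _ inj sub])
    show "\<forall>u\<in>C. u \<noteq> r \<longrightarrow> par u \<in> C \<and> pe u \<in> A \<and> ends G (pe u) = {#par u, u#} \<and> dep (par u) < dep u"
      using * by blast
  next
    have "pe ` (C - {r}) = {e \<in> A. set_mset (ends G e) \<subseteq> C}"
      if r: "r \<in> C" and ac: "\<forall>vs es. set es \<subseteq> {e \<in> A. set_mset (ends G e) \<subseteq> C} \<longrightarrow> \<not> is_cycle G vs es"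
    proof (rule equalityI[OF sub], rule ccontr)
      assume "\<not> {e \<in> A. set_mset (ends G e) \<subseteq> C} \<subseteq> pe ` (C - {r})"
      then obtain e where e: "e \<in> A" "set_mset (ends G e) \<subseteq> C" "e \<notin> pe ` (C - {r})" by blast
      then obtain a b where ab: "ends G e = {#a, b#}" "a \<in> C" "b \<in> C"
        using wf_edge_obtain[OF wf, of e] A by (metis insert_subset set_mset_add_mset_insert subsetD)
      \<comment> \<open>Passing to the edges inside \<open>C\<close> makes
        \<open>cycle_of_path\<close> return a cycle that stays in \<open>C\<close>. The two ends of
        a non-tree edge are joined by the tree paths through \<open>r\<close>.\<close>
      let ?H = "G\<lparr>edges := {e \<in> A. set_mset (ends G e) \<subseteq> C}\<rparr>"
      have adj: "adj ?H X = adj G X" for X by (simp add: adj_def)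
      have "(a, b) \<in> (adj ?H (pe ` (C - {r})))\<^sup>*"
        unfolding adj using root[OF ab(2)] root[OF ab(3)] by (meson adj_rtrancl_sym rtrancl_trans)
      moreover have "wf_graph ?H" using wf A by (auto simp: wf_graph_def)
      ultimately have "\<not> acyclic_graph ?H"
        using sub e ab cycle_of_path[of ?H "pe ` (C - {r})" e a b] by auto
      then obtain vs es where "is_cycle ?H vs es" by (auto simp: acyclic_graph_def)
      then have "is_cycle G vs es" "set es \<subseteq> {e \<in> A. set_mset (ends G e) \<subseteq> C}"
        using A by (auto simp: is_cycle_def)
      then show False using ac by blast
    qed
    then show "r \<in> C \<and> (\<forall>vs es. set es \<subseteq> {e \<in> A. set_mset (ends G e) \<subseteq> C} \<longrightarrow> \<not> is_cycle G vs es) \<longrightarrow>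
       pe ` (C - {r}) = {e \<in> A. set_mset (ends G e) \<subseteq> C}" by blast
  qed
qed

section \<open>Spin sums and Griffiths' inequalities\<close>

definition spin_sum :: "'v set \<Rightarrow> (('v \<Rightarrow> real) \<Rightarrow> real) \<Rightarrow> real" where
  "spin_sum V f = (\<Sum>\<sigma>\<in>V \<rightarrow>\<^sub>E {-1, 1}. f \<sigma>)"

text \<open>Multisets give edges (loops included), single sites and products of such observables one
  common form; multiplying observables is adding multisets.\<close>

definition spin_prod :: "('v \<Rightarrow> real) \<Rightarrow> 'v multiset \<Rightarrow> real" where
  "spin_prod \<sigma> A = (\<Prod>u\<in>#A. \<sigma> u)"

lemma spin_prod_add: "spin_prod \<sigma> (A + B) = spin_prod \<sigma> A * spin_prod \<sigma> B"
  by (simp add: spin_prod_def)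

lemma spin_prod_simps [simp]:
  "spin_prod \<sigma> {#} = 1" "spin_prod \<sigma> (add_mset u A) = \<sigma> u * spin_prod \<sigma> A"
  by (simp_all add: spin_prod_def)

lemma spin_prod_cong: "(\<And>u. u \<in># A \<Longrightarrow> \<sigma> u = \<tau> u) \<Longrightarrow> spin_prod \<sigma> A = spin_prod \<tau> A"
  by (induction A) auto

lemma spin_values: "\<sigma> \<in> V \<rightarrow>\<^sub>E {-1, 1::real} \<Longrightarrow> u \<in> V \<Longrightarrow> \<sigma> u = -1 \<or> \<sigma> u = 1"
  by (auto simp: PiE_iff)

lemma spin_prod_values:
  assumes "\<sigma> \<in> V \<rightarrow>\<^sub>E {-1, 1::real}" "set_mset A \<subseteq> V"
  shows "spin_prod \<sigma> A = -1 \<or> spin_prod \<sigma> A = 1"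
  using assms(2)
proof (induction A)
  case (add u A)
  then show ?case using spin_values[OF assms(1), of u] by auto
qed auto

lemma spin_sum_cong:
  "(\<And>\<sigma>. \<sigma> \<in> V \<rightarrow>\<^sub>E {-1, 1} \<Longrightarrow> f \<sigma> = g \<sigma>) \<Longrightarrow> spin_sum V f = spin_sum V g"
  unfolding spin_sum_def by (rule sum.cong) auto

lemma spin_sum_mono:
  "(\<And>\<sigma>. \<sigma> \<in> V \<rightarrow>\<^sub>E {-1, 1} \<Longrightarrow> f \<sigma> \<le> g \<sigma>) \<Longrightarrow> spin_sum V f \<le> spin_sum V g"
  unfolding spin_sum_def by (rule sum_mono) auto

lemma spin_sum_nonneg:
  "(\<And>\<sigma>. \<sigma> \<in> V \<rightarrow>\<^sub>E {-1, 1} \<Longrightarrow> 0 \<le> f \<sigma>) \<Longrightarrow> 0 \<le> spin_sum V f"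
  unfolding spin_sum_def by (rule sum_nonneg) auto

lemma finite_spins: "finite V \<Longrightarrow> finite (V \<rightarrow>\<^sub>E {-1, 1::real})"
  by (intro finite_PiE) auto

lemma spins_nonempty: "V \<rightarrow>\<^sub>E {-1, 1::real} \<noteq> {}"
  by (simp add: PiE_eq_empty_iff)

lemma spin_sum_pos:
  assumes "finite V" "\<And>\<sigma>. \<sigma> \<in> V \<rightarrow>\<^sub>E {-1, 1} \<Longrightarrow> 0 < f \<sigma>" shows "0 < spin_sum V f"
  unfolding spin_sum_def by (rule sum_pos) (use assms finite_spins spins_nonempty in auto)

lemma spin_sum_add: "spin_sum V (\<lambda>\<sigma>. f \<sigma> + g \<sigma>) = spin_sum V f + spin_sum V g"
  unfolding spin_sum_def by (rule sum.distrib)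

lemma spin_sum_diff: "spin_sum V (\<lambda>\<sigma>. f \<sigma> - g \<sigma>) = spin_sum V f - spin_sum V g"
  unfolding spin_sum_def by (rule sum_subtractf)

lemma spin_sum_cmult: "spin_sum V (\<lambda>\<sigma>. c * f \<sigma>) = c * spin_sum V f"
  unfolding spin_sum_def by (simp add: sum_distrib_left)

lemma spin_sum_sum: "spin_sum V (\<lambda>\<sigma>. \<Sum>i\<in>I. f i \<sigma>) = (\<Sum>i\<in>I. spin_sum V (f i))"
  unfolding spin_sum_def by (rule sum.swap)

lemma spin_sum_empty [simp]: "spin_sum {} f = f (\<lambda>_. undefined)"
  by (simp add: spin_sum_def)

lemma spin_sum_insert:
  assumes "finite V" "u \<notin> V"
  shows "spin_sum (insert u V) f = spin_sum V (\<lambda>\<sigma>. f (\<sigma>(u := 1)) + f (\<sigma>(u := -1)))"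
proof -
  have "spin_sum (insert u V) f = (\<Sum>(y, g)\<in>{-1, 1} \<times> (V \<rightarrow>\<^sub>E {-1, 1}). f (g(u := y)))"
    unfolding spin_sum_def PiE_insert_eq
    by (subst sum.reindex) (use inj_combinator[OF assms(2), of "\<lambda>_. {-1, 1::real}"] in \<open>auto simp: case_prod_unfold\<close>)
  also have "\<dots> = (\<Sum>y\<in>{-1, 1}. \<Sum>g\<in>V \<rightarrow>\<^sub>E {-1, 1}. f (g(u := y)))"
    by (simp add: sum.cartesian_product)
  finally show ?thesis by (simp add: spin_sum_add) (simp add: spin_sum_def)
qed

lemma spin_sum_prod:
  assumes "finite V"
  shows "spin_sum V (\<lambda>\<sigma>. \<Prod>u\<in>V. f u (\<sigma> u)) = (\<Prod>u\<in>V. f u 1 + f u (-1))"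
proof -
  have "(\<Prod>u\<in>V. f u 1 + f u (-1)) = (\<Prod>u\<in>V. \<Sum>s\<in>{-1, 1}. f u s)" by (simp add: add.commute)
  also have "\<dots> = spin_sum V (\<lambda>\<sigma>. \<Prod>u\<in>V. f u (\<sigma> u))"
    unfolding spin_sum_def using assms by (subst prod_sum_PiE) auto
  finally show ?thesis by simp
qed

lemma spin_sum_free:
  assumes "finite V" "finite D" "V \<inter> D = {}"
    and "\<And>\<sigma> \<tau>. (\<And>u. u \<in> V \<Longrightarrow> \<sigma> u = \<tau> u) \<Longrightarrow> f \<sigma> = f \<tau>"
  shows "spin_sum (V \<union> D) f = 2 ^ card D * spin_sum V f"
  using assms(2,3)
proof (induction D)
  case (insert u D)
  have "f (\<sigma>(u := s)) = f \<sigma>" for \<sigma> s using insert.prems by (intro assms(4)) auto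
  then have "spin_sum (V \<union> insert u D) f = spin_sum (V \<union> D) (\<lambda>\<sigma>. 2 * f \<sigma>)"
    using insert assms(1) by (simp add: spin_sum_insert)
  then show ?case using insert by (simp add: spin_sum_cmult)
qed auto

text \<open>The factor \<open>1 + \<sigma> u\<close> is 2 at spin +1 and 0 at spin -1. Pinning is
  expressed by a weight so that it becomes one more factor of the kind that Griffiths' inequalities
  handle.\<close>

lemma spin_sum_pinned:
  assumes "finite V" "finite D" "V \<inter> D = {}"
  shows "spin_sum (V \<union> D) (\<lambda>\<sigma>. f \<sigma> * (\<Prod>u\<in>D. 1 + \<sigma> u)) =
    2 ^ card D * spin_sum V (\<lambda>\<sigma>. f (\<lambda>u. if u \<in> D then 1 else \<sigma> u))"
  using assms(2,3)
proof (induction D arbitrary: f)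
  case (insert u D)
  have P: "(\<Prod>w\<in>D. 1 + (\<sigma>(u := s)) w) = (\<Prod>w\<in>D. 1 + \<sigma> w)" for \<sigma> :: "'a \<Rightarrow> real" and s
    by (rule prod.cong) (use insert.hyps in auto)
  have "spin_sum (V \<union> insert u D) (\<lambda>\<sigma>. f \<sigma> * (\<Prod>u\<in>insert u D. 1 + \<sigma> u)) =
     spin_sum (V \<union> D) (\<lambda>\<sigma>. (2 * f (\<sigma>(u := 1))) * (\<Prod>u\<in>D. 1 + \<sigma> u))"
    using insert assms(1) by (simp add: spin_sum_insert P algebra_simps del: fun_upd_apply)
      (simp add: algebra_simps)
  also have "\<dots> = 2 ^ card D * spin_sum V (\<lambda>\<sigma>. 2 * f ((\<lambda>w. if w \<in> D then 1 else \<sigma> w)(u := 1)))"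
    using insert by (subst insert.IH) auto
  also have "(\<lambda>\<sigma>. 2 * f ((\<lambda>w. if w \<in> D then 1 else \<sigma> w)(u := 1))) =
     (\<lambda>\<sigma>. 2 * f (\<lambda>w. if w \<in> insert u D then 1 else \<sigma> w))"
    by (intro ext arg_cong[of _ _ "\<lambda>x. 2 * f x"]) auto
  finally show ?case using insert by (simp add: spin_sum_cmult)
qed auto

lemma spin_sum_bij:
  assumes f: "bij_betw f V V'"
  shows "spin_sum V' F = spin_sum V (\<lambda>\<sigma>. F (\<lambda>u\<in>V'. \<sigma> (inv_into V f u)))"
proof -
  have fV: "f u \<in> V'" "inv_into V f (f u) = u" if "u \<in> V" for u
    using f that by (auto simp: bij_betw_def)
  have iV: "inv_into V f u \<in> V" "f (inv_into V f u) = u" if "u \<in> V'" for u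
    using f that by (auto simp: bij_betw_def inv_into_into f_inv_into_f)
  have push: "(\<lambda>u\<in>V'. (\<lambda>u\<in>V. \<sigma> (f u)) (inv_into V f u)) = \<sigma>" if "\<sigma> \<in> V' \<rightarrow>\<^sub>E {-1, 1}" for \<sigma> :: "_ \<Rightarrow> real"
    using that by (intro ext) (auto simp: iV PiE_iff extensional_def)
  have pull: "(\<lambda>u\<in>V. (\<lambda>u\<in>V'. \<sigma> (inv_into V f u)) (f u)) = \<sigma>" if "\<sigma> \<in> V \<rightarrow>\<^sub>E {-1, 1}" for \<sigma> :: "_ \<Rightarrow> real"
    using that by (intro ext) (auto simp: fV PiE_iff extensional_def)
  show ?thesis
    unfolding spin_sum_def
    by (rule sum.reindex_bij_witness[of _ "\<lambda>\<sigma>. \<lambda>u\<in>V'. \<sigma> (inv_into V f u)" "\<lambda>\<tau>. \<lambda>u\<in>V. \<tau> (f u)"])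
      (use fV iV push pull in \<open>auto simp: PiE_iff\<close>)
qed

text \<open>The sum factorizes over the vertices, and each factor is 2 or 0 according to the parity
  of the multiplicity in \<open>A\<close>.\<close>

lemma spin_sum_prod_nonneg:
  assumes "finite V" "set_mset A \<subseteq> V"
  shows "0 \<le> spin_sum V (\<lambda>\<sigma>. spin_prod \<sigma> A)"
proof -
  have "spin_prod \<sigma> A = (\<Prod>u\<in>V. \<sigma> u ^ count A u)" for \<sigma> :: "'a \<Rightarrow> real"
  proof -
    have "spin_prod \<sigma> A = (\<Prod>u\<in>set_mset A. \<sigma> u ^ count A u)"
      unfolding spin_prod_def by (rule image_prod_mset_multiplicity)
    also have "\<dots> = (\<Prod>u\<in>V. \<sigma> u ^ count A u)"
      by (rule prod.mono_neutral_left) (use assms in \<open>auto simp: not_in_iff\<close>)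
    finally show ?thesis .
  qed
  then have "spin_sum V (\<lambda>\<sigma>. spin_prod \<sigma> A) = (\<Prod>u\<in>V. 1 ^ count A u + (-1) ^ count A u)"
    using spin_sum_prod[OF assms(1), of "\<lambda>u s. s ^ count A u"] by simp
  also have "\<dots> \<ge> 0" by (intro prod_nonneg) (auto simp: minus_one_power_iff)
  finally show ?thesis .
qed

text \<open>Multiplying out one factor at a time leaves nonnegative coefficients times sums of spin
  products. The affine form of the factors covers Boltzmann weights, by exp (K s) = cosh K + s sinh
  K for a sign s, as well as pinning factors.\<close>

lemma griffiths_first:
  assumes "finite I" "finite V" "set_mset A \<subseteq> V" "\<And>i. i \<in> I \<Longrightarrow> set_mset (S i) \<subseteq> V"
    and "\<And>i. i \<in> I \<Longrightarrow> 0 \<le> a i" "\<And>i. i \<in> I \<Longrightarrow> 0 \<le> b i"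
  shows "0 \<le> spin_sum V (\<lambda>\<sigma>. spin_prod \<sigma> A * (\<Prod>i\<in>I. a i + b i * spin_prod \<sigma> (S i)))"
  using assms(1,3-)
proof (induction I arbitrary: A)
  case empty
  then show ?case using spin_sum_prod_nonneg assms(2) by simp
next
  case (insert j I)
  let ?P = "\<lambda>\<sigma>. \<Prod>i\<in>I. a i + b i * spin_prod \<sigma> (S i)"
  have "spin_sum V (\<lambda>\<sigma>. spin_prod \<sigma> A * (\<Prod>i\<in>insert j I. a i + b i * spin_prod \<sigma> (S i))) =
    a j * spin_sum V (\<lambda>\<sigma>. spin_prod \<sigma> A * ?P \<sigma>) +
    b j * spin_sum V (\<lambda>\<sigma>. spin_prod \<sigma> (A + S j) * ?P \<sigma>)"
    using insert.hyps
    by (simp add: spin_prod_add algebra_simps flip: spin_sum_add spin_sum_cmult)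
  also have "\<dots> \<ge> 0"
    using insert.prems by (intro add_nonneg_nonneg mult_nonneg_nonneg insert.IH) auto
  finally show ?case .
qed

text \<open>Pointwise multiplication by a fixed configuration of signs is an involution of the
  configurations.\<close>

lemma spin_sum_twist:
  assumes "\<sigma> \<in> V \<rightarrow>\<^sub>E {-1, 1}"
  shows "spin_sum V f = spin_sum V (\<lambda>\<tau>. f (\<lambda>u\<in>V. \<sigma> u * \<tau> u))"
  unfolding spin_sum_def
proof (rule sum.reindex_bij_witness[of _ "\<lambda>\<tau>. \<lambda>u\<in>V. \<sigma> u * \<tau> u" "\<lambda>\<tau>. \<lambda>u\<in>V. \<sigma> u * \<tau> u"])
  have sq: "\<sigma> u * \<sigma> u = 1" if "u \<in> V" for u using spin_values[OF assms that] by auto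
  fix \<tau> :: "'a \<Rightarrow> real" assume t: "\<tau> \<in> V \<rightarrow>\<^sub>E {-1, 1}"
  show *: "(\<lambda>u\<in>V. \<sigma> u * (\<lambda>u\<in>V. \<sigma> u * \<tau> u) u) = \<tau>"
  proof
    fix u show "(\<lambda>u\<in>V. \<sigma> u * (\<lambda>u\<in>V. \<sigma> u * \<tau> u) u) u = \<tau> u"
      using sq[of u] t by (auto simp: PiE_iff extensional_def simp flip: mult.assoc)
  qed
  then show "(\<lambda>u\<in>V. \<sigma> u * (\<lambda>u\<in>V. \<sigma> u * \<tau> u) u) = \<tau>" .
  have "\<sigma> u * \<tau> u \<in> {-1, 1}" if "u \<in> V" for u
    using spin_values[OF t that] spin_values[OF assms that] by auto
  then show "(\<lambda>u\<in>V. \<sigma> u * \<tau> u) \<in> V \<rightarrow>\<^sub>E {-1, 1}" by (simp add: PiE_iff)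
  then show "(\<lambda>u\<in>V. \<sigma> u * \<tau> u) \<in> V \<rightarrow>\<^sub>E {-1, 1}" .
  from * show "f (\<lambda>u\<in>V. \<sigma> u * (\<lambda>u\<in>V. \<sigma> u * \<tau> u) u) = f \<tau>" by simp
qed

lemma spin_prod_mult:
  "set_mset A \<subseteq> V \<Longrightarrow> spin_prod (\<lambda>u\<in>V. \<sigma> u * \<tau> u) A = spin_prod \<sigma> A * spin_prod \<tau> A"
  by (induction A) auto

text \<open>Ginibre's duplication: after the substitution \<open>\<sigma>' = \<sigma> \<tau>\<close> in the doubled system, the sum over
  \<open>\<sigma>\<close> has nonnegative coefficients for each fixed \<open>\<tau>\<close>.\<close>

lemma griffiths_comparison:
  fixes V :: "'v set"
  assumes fin: "finite I" "finite V" and A: "set_mset A \<subseteq> V" and S: "\<And>i. i \<in> I \<Longrightarrow> set_mset (S i) \<subseteq> V"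
    and a: "\<And>i. i \<in> I \<Longrightarrow> \<bar>b i\<bar> \<le> a i" and a': "\<And>i. i \<in> I \<Longrightarrow> \<bar>b' i\<bar> \<le> a' i"
    and le: "\<And>i. i \<in> I \<Longrightarrow> \<bar>b i\<bar> * a' i \<le> b' i * a i"
  defines "W \<equiv> \<lambda>\<sigma>. \<Prod>i\<in>I. a i + b i * spin_prod \<sigma> (S i)"
    and "W' \<equiv> \<lambda>\<sigma>. \<Prod>i\<in>I. a' i + b' i * spin_prod \<sigma> (S i)"
  shows "spin_sum V (\<lambda>\<sigma>. spin_prod \<sigma> A * W \<sigma>) * spin_sum V W' \<le>
         spin_sum V (\<lambda>\<sigma>. spin_prod \<sigma> A * W' \<sigma>) * spin_sum V W"
proof -
  \<comment> \<open>The product of the \<open>i\<close>-th factors of the two copies after the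
    substitution, simplified by the fact that a spin product squares to 1. For fixed \<tau> it is
    again affine in the spin product of \<sigma>, so \<open>griffiths_first\<close> applies.\<close>
  define T where "T \<tau> \<sigma> = (\<Prod>i\<in>I. (a i * a' i + b i * b' i * spin_prod \<tau> (S i)) +
      (b' i * a i + a' i * b i * spin_prod \<tau> (S i)) * spin_prod \<sigma> (S i))" for \<tau> \<sigma> :: "'v \<Rightarrow> real"
  have "spin_sum V (\<lambda>\<sigma>. spin_prod \<sigma> A * W' \<sigma>) * spin_sum V W
      - spin_sum V (\<lambda>\<sigma>. spin_prod \<sigma> A * W \<sigma>) * spin_sum V W'
    = spin_sum V (\<lambda>\<sigma>. spin_sum V (\<lambda>\<tau>. (spin_prod \<sigma> A - spin_prod \<tau> A) * (W' \<sigma> * W \<tau>)))"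
    unfolding spin_sum_def sum_product
    by (subst (2) sum.swap) (simp add: algebra_simps flip: sum_subtractf)
  also have "\<dots> = spin_sum V (\<lambda>\<sigma>. spin_sum V (\<lambda>\<tau>. (1 - spin_prod \<tau> A) * (spin_prod \<sigma> A * T \<tau> \<sigma>)))"
  proof (rule spin_sum_cong)
    fix \<sigma> assume s: "\<sigma> \<in> V \<rightarrow>\<^sub>E {-1, 1::real}"
    have W: "W' \<sigma> * W (\<lambda>u\<in>V. \<sigma> u * \<tau> u) = T \<tau> \<sigma>" for \<tau>
      unfolding W_def W'_def T_def prod.distrib[symmetric]
    proof (rule prod.cong)
      fix i assume i: "i \<in> I"
      have "spin_prod \<sigma> (S i) * spin_prod \<sigma> (S i) = 1" using spin_prod_values[OF s S[OF i]] by auto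
      then have "b' i * (b i * spin_prod \<tau> (S i)) * (spin_prod \<sigma> (S i) * spin_prod \<sigma> (S i)) =
        b' i * (b i * spin_prod \<tau> (S i))" by simp
      then show "(a' i + b' i * spin_prod \<sigma> (S i)) * (a i + b i * spin_prod (\<lambda>u\<in>V. \<sigma> u * \<tau> u) (S i)) =
        (a i * a' i + b i * b' i * spin_prod \<tau> (S i)) +
        (b' i * a i + a' i * b i * spin_prod \<tau> (S i)) * spin_prod \<sigma> (S i)"
        unfolding spin_prod_mult[OF S[OF i]] by (simp add: algebra_simps)
    qed simp
    show "spin_sum V (\<lambda>\<tau>. (spin_prod \<sigma> A - spin_prod \<tau> A) * (W' \<sigma> * W \<tau>)) =
      spin_sum V (\<lambda>\<tau>. (1 - spin_prod \<tau> A) * (spin_prod \<sigma> A * T \<tau> \<sigma>))"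
      by (subst spin_sum_twist[OF s]) (simp add: spin_prod_mult[OF A] algebra_simps flip: W)
  qed
  also have "\<dots> = spin_sum V (\<lambda>\<tau>. (1 - spin_prod \<tau> A) * spin_sum V (\<lambda>\<sigma>. spin_prod \<sigma> A * T \<tau> \<sigma>))"
    unfolding spin_sum_def sum_distrib_left by (rule sum.swap)
  also have "\<dots> \<ge> 0"
  proof (rule spin_sum_nonneg, rule mult_nonneg_nonneg)
    fix \<tau> assume t: "\<tau> \<in> V \<rightarrow>\<^sub>E {-1, 1::real}"
    show "0 \<le> 1 - spin_prod \<tau> A" using spin_prod_values[OF t A] by auto
    show "0 \<le> spin_sum V (\<lambda>\<sigma>. spin_prod \<sigma> A * T \<tau> \<sigma>)"
      unfolding T_def
    proof (rule griffiths_first[OF fin A S])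
      fix i assume i: "i \<in> I"
      have "\<bar>b i * b' i\<bar> \<le> a i * a' i"
        unfolding abs_mult using a[OF i] a'[OF i] by (intro mult_mono) auto
      then show "0 \<le> a i * a' i + b i * b' i * spin_prod \<tau> (S i)"
        using spin_prod_values[OF t S[OF i]] by auto
      \<comment> \<open>The hypothesis \<open>le\<close> is exactly the nonnegativity of this
        coefficient for both signs of the spin product of \<tau>.\<close>
      have "\<bar>a' i * b i\<bar> \<le> b' i * a i"
        using le[OF i] a'[OF i] by (simp add: abs_mult mult.commute)
      then show "0 \<le> b' i * a i + a' i * b i * spin_prod \<tau> (S i)"
        using spin_prod_values[OF t S[OF i]] by auto
    qed
  qed
  finally show ?thesis by simp
qed

section \<open>The Ising model on a tree\<close>

text \<open>The field that a leaf with field \<open>x\<close> exerts on its neighbour, through a coupling \<open>J\<close>.\<close>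

definition leaf_field :: "real \<Rightarrow> real \<Rightarrow> real" where
  "leaf_field J x = (ln (cosh (x + J)) - ln (cosh (x - J))) / 2"

lemma leaf_field_deriv:
  "(leaf_field J has_real_derivative (tanh (x + J) - tanh (x - J)) / 2) (at x)"
  unfolding leaf_field_def [abs_def] by (auto intro!: derivative_eq_intros simp: tanh_def mult.commute)

lemma tanh_concave: "concave_on {0..} (tanh :: real \<Rightarrow> real)"
proof (rule f''_le0_imp_concave[where f' = "\<lambda>x. 1 - tanh x ^ 2" and f'' = "\<lambda>x. - 2 * tanh x * (1 - tanh x ^ 2)"])
  fix x :: real assume "x \<in> {0..}"
  then have "0 \<le> tanh x" "tanh x ^ 2 \<le> 1"
    using tanh_real_bounds[of x] by (auto simp: abs_square_le_1)
  then have "0 \<le> tanh x * (1 - (tanh x)\<^sup>2)" by simp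
  then show "- 2 * tanh x * (1 - (tanh x)\<^sup>2) \<le> 0" by simp
qed (auto intro!: derivative_eq_intros)

text \<open>The second derivative has the sign of tanh(x - J)^2 - tanh(x + J)^2, and |x - J| is at
  most x + J when both are nonnegative. The function is odd, so on negative fields it is convex
  instead: this is where the argument depends on positive fields.\<close>

lemma leaf_field_concave:
  assumes "0 \<le> J" shows "concave_on {0..} (leaf_field J)"
proof (rule f''_le0_imp_concave[where f' = "\<lambda>x. (tanh (x + J) - tanh (x - J)) / 2"
      and f'' = "\<lambda>x. (tanh (x - J) ^ 2 - tanh (x + J) ^ 2) / 2"])
  fix x :: real assume x: "x \<in> {0..}"
  have "\<bar>tanh (x - J)\<bar> = tanh \<bar>x - J\<bar>" by simp
  also have "tanh \<bar>x - J\<bar> \<le> tanh (x + J)" unfolding tanh_real_le_iff using x assms by auto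
  finally have "tanh (x - J) ^ 2 \<le> tanh (x + J) ^ 2" using power_mono[of "\<bar>tanh (x - J)\<bar>" _ 2] by simp
  then show "(tanh (x - J) ^ 2 - tanh (x + J) ^ 2) / 2 \<le> 0" by simp
qed (auto intro!: derivative_eq_intros leaf_field_deriv)

lemma leaf_field_mono:
  assumes "0 \<le> J" "x \<le> y" shows "leaf_field J x \<le> leaf_field J y"
  using assms(2) by (rule DERIV_nonneg_imp_nondecreasing) (use leaf_field_deriv assms in fastforce)

lemma leaf_field_zero [simp]: "leaf_field J 0 = 0"
  by (simp add: leaf_field_def)

lemma leaf_field_nonneg: "0 \<le> J \<Longrightarrow> 0 \<le> x \<Longrightarrow> 0 \<le> leaf_field J x"
  using leaf_field_mono[of J 0 x] by simp

text \<open>Strictness makes the ratio \<open>J / leaf_field J c\<close> finite; the constant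
  \<open>C\<close> of the tree estimate is chosen from it.\<close>

lemma leaf_field_pos:
  assumes "0 < J" "0 < x" shows "0 < leaf_field J x"
proof -
  have "cosh (x - J) = cosh \<bar>x - J\<bar>" by (simp add: cosh_def abs_if)
  also have "\<dots> < cosh (x + J)" using assms by (subst cosh_real_nonneg_less_iff) auto
  finally show ?thesis by (simp add: leaf_field_def)
qed

text \<open>Any positive function of a sign \<open>s\<close> has the form K exp (y s). Summing out a
  leaf spin produces such a function of the neighbouring spin, and its y is
  \<open>leaf_field J x\<close>.\<close>

lemma leaf_sum:
  assumes "s = 1 \<or> s = -1"
  shows "exp (x + J * s) + exp (- x - J * s) =
    2 * exp ((ln (cosh (x + J)) + ln (cosh (x - J))) / 2) * exp (leaf_field J x * s)"
proof -
  have "exp (x + J * s) + exp (- x - J * s) = 2 * cosh (x + J * s)" by (simp add: cosh_def)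
  also have "cosh (x + J * s) = exp (ln (cosh (x + J * s)))" by simp
  also have "ln (cosh (x + J * s)) = (ln (cosh (x + J)) + ln (cosh (x - J))) / 2 + leaf_field J x * s"
    using assms by (auto simp: leaf_field_def field_simps)
  finally show ?thesis by (simp add: exp_add)
qed

text \<open>Every vertex \<open>u\<close> other than the root stands for the edge from
  \<open>u\<close> to \<open>par u\<close>.\<close>

definition tree_weight :: "'v set \<Rightarrow> 'v \<Rightarrow> ('v \<Rightarrow> 'v) \<Rightarrow> real \<Rightarrow> ('v \<Rightarrow> real) \<Rightarrow> ('v \<Rightarrow> real) \<Rightarrow> real" where
  "tree_weight V r par J x \<sigma> = exp (J * (\<Sum>u\<in>V - {r}. \<sigma> u * \<sigma> (par u)) + (\<Sum>u\<in>V. x u * \<sigma> u))"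

definition tree_mag :: "'v set \<Rightarrow> 'v \<Rightarrow> ('v \<Rightarrow> 'v) \<Rightarrow> real \<Rightarrow> ('v \<Rightarrow> real) \<Rightarrow> real" where
  "tree_mag V r par J x =
     spin_sum V (\<lambda>\<sigma>. \<sigma> r * tree_weight V r par J x \<sigma>) / spin_sum V (tree_weight V r par J x)"

lemma tree_mag_cong:
  assumes "\<And>u. u \<in> V \<Longrightarrow> x u = y u"
  shows "tree_mag V r par J x = tree_mag V r par J y"
proof -
  have "tree_weight V r par J x = tree_weight V r par J y"
    unfolding tree_weight_def using assms by (intro ext arg_cong[of _ _ exp] arg_cong2[of _ _ _ _ "(+)"] sum.cong) auto
  then show ?thesis by (simp add: tree_mag_def)
qed

text \<open>Summing over the spin of the leaf multiplies numerator and denominator by the same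
  constant and moves \<open>leaf_field J (x u)\<close> to the field of the parent.\<close>

lemma tree_mag_leaf:
  assumes V: "finite V" "u \<in> V" "u \<noteq> r" "par u \<in> V" "par u \<noteq> u" and r: "r \<in> V"
    and leaf: "\<And>w. w \<in> V \<Longrightarrow> w \<noteq> r \<Longrightarrow> par w \<noteq> u"
  shows "tree_mag V r par J x = tree_mag (V - {u}) r par J (x(par u := x (par u) + leaf_field J (x u)))"
proof -
  let ?U = "V - {u}" and ?p = "par u"
  let ?y = "x(?p := x ?p + leaf_field J (x u))"
  define K where "K = 2 * exp ((ln (cosh (x u + J)) + ln (cosh (x u - J))) / 2)"
  have W: "tree_weight V r par J x (\<sigma>(u := s)) =
      exp (J * (\<Sum>w\<in>?U - {r}. \<sigma> w * \<sigma> (par w)) + (\<Sum>w\<in>?U. x w * \<sigma> w)) * exp (x u * s + J * s * \<sigma> ?p)" for \<sigma> s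
  proof -
    have 1: "(\<Sum>w\<in>V - {r}. (\<sigma>(u := s)) w * (\<sigma>(u := s)) (par w)) =
        s * \<sigma> ?p + (\<Sum>w\<in>?U - {r}. \<sigma> w * \<sigma> (par w))"
    proof -
      have "V - {r} - {u} = ?U - {r}" by auto
      then have "(\<Sum>w\<in>V - {r}. (\<sigma>(u := s)) w * (\<sigma>(u := s)) (par w)) =
        s * \<sigma> ?p + (\<Sum>w\<in>?U - {r}. (\<sigma>(u := s)) w * (\<sigma>(u := s)) (par w))"
        using V sum.remove[of "V - {r}" u "\<lambda>w. (\<sigma>(u := s)) w * (\<sigma>(u := s)) (par w)"] by simp
      also have "(\<Sum>w\<in>?U - {r}. (\<sigma>(u := s)) w * (\<sigma>(u := s)) (par w)) = (\<Sum>w\<in>?U - {r}. \<sigma> w * \<sigma> (par w))"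
        by (rule sum.cong) (use leaf in auto)
      finally show ?thesis .
    qed
    have 2: "(\<Sum>w\<in>V. x w * (\<sigma>(u := s)) w) = x u * s + (\<Sum>w\<in>?U. x w * \<sigma> w)"
      using V by (subst sum.remove[of V u]) auto
    show ?thesis unfolding tree_weight_def 1 2 by (simp add: algebra_simps exp_add)
  qed
  have Y: "(\<Sum>w\<in>?U. ?y w * \<sigma> w) = (\<Sum>w\<in>?U. x w * \<sigma> w) + leaf_field J (x u) * \<sigma> ?p" for \<sigma>
    using V by (subst (1 2) sum.remove[of ?U ?p]) (auto simp: algebra_simps)
  have sum: "tree_weight V r par J x (\<sigma>(u := 1)) + tree_weight V r par J x (\<sigma>(u := -1)) =
      K * tree_weight ?U r par J ?y \<sigma>" if "\<sigma> \<in> ?U \<rightarrow>\<^sub>E {-1, 1}" for \<sigma>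
  proof -
    have "\<sigma> ?p = 1 \<or> \<sigma> ?p = -1" using spin_values[OF that, of ?p] V by auto
    note leaf_sum[OF this, of "x u" J]
    then show ?thesis unfolding W K_def tree_weight_def[of ?U] Y
      by (simp add: exp_add distrib_left[symmetric])
  qed
  have Vu: "V = insert u ?U" using V by auto
  have "spin_sum V (tree_weight V r par J x) = K * spin_sum ?U (tree_weight ?U r par J ?y)"
    unfolding spin_sum_cmult[symmetric]
    by (subst Vu, subst spin_sum_insert) (use V sum in \<open>auto intro!: spin_sum_cong simp del: insert_Diff_single\<close>)
  moreover have "spin_sum V (\<lambda>\<sigma>. \<sigma> r * tree_weight V r par J x \<sigma>) =
      K * spin_sum ?U (\<lambda>\<sigma>. \<sigma> r * tree_weight ?U r par J ?y \<sigma>)"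
    unfolding spin_sum_cmult[symmetric]
  proof (subst Vu, subst spin_sum_insert)
    show "spin_sum ?U (\<lambda>\<sigma>. (\<sigma>(u := 1)) r * tree_weight V r par J x (\<sigma>(u := 1)) +
        (\<sigma>(u := - 1)) r * tree_weight V r par J x (\<sigma>(u := - 1))) =
      spin_sum ?U (\<lambda>\<sigma>. K * (\<sigma> r * tree_weight ?U r par J ?y \<sigma>))"
    proof (rule spin_sum_cong)
      fix \<sigma> assume "\<sigma> \<in> ?U \<rightarrow>\<^sub>E {-1, 1::real}"
      from arg_cong[OF sum[OF this], of "\<lambda>z. \<sigma> r * z"]
      show "(\<sigma>(u := 1)) r * tree_weight V r par J x (\<sigma>(u := 1)) +
          (\<sigma>(u := - 1)) r * tree_weight V r par J x (\<sigma>(u := - 1)) =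
        K * (\<sigma> r * tree_weight ?U r par J ?y \<sigma>)"
        using V by (simp add: algebra_simps)
    qed
  qed (use V in auto)
  moreover have "K \<noteq> 0" by (simp add: K_def)
  ultimately show ?thesis by (simp add: tree_mag_def)
qed

lemma tree_mag_singleton: "tree_mag {r} r par J x = tanh (x r)"
proof -
  have "tree_mag {r} r par J x = (exp (x r) - exp (- x r)) / (exp (x r) + exp (- x r))"
    using spin_sum_insert[of "{}" r] by (simp add: tree_mag_def tree_weight_def)
  then show ?thesis by (simp add: tanh_altdef)
qed

text \<open>\<open>dep\<close> only certifies that iterating \<open>par\<close> ends at the root. It
  need not be the distance to the root, so the same \<open>dep\<close> still serves after a leaf has
  been removed.\<close>

locale rooted_tree =
  fixes V :: "'v set" and r :: 'v and par :: "'v \<Rightarrow> 'v" and dep :: "'v \<Rightarrow> nat"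
  assumes finite_V: "finite V" and root: "r \<in> V"
    and par: "\<And>u. u \<in> V \<Longrightarrow> u \<noteq> r \<Longrightarrow> par u \<in> V \<and> dep (par u) < dep u"

text \<open>A vertex of maximal \<open>dep\<close> among those other than the root is nobody's
  parent.\<close>

lemma rooted_tree_induct [consumes 1, case_names root leaf]:
  assumes "rooted_tree V r par dep"
    and "P {r}"
    and "\<And>V u. rooted_tree V r par dep \<Longrightarrow> rooted_tree (V - {u}) r par dep \<Longrightarrow> u \<in> V \<Longrightarrow> u \<noteq> r \<Longrightarrow>
          (\<And>w. w \<in> V \<Longrightarrow> w \<noteq> r \<Longrightarrow> par w \<noteq> u) \<Longrightarrow> P (V - {u}) \<Longrightarrow> P V"
  shows "P V"
  using assms(1)
proof (induction "card V" arbitrary: V rule: less_induct)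
  case less
  interpret rooted_tree V r par dep by fact
  show ?case
  proof (cases "V = {r}")
    case False
    then have ne: "V - {r} \<noteq> {}" using root by auto
    have "Max (dep ` (V - {r})) \<in> dep ` (V - {r})" using finite_V ne by (intro Max_in) auto
    then obtain u where "u \<in> V - {r}" "Max (dep ` (V - {r})) = dep u" by (rule imageE) simp
    then have u: "u \<in> V" "u \<noteq> r" and "dep u = Max (dep ` (V - {r}))" by auto
    then have max: "\<And>w. w \<in> V - {r} \<Longrightarrow> dep w \<le> dep u" using finite_V by simp
    have leaf: "par w \<noteq> u" if "w \<in> V" "w \<noteq> r" for w
      using par[OF that] max[of w] that by (metis DiffI leD singletonD)
    have "rooted_tree (V - {u}) r par dep"
      by unfold_locales (use finite_V root u par leaf in auto)
    moreover from this have "P (V - {u})"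
      using u finite_V by (intro less.hyps card_Diff1_less)
    ultimately show ?thesis using assms(3)[OF less.prems] u leaf by blast
  qed (use assms(2) in simp)
qed

lemma tree_mag_mono:
  assumes "rooted_tree V r par dep" "0 \<le> J" "\<And>u. u \<in> V \<Longrightarrow> x u \<le> y u"
  shows "tree_mag V r par J x \<le> tree_mag V r par J y"
  using assms(1,3)
proof (induction arbitrary: x y rule: rooted_tree_induct)
  case (leaf V u)
  interpret rooted_tree V r par dep by fact
  note L = tree_mag_leaf[where par = par and u = u, OF finite_V leaf.hyps(3,4) _ _ root leaf.hyps(5)]
  have "par u \<noteq> u" using par[OF leaf.hyps(3,4)] by auto
  moreover have "leaf_field J (x u) \<le> leaf_field J (y u)"
    using leaf assms(2) by (intro leaf_field_mono) auto
  moreover have p: "par u \<in> V" using par[OF leaf.hyps(3,4)] by simp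
  moreover have "x (par u) + leaf_field J (x u) \<le> y (par u) + leaf_field J (y u)"
    using calculation leaf.prems[OF p] by simp
  ultimately show ?case
    using leaf.prems by (subst (1 2) L) (auto intro!: leaf.IH split: if_splits)
qed (auto simp: tree_mag_singleton)

text \<open>The Griffiths-Hurst-Sherman inequality for the root of a tree. Removing a leaf replaces
  the fields by a concave function of the fields, and the magnetization of the smaller tree is
  concave by induction and monotone by \<open>tree_mag_mono\<close>.\<close>

lemma tree_mag_concave:
  assumes "rooted_tree V r par dep" "0 \<le> J" "\<And>u. u \<in> V \<Longrightarrow> 0 \<le> x u" "\<And>u. u \<in> V \<Longrightarrow> 0 \<le> y u"
    and l: "0 \<le> l" "l \<le> 1"
  shows "(1 - l) * tree_mag V r par J x + l * tree_mag V r par J y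
    \<le> tree_mag V r par J (\<lambda>u. (1 - l) * x u + l * y u)"
  using assms(1,3,4)
proof (induction arbitrary: x y rule: rooted_tree_induct)
  case root
  then show ?case using concave_onD[OF tanh_concave, of l "x r" "y r"] l by (simp add: tree_mag_singleton)
next
  case (leaf V u)
  interpret rooted_tree V r par dep by fact
  note u = leaf.hyps(3,4)
  have p: "par u \<in> V" "par u \<noteq> u" using par[OF u] by auto
  define z where "z x = x(par u := x (par u) + leaf_field J (x u))" for x :: "'a \<Rightarrow> real"
  have L: "tree_mag V r par J x = tree_mag (V - {u}) r par J (z x)" for x
    unfolding z_def by (rule tree_mag_leaf[where par = par and u = u, OF finite_V u p root leaf.hyps(5)])
  have nn: "0 \<le> z x w" if "\<And>u. u \<in> V \<Longrightarrow> 0 \<le> x u" "w \<in> V - {u}" for x w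
    using that p u assms(2) by (auto simp: z_def intro!: add_nonneg_nonneg leaf_field_nonneg)
  have "(1 - l) * tree_mag V r par J x + l * tree_mag V r par J y
    \<le> tree_mag (V - {u}) r par J (\<lambda>w. (1 - l) * z x w + l * z y w)"
    unfolding L using leaf.prems by (intro leaf.IH nn) auto
  also have "\<dots> \<le> tree_mag (V - {u}) r par J (z (\<lambda>w. (1 - l) * x w + l * y w))"
  proof (rule tree_mag_mono[OF leaf.hyps(2) assms(2)])
    fix w assume "w \<in> V - {u}"
    show "(1 - l) * z x w + l * z y w \<le> z (\<lambda>w. (1 - l) * x w + l * y w) w"
      using concave_onD[OF leaf_field_concave[OF assms(2)] l, of "x u" "y u"] leaf.prems u
      by (auto simp: z_def algebra_simps)
  qed
  also have "\<dots> = tree_mag V r par J (\<lambda>w. (1 - l) * x w + l * y w)" by (rule L[symmetric])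
  finally show ?case .
qed

text \<open>All parents of vertices in \<open>D\<close> lie in \<open>V\<close>, so the vertices of
  \<open>D\<close> are leaves that do not affect each other's fields and can be removed in any
  order.\<close>

lemma tree_mag_remove_level:
  assumes "finite D" "finite V" "V \<inter> D = {}" "r \<in> V" "par ` D \<subseteq> V" "par ` (V - {r}) \<subseteq> V"
  shows "tree_mag (V \<union> D) r par J x =
    tree_mag V r par J (\<lambda>u. x u + (\<Sum>w\<in>{w \<in> D. par w = u}. leaf_field J (x w)))"
  using assms(1,3,5)
proof (induction D arbitrary: x)
  case (insert d D)
  let ?y = "x(par d := x (par d) + leaf_field J (x d))"
  have "tree_mag (V \<union> insert d D) r par J x = tree_mag (V \<union> insert d D - {d}) r par J ?y"
    by (rule tree_mag_leaf) (use insert assms in auto)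
  also have "V \<union> insert d D - {d} = V \<union> D" using insert by auto
  also have "tree_mag (V \<union> D) r par J ?y = tree_mag V r par J
      (\<lambda>u. ?y u + (\<Sum>w\<in>{w \<in> D. par w = u}. leaf_field J (?y w)))"
    using insert by (intro insert.IH) auto
  also have "\<dots> = tree_mag V r par J (\<lambda>u. x u + (\<Sum>w\<in>{w \<in> insert d D. par w = u}. leaf_field J (x w)))"
  proof (rule tree_mag_cong)
    fix u assume "u \<in> V"
    have "?y w = x w" if "w \<in> D" for w using that insert by auto
    then have "(\<Sum>w\<in>{w \<in> D. par w = u}. leaf_field J (?y w)) = (\<Sum>w\<in>{w \<in> D. par w = u}. leaf_field J (x w))"
      by (intro sum.cong) auto
    moreover have "{w \<in> insert d D. par w = u} = (if par d = u then insert d {w \<in> D. par w = u} else {w \<in> D. par w = u})"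
      by auto
    ultimately show "?y u + (\<Sum>w\<in>{w \<in> D. par w = u}. leaf_field J (?y w)) =
      x u + (\<Sum>w\<in>{w \<in> insert d D. par w = u}. leaf_field J (x w))"
      using insert.hyps by auto
  qed
  finally show ?case .
qed auto

text \<open>Summing out the level \<open>D\<close> adds at least \<open>leaf_field J c\<close> per child to a field, pinning it to \<open>+1\<close> adds \<open>J\<close>
  per child: these are two points of a ray, along which the magnetization is concave.\<close>

lemma tree_mag_level_bound:
  assumes V: "rooted_tree V r par dep" and D: "finite D" "V \<inter> D = {}" "par ` D \<subseteq> V"
    and J: "0 \<le> J" and c: "0 < c" "\<And>u. u \<in> V \<union> D \<Longrightarrow> c \<le> x u"
    and C: "1 \<le> C" "J \<le> C * leaf_field J c"
  shows "tree_mag V r par J (\<lambda>u. x u + J * card {w \<in> D. par w = u}) - tree_mag V r par J x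
    \<le> C * (tree_mag (V \<union> D) r par J x - tree_mag V r par J x)"
proof -
  interpret rooted_tree V r par dep by fact
  define n where "n u = real (card {w \<in> D. par w = u})" for u
  define M where "M s = tree_mag V r par J (\<lambda>u. x u + s * n u)" for s
  define b where "b = leaf_field J c"
  have n: "0 \<le> n u" for u by (simp add: n_def)
  have x: "0 \<le> x u" if "u \<in> V" for u using c that by (meson UnI1 less_imp_le order.trans)
  have b: "0 \<le> b" using leaf_field_nonneg J c by (simp add: b_def)
  \<comment> \<open>Pinned children amount to the point \<open>J\<close> of the ray; by the choice
    of \<open>C\<close> it lies below the point \<open>C * b\<close>.\<close>
  have "M J \<le> M (C * b)"
    unfolding M_def
  proof (rule tree_mag_mono[OF V J])
    fix u show "x u + J * n u \<le> x u + C * b * n u"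
      using mult_right_mono[OF C(2) n[of u]] by (simp add: b_def)
  qed
  \<comment> \<open>The point \<open>b\<close> is the convex combination of 0 and
    \<open>C * b\<close> with weight \<open>1 / C\<close> on the latter, which is why
    \<open>C\<close> is at least 1.\<close>
  moreover have "(1 - 1 / C) * M 0 + 1 / C * M (C * b) \<le> M b"
  proof -
    have "(1 - 1 / C) * M 0 + 1 / C * M (C * b)
      \<le> tree_mag V r par J (\<lambda>u. (1 - 1 / C) * (x u + 0 * n u) + 1 / C * (x u + C * b * n u))"
      unfolding M_def
    proof (rule tree_mag_concave[OF V J])
      fix u assume "u \<in> V"
      then show "0 \<le> x u + 0 * n u" "0 \<le> x u + C * b * n u"
        using x[of u] C(1) b n[of u] by (simp_all add: add_nonneg_nonneg)
    qed (use C in auto)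
    also have "(\<lambda>u. (1 - 1 / C) * (x u + 0 * n u) + 1 / C * (x u + C * b * n u)) = (\<lambda>u. x u + b * n u)"
      using C by (intro ext) (simp add: field_simps)
    finally show ?thesis by (simp add: M_def)
  qed
  then have "M (C * b) - M 0 \<le> C * (M b - M 0)" using C by (simp add: field_simps)
  moreover have "M b \<le> tree_mag (V \<union> D) r par J x"
  proof -
    have "tree_mag (V \<union> D) r par J x =
        tree_mag V r par J (\<lambda>u. x u + (\<Sum>w\<in>{w \<in> D. par w = u}. leaf_field J (x w)))"
      using D finite_V root par by (intro tree_mag_remove_level) auto
    also have "\<dots> \<ge> M b"
      unfolding M_def
    proof (rule tree_mag_mono[OF V J])
      fix u assume "u \<in> V"
      have "(\<Sum>w\<in>{w \<in> D. par w = u}. leaf_field J (x w)) \<ge> (\<Sum>w\<in>{w \<in> D. par w = u}. b)"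
        unfolding b_def by (intro sum_mono leaf_field_mono J c(2)) auto
      then show "x u + b * n u \<le> x u + (\<Sum>w\<in>{w \<in> D. par w = u}. leaf_field J (x w))"
        by (simp add: n_def mult.commute)
    qed
    finally show ?thesis .
  qed
  then have "C * (M b - M 0) \<le> C * (tree_mag (V \<union> D) r par J x - M 0)" using C by simp
  ultimately show ?thesis by (simp add: M_def n_def)
qed

section \<open>Sandwiching the magnetization between balls\<close>

text \<open>This is tanh |K| <= tanh K' without denominators, the form in which
  \<open>griffiths_comparison\<close> compares couplings; it expands sinh (K' - |K|) >= 0.\<close>

lemma sinh_cosh_compare:
  assumes "\<bar>K\<bar> \<le> (K' :: real)"
  shows "\<bar>sinh K\<bar> * cosh K' \<le> sinh K' * cosh K"
proof -
  have "0 \<le> sinh (K' - \<bar>K\<bar>)" using assms by simp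
  then show ?thesis by (simp add: sinh_diff mult.commute)
qed

lemma exp_spin:
  assumes "s = -1 \<or> s = (1 :: real)" shows "exp (K * s) = cosh K + sinh K * s"
  using assms by (auto simp: cosh_plus_sinh cosh_minus_sinh)

lemma abs_sinh_le_cosh: "\<bar>sinh K\<bar> \<le> cosh (K :: real)"
proof -
  have "\<bar>sinh K\<bar> = sinh \<bar>K\<bar>" by (simp add: abs_if)
  also have "\<dots> \<le> cosh \<bar>K\<bar>" using cosh_minus_sinh[of "\<bar>K\<bar>"] exp_ge_zero[of "- \<bar>K\<bar>"] by linarith
  finally show ?thesis by simp
qed

text \<open>The spins in \<open>P\<close> are pinned to \<open>+1\<close> in the larger system.\<close>

lemma griffiths_exp:
  fixes V :: "'v set"
  assumes fin: "finite I" "finite V" and A: "set_mset A \<subseteq> V" and S: "\<And>i. i \<in> I \<Longrightarrow> set_mset (S i) \<subseteq> V"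
    and K: "\<And>i. i \<in> I \<Longrightarrow> \<bar>K i\<bar> \<le> K' i" and P: "P \<subseteq> V"
  defines "W \<equiv> \<lambda>\<sigma>. exp (\<Sum>i\<in>I. K i * spin_prod \<sigma> (S i))"
    and "W' \<equiv> \<lambda>\<sigma>. exp (\<Sum>i\<in>I. K' i * spin_prod \<sigma> (S i)) * (\<Prod>u\<in>P. 1 + \<sigma> u)"
  shows "spin_sum V (\<lambda>\<sigma>. spin_prod \<sigma> A * W \<sigma>) * spin_sum V W' \<le>
         spin_sum V (\<lambda>\<sigma>. spin_prod \<sigma> A * W' \<sigma>) * spin_sum V W"
proof -
  have finP: "finite P" using P fin finite_subset by blast
  \<comment> \<open>The pinned sites are appended to the interactions. Their factor is the trivial
    \<open>1 + 0 * \<sigma> u\<close> in the smaller system and \<open>1 + 1 * \<sigma> u\<close> in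
    the larger one.\<close>
  let ?S = "case_sum S (\<lambda>u. {#u#})"
  let ?a = "case_sum (\<lambda>i. cosh (K i)) (\<lambda>u. 1)" and ?b = "case_sum (\<lambda>i. sinh (K i)) (\<lambda>u. 0)"
  let ?a' = "case_sum (\<lambda>i. cosh (K' i)) (\<lambda>u. 1)" and ?b' = "case_sum (\<lambda>i. sinh (K' i)) (\<lambda>u. 1)"
  have E: "exp (\<Sum>i\<in>I. k i * spin_prod \<sigma> (S i)) = (\<Prod>i\<in>I. cosh (k i) + sinh (k i) * spin_prod \<sigma> (S i))"
    if "\<sigma> \<in> V \<rightarrow>\<^sub>E {-1, 1}" for k \<sigma>
    unfolding exp_sum[OF fin(1)] by (intro prod.cong refl exp_spin spin_prod_values[OF that] S)
  have W: "W \<sigma> = (\<Prod>i\<in>I <+> P. ?a i + ?b i * spin_prod \<sigma> (?S i))"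
    and W': "W' \<sigma> = (\<Prod>i\<in>I <+> P. ?a' i + ?b' i * spin_prod \<sigma> (?S i))"
    if "\<sigma> \<in> V \<rightarrow>\<^sub>E {-1, 1}" for \<sigma>
    unfolding W_def W'_def E[OF that] using fin finP by (simp_all add: prod.Plus)
  have "spin_sum V (\<lambda>\<sigma>. spin_prod \<sigma> A * (\<Prod>i\<in>I <+> P. ?a i + ?b i * spin_prod \<sigma> (?S i))) *
      spin_sum V (\<lambda>\<sigma>. \<Prod>i\<in>I <+> P. ?a' i + ?b' i * spin_prod \<sigma> (?S i)) \<le>
      spin_sum V (\<lambda>\<sigma>. spin_prod \<sigma> A * (\<Prod>i\<in>I <+> P. ?a' i + ?b' i * spin_prod \<sigma> (?S i))) *
      spin_sum V (\<lambda>\<sigma>. \<Prod>i\<in>I <+> P. ?a i + ?b i * spin_prod \<sigma> (?S i))"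
    using fin finP A P K by (intro griffiths_comparison) (auto simp: abs_sinh_le_cosh sinh_cosh_compare dest: S[THEN subsetD])
  then show ?thesis
    by (simp only: spin_sum_cong[OF W] spin_sum_cong[OF W'] W W' cong: spin_sum_cong)
qed

section \<open>Free and plus boundary conditions on a set of vertices\<close>

definition edges_in :: "('v, 'e) mgraph \<Rightarrow> 'v set \<Rightarrow> 'e set" where
  "edges_in G W = {e \<in> edges G. set_mset (ends G e) \<subseteq> W}"

text \<open>Free boundary conditions: edges leaving \<open>W\<close> are dropped, but the field
  \<open>x\<close> is kept as it is. When \<open>x\<close> is computed from degrees, these are the
  degrees in \<open>G\<close>.\<close>

definition ising_weight :: "('v, 'e) mgraph \<Rightarrow> real \<Rightarrow> ('v \<Rightarrow> real) \<Rightarrow> 'v set \<Rightarrow> ('v \<Rightarrow> real) \<Rightarrow> real" where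
  "ising_weight G J x W \<sigma> = exp (J * (\<Sum>e\<in>edges_in G W. spin_prod \<sigma> (ends G e)) + (\<Sum>v\<in>W. x v * \<sigma> v))"

definition ising_mag :: "('v, 'e) mgraph \<Rightarrow> real \<Rightarrow> ('v \<Rightarrow> real) \<Rightarrow> 'v set \<Rightarrow> 'v \<Rightarrow> real" where
  "ising_mag G J x W v =
     spin_sum W (\<lambda>\<sigma>. \<sigma> v * ising_weight G J x W \<sigma>) / spin_sum W (ising_weight G J x W)"

lemma ising_weight_pos [simp]: "0 < ising_weight G J x W \<sigma>"
  by (simp add: ising_weight_def)

lemma ising_sum_pos: "finite W \<Longrightarrow> 0 < spin_sum W (ising_weight G J x W)"
  by (rule spin_sum_pos) auto

lemma ising_mag_bound:
  assumes "finite W" "v \<in> W" shows "\<bar>ising_mag G J x W v\<bar> \<le> 1"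
proof -
  have "\<bar>spin_sum W (\<lambda>\<sigma>. \<sigma> v * ising_weight G J x W \<sigma>)\<bar> \<le> spin_sum W (ising_weight G J x W)"
    unfolding spin_sum_def
  proof (rule order.trans[OF sum_abs], rule sum_mono)
    fix \<sigma> assume "\<sigma> \<in> W \<rightarrow>\<^sub>E {-1, 1::real}"
    from spin_values[OF this assms(2)]
    show "\<bar>\<sigma> v * ising_weight G J x W \<sigma>\<bar> \<le> ising_weight G J x W \<sigma>"
      using less_imp_le[OF ising_weight_pos[of G J x W \<sigma>]] by (auto simp: abs_mult)
  qed
  then show ?thesis using ising_sum_pos[OF assms(1), of G J x] by (simp add: ising_mag_def field_simps)
qed

lemma edges_in_verts: "wf_graph G \<Longrightarrow> edges_in G (verts G) = edges G"
  by (auto simp: edges_in_def wf_graph_def)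

text \<open>Couplings and fields vary from edge to edge and from vertex to vertex, so that setting
  some of them to 0 detaches a part of the graph.\<close>

lemma griffiths_graph:
  fixes G :: "('v, 'e) mgraph"
  assumes G: "finite_graph G" and v: "v \<in> verts G" and P: "P \<subseteq> verts G"
    and j: "\<And>e. e \<in> edges G \<Longrightarrow> \<bar>j e\<bar> \<le> j' e" and x: "\<And>u. u \<in> verts G \<Longrightarrow> \<bar>x u\<bar> \<le> x' u"
  defines "W \<equiv> \<lambda>j x \<sigma>. exp ((\<Sum>e\<in>edges G. j e * spin_prod \<sigma> (ends G e)) + (\<Sum>u\<in>verts G. x u * \<sigma> u))"
  shows "spin_sum (verts G) (\<lambda>\<sigma>. \<sigma> v * W j x \<sigma>) * spin_sum (verts G) (\<lambda>\<sigma>. W j' x' \<sigma> * (\<Prod>u\<in>P. 1 + \<sigma> u)) \<le>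
    spin_sum (verts G) (\<lambda>\<sigma>. \<sigma> v * (W j' x' \<sigma> * (\<Prod>u\<in>P. 1 + \<sigma> u))) * spin_sum (verts G) (W j x)"
proof -
  have wf: "wf_graph G" and fin: "finite (verts G)" "finite (edges G)" using G by (auto simp: finite_graph_def)
  define I :: "('e + 'v) set" where "I = edges G <+> verts G"
  define S :: "'e + 'v \<Rightarrow> 'v multiset" where "S = case_sum (ends G) (\<lambda>u. {#u#})"
  have W: "W j x \<sigma> = exp (\<Sum>i\<in>I. case_sum j x i * spin_prod \<sigma> (S i))" for j x \<sigma>
    using fin unfolding I_def W_def by (subst sum.Plus) (auto simp: S_def)
  have "spin_sum (verts G) (\<lambda>\<sigma>. spin_prod \<sigma> {#v#} * W j x \<sigma>) * spin_sum (verts G) (\<lambda>\<sigma>. W j' x' \<sigma> * (\<Prod>u\<in>P. 1 + \<sigma> u)) \<le>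
    spin_sum (verts G) (\<lambda>\<sigma>. spin_prod \<sigma> {#v#} * (W j' x' \<sigma> * (\<Prod>u\<in>P. 1 + \<sigma> u))) * spin_sum (verts G) (W j x)"
    unfolding W
  proof (rule griffiths_exp)
    show "finite I" using fin by (simp add: I_def)
    show "set_mset (S i) \<subseteq> verts G" if "i \<in> I" for i
      using that wf by (auto simp: I_def S_def wf_graph_def) blast
    show "\<bar>case_sum j x i\<bar> \<le> case_sum j' x' i" if "i \<in> I" for i using that j x by (auto simp: I_def)
  qed (use fin P v in auto)
  then show ?thesis by simp
qed

lemma ising_weight_verts:
  assumes "wf_graph G"
  shows "ising_weight G J x (verts G) \<sigma> = exp ((\<Sum>e\<in>edges G. J * spin_prod \<sigma> (ends G e)) + (\<Sum>u\<in>verts G. x u * \<sigma> u))"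
  by (simp add: ising_weight_def edges_in_verts[OF assms] sum_distrib_left)

text \<open>With the edges not inside \<open>W\<close> and the fields outside \<open>W\<close>
  switched off, the spins outside \<open>W\<close> are free and contribute the same power of 2 to
  numerator and denominator. Switching them on raises the magnetization by Griffiths'
  inequality.\<close>

lemma ising_mag_subset_le:
  fixes G :: "('v, 'e) mgraph"
  assumes G: "finite_graph G" and W: "W \<subseteq> verts G" and v: "v \<in> W" and J: "0 \<le> J"
    and x: "\<And>u. u \<in> verts G \<Longrightarrow> 0 \<le> x u"
  shows "ising_mag G J x W v \<le> ising_mag G J x (verts G) v"
proof -
  let ?V = "verts G" and ?E = "edges G"
  let ?j = "\<lambda>e. if set_mset (ends G e) \<subseteq> W then J else 0" and ?x = "\<lambda>u. if u \<in> W then x u else 0"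
  have wf: "wf_graph G" and fin: "finite ?V" "finite ?E" using G by (auto simp: finite_graph_def)
  have finW: "finite W" using W fin finite_subset by blast
  have K: "exp ((\<Sum>e\<in>?E. ?j e * spin_prod \<sigma> (ends G e)) + (\<Sum>u\<in>?V. ?x u * \<sigma> u)) = ising_weight G J x W \<sigma>" for \<sigma>
  proof -
    have "(\<Sum>e\<in>?E. ?j e * spin_prod \<sigma> (ends G e)) = J * (\<Sum>e\<in>edges_in G W. spin_prod \<sigma> (ends G e))"
      unfolding edges_in_def sum_distrib_left using fin by (intro sum.mono_neutral_cong_right) auto
    moreover have "(\<Sum>u\<in>?V. ?x u * \<sigma> u) = (\<Sum>u\<in>W. x u * \<sigma> u)"
      using fin W by (intro sum.mono_neutral_cong_right) auto
    ultimately show ?thesis by (simp add: ising_weight_def)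
  qed
  have "spin_sum ?V (\<lambda>\<sigma>. \<sigma> v * exp ((\<Sum>e\<in>?E. ?j e * spin_prod \<sigma> (ends G e)) + (\<Sum>u\<in>?V. ?x u * \<sigma> u))) *
      spin_sum ?V (\<lambda>\<sigma>. exp ((\<Sum>e\<in>?E. J * spin_prod \<sigma> (ends G e)) + (\<Sum>u\<in>?V. x u * \<sigma> u)) * (\<Prod>u\<in>{}. 1 + \<sigma> u)) \<le>
      spin_sum ?V (\<lambda>\<sigma>. \<sigma> v * (exp ((\<Sum>e\<in>?E. J * spin_prod \<sigma> (ends G e)) + (\<Sum>u\<in>?V. x u * \<sigma> u)) * (\<Prod>u\<in>{}. 1 + \<sigma> u))) *
      spin_sum ?V (\<lambda>\<sigma>. exp ((\<Sum>e\<in>?E. ?j e * spin_prod \<sigma> (ends G e)) + (\<Sum>u\<in>?V. ?x u * \<sigma> u)))"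
    by (rule griffiths_graph[OF G]) (use J x W v in auto)
  then have ge: "spin_sum ?V (\<lambda>\<sigma>. \<sigma> v * ising_weight G J x W \<sigma>) * spin_sum ?V (ising_weight G J x ?V) \<le>
      spin_sum ?V (\<lambda>\<sigma>. \<sigma> v * ising_weight G J x ?V \<sigma>) * spin_sum ?V (ising_weight G J x W)"
    unfolding K ising_weight_verts[OF wf, symmetric] by simp
  have cg: "ising_weight G J x W \<sigma> = ising_weight G J x W \<tau>" if "\<And>u. u \<in> W \<Longrightarrow> \<sigma> u = \<tau> u" for \<sigma> \<tau>
    unfolding ising_weight_def using that
    by (intro arg_cong[of _ _ exp] arg_cong2[of _ _ _ _ "(+)"] arg_cong2[of _ _ _ _ "(*)"] sum.cong refl spin_prod_cong)
      (auto simp: edges_in_def)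
  have "spin_sum (W \<union> (?V - W)) (\<lambda>\<sigma>. \<sigma> v * ising_weight G J x W \<sigma>) =
      2 ^ card (?V - W) * spin_sum W (\<lambda>\<sigma>. \<sigma> v * ising_weight G J x W \<sigma>)"
  proof (rule spin_sum_free)
    fix \<sigma> \<tau> :: "'v \<Rightarrow> real" assume eq: "\<And>u. u \<in> W \<Longrightarrow> \<sigma> u = \<tau> u"
    show "\<sigma> v * ising_weight G J x W \<sigma> = \<tau> v * ising_weight G J x W \<tau>"
      by (rule arg_cong2[where f = "(*)", OF eq[OF v] cg[OF eq]])
  qed (use fin finW in auto)
  moreover have "spin_sum (W \<union> (?V - W)) (ising_weight G J x W) =
      2 ^ card (?V - W) * spin_sum W (ising_weight G J x W)"
  proof (rule spin_sum_free)
    fix \<sigma> \<tau> :: "'v \<Rightarrow> real" assume "\<And>u. u \<in> W \<Longrightarrow> \<sigma> u = \<tau> u"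
    then show "ising_weight G J x W \<sigma> = ising_weight G J x W \<tau>" by (rule cg)
  qed (use fin finW in auto)
  moreover have "W \<union> (?V - W) = ?V" using W by auto
  ultimately show ?thesis
    using ge ising_sum_pos[of ?V G J x] fin ising_sum_pos[OF finW, of G J x]
    by (simp add: ising_mag_def divide_simps mult.commute[of "2 ^ _"])
qed

text \<open>Inserting the factors \<open>1 + \<sigma> u\<close> outside \<open>W\<close> raises the
  magnetization by Griffiths' inequality, and it turns the full system into one on \<open>W\<close>
  with plus boundary conditions.\<close>

lemma ising_mag_le_pinned:
  fixes G :: "('v, 'e) mgraph"
  assumes G: "finite_graph G" and W: "W \<subseteq> verts G" and v: "v \<in> W" and J: "0 \<le> J"
    and x: "\<And>u. u \<in> verts G \<Longrightarrow> 0 \<le> x u"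
  defines "pin \<equiv> \<lambda>\<sigma> u. if u \<in> verts G - W then 1 else \<sigma> u"
  shows "ising_mag G J x (verts G) v \<le>
    spin_sum W (\<lambda>\<sigma>. \<sigma> v * ising_weight G J x (verts G) (pin \<sigma>)) /
    spin_sum W (\<lambda>\<sigma>. ising_weight G J x (verts G) (pin \<sigma>))"
proof -
  let ?V = "verts G"
  have wf: "wf_graph G" and fin: "finite ?V" using G by (auto simp: finite_graph_def)
  have finW: "finite W" using W fin finite_subset by blast
  have ge: "spin_sum ?V (\<lambda>\<sigma>. \<sigma> v * ising_weight G J x ?V \<sigma>) *
      spin_sum ?V (\<lambda>\<sigma>. ising_weight G J x ?V \<sigma> * (\<Prod>u\<in>?V - W. 1 + \<sigma> u)) \<le>
      spin_sum ?V (\<lambda>\<sigma>. \<sigma> v * (ising_weight G J x ?V \<sigma> * (\<Prod>u\<in>?V - W. 1 + \<sigma> u))) * spin_sum ?V (ising_weight G J x ?V)"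
    unfolding ising_weight_verts[OF wf] by (rule griffiths_graph[OF G]) (use J x W v in auto)
  have V: "W \<union> (?V - W) = ?V" using W by auto
  have "spin_sum ?V (\<lambda>\<sigma>. (\<sigma> v * ising_weight G J x ?V \<sigma>) * (\<Prod>u\<in>?V - W. 1 + \<sigma> u)) =
      2 ^ card (?V - W) * spin_sum W (\<lambda>\<sigma>. pin \<sigma> v * ising_weight G J x ?V (pin \<sigma>))"
    and "spin_sum ?V (\<lambda>\<sigma>. ising_weight G J x ?V \<sigma> * (\<Prod>u\<in>?V - W. 1 + \<sigma> u)) =
      2 ^ card (?V - W) * spin_sum W (\<lambda>\<sigma>. ising_weight G J x ?V (pin \<sigma>))"
    using spin_sum_pinned[of W "?V - W"] finW fin unfolding V pin_def by auto
  moreover have "pin \<sigma> v = \<sigma> v" for \<sigma> using v by (simp add: pin_def)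
  moreover have "0 < spin_sum W (\<lambda>\<sigma>. ising_weight G J x ?V (pin \<sigma>))"
    using finW by (intro spin_sum_pos) auto
  ultimately show ?thesis
    using ge ising_sum_pos[of ?V G J x] fin
    by (simp add: ising_mag_def divide_simps mult.assoc mult.commute[of "2 ^ _"])
qed

section \<open>Graph distance and breadth-first trees of balls\<close>

definition gdist :: "('v, 'e) mgraph \<Rightarrow> 'v \<Rightarrow> 'v \<Rightarrow> nat" where
  "gdist G v u = (LEAST j. (v, u) \<in> adj G (edges G) ^^ j)"

lemma gdist_le: "(v, u) \<in> adj G (edges G) ^^ j \<Longrightarrow> gdist G v u \<le> j"
  unfolding gdist_def by (rule Least_le)

lemma gdist_relpow: "(v, u) \<in> adj G (edges G) ^^ j \<Longrightarrow> (v, u) \<in> adj G (edges G) ^^ gdist G v u"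
  unfolding gdist_def by (rule LeastI)

text \<open>The membership in the relation power records reachability: for an unreachable vertex the
  value of \<open>gdist\<close> is meaningless.\<close>

lemma ball_verts_iff:
  "u \<in> ball_verts G r v \<longleftrightarrow> u \<in> verts G \<and> (v, u) \<in> adj G (edges G) ^^ gdist G v u \<and> gdist G v u \<le> r"
  unfolding ball_verts_def using gdist_le gdist_relpow by (fastforce dest: order.trans)

lemma ball_verts_mono: "r \<le> s \<Longrightarrow> ball_verts G r v \<subseteq> ball_verts G s v"
  by (auto simp: ball_verts_iff)

lemma ball_verts_root: "v \<in> verts G \<Longrightarrow> v \<in> ball_verts G r v"
  by (auto simp: ball_verts_def intro!: exI[of _ "0::nat"])

lemma ball_verts_step:
  assumes "wf_graph G" "u \<in> ball_verts G l v" "(u, w) \<in> adj G (edges G)"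
  shows "w \<in> ball_verts G (Suc l) v"
proof -
  obtain j where "j \<le> l" "(v, u) \<in> adj G (edges G) ^^ j" using assms by (auto simp: ball_verts_def)
  then have "Suc j \<le> Suc l" "(v, w) \<in> adj G (edges G) ^^ Suc j" using assms by auto
  then show ?thesis unfolding ball_verts_def using adj_verts[OF assms(1) _ assms(3)] by blast
qed

lemma ball_verts_parent:
  assumes wf: "wf_graph G" and u: "u \<in> ball_verts G r v" "u \<noteq> v"
  shows "\<exists>p\<in>ball_verts G r v. (p, u) \<in> adj G (edges G) \<and> gdist G v p < gdist G v u"
proof -
  from u have *: "(v, u) \<in> adj G (edges G) ^^ gdist G v u" "gdist G v u \<le> r" by (auto simp: ball_verts_iff)
  then obtain d where d: "gdist G v u = Suc d" using u(2) by (cases "gdist G v u") auto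
  with * obtain p where p: "(v, p) \<in> adj G (edges G) ^^ d" "(p, u) \<in> adj G (edges G)" by auto
  have "gdist G v p \<le> d" by (rule gdist_le) fact
  moreover have "p \<in> verts G" using adj_verts[OF wf _ p(2)] by blast
  ultimately show ?thesis using p d * gdist_relpow[OF p(1)] by (intro bexI[of _ p]) (auto simp: ball_verts_iff)
qed

lemma nbhd_simps [simp]:
  "verts (fst (nbhd r (G, v))) = ball_verts G r v"
  "edges (fst (nbhd r (G, v))) = edges_in G (ball_verts G r v)"
  "ends (fst (nbhd r (G, v))) = ends G"
  "snd (nbhd r (G, v)) = v"
  by (simp_all add: nbhd_def edges_in_def)

lemma acyclic_nbhd_no_cycle:
  assumes "acyclic_graph (fst (nbhd r (G, v)))" "set es \<subseteq> edges_in G (ball_verts G r v)"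
  shows "\<not> is_cycle G vs es"
proof
  assume c: "is_cycle G vs es"
  have "set vs \<subseteq> ball_verts G r v"
  proof
    fix w assume "w \<in> set vs"
    then obtain i where i: "i < length vs" "w = vs ! i" by (auto simp: in_set_conv_nth)
    then have "w \<in># ends G (es ! i)" "es ! i \<in> set es" using c by (auto simp: is_cycle_def)
    then show "w \<in> ball_verts G r v" using assms(2) by (auto simp: edges_in_def)
  qed
  then have "is_cycle (fst (nbhd r (G, v))) vs es" using c assms(2) by (auto simp: is_cycle_def)
  then show False using assms(1) by (auto simp: acyclic_graph_def)
qed

text \<open>One breadth-first tree of the largest ball serves all smaller balls, because parents are
  strictly closer to the centre. Magnetizations at different radii can then be compared with a
  single parent function.\<close>

lemma ball_tree:
  assumes wf: "wf_graph G" and v: "v \<in> verts G" and ac: "acyclic_graph (fst (nbhd r (G, v)))"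
  obtains par pe where
    "\<And>l u. l \<le> r \<Longrightarrow> u \<in> ball_verts G l v \<Longrightarrow> u \<noteq> v \<Longrightarrow>
       par u \<in> ball_verts G l v \<and> ends G (pe u) = {#par u, u#} \<and> gdist G v (par u) < gdist G v u"
    "\<And>l u. Suc l \<le> r \<Longrightarrow> u \<in> ball_verts G (Suc l) v \<Longrightarrow> u \<noteq> v \<Longrightarrow> par u \<in> ball_verts G l v"
    "inj_on pe (ball_verts G r v - {v})"
    "\<And>l. l \<le> r \<Longrightarrow> edges_in G (ball_verts G l v) = pe ` (ball_verts G l v - {v})"
proof -
  let ?C = "ball_verts G r v"
  have down: "\<exists>p\<in>?C. \<exists>e\<in>edges G. ends G e = {#p, u#} \<and> gdist G v p < gdist G v u"
    if "u \<in> ?C" "u \<noteq> v" for u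
    using ball_verts_parent[OF wf that] by (auto simp: adj_def)
  obtain par pe where
    par: "\<forall>u\<in>?C. u \<noteq> v \<longrightarrow> par u \<in> ?C \<and> pe u \<in> edges G \<and> ends G (pe u) = {#par u, u#} \<and>
        gdist G v (par u) < gdist G v u"
    and inj: "inj_on pe (?C - {v})"
    and "pe ` (?C - {v}) \<subseteq> {e \<in> edges G. set_mset (ends G e) \<subseteq> ?C}"
    and E: "v \<in> ?C \<and> (\<forall>vs es. set es \<subseteq> {e \<in> edges G. set_mset (ends G e) \<subseteq> ?C} \<longrightarrow> \<not> is_cycle G vs es) \<longrightarrow>
       pe ` (?C - {v}) = {e \<in> edges G. set_mset (ends G e) \<subseteq> ?C}"
    using parent_structure[OF wf order.refl down] by blast
  have E: "pe ` (?C - {v}) = edges_in G ?C"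
    using E acyclic_nbhd_no_cycle[OF ac] ball_verts_root[OF v] unfolding edges_in_def by blast
  have par': "par u \<in> ball_verts G l v" if "l \<le> r" "u \<in> ball_verts G l v" "u \<noteq> v" for l u
    using that par ball_verts_mono[OF that(1), of G v] by (auto simp: ball_verts_iff)
  have par'': "par u \<in> ball_verts G l v" if "Suc l \<le> r" "u \<in> ball_verts G (Suc l) v" "u \<noteq> v" for l u
    using that par ball_verts_mono[OF that(1), of G v] by (auto simp: ball_verts_iff)
  show ?thesis
  proof (rule that[of par pe])
    fix l u assume *: "l \<le> r" "u \<in> ball_verts G l v" "u \<noteq> v"
    then show "par u \<in> ball_verts G l v \<and> ends G (pe u) = {#par u, u#} \<and> gdist G v (par u) < gdist G v u"
      using par par' ball_verts_mono[OF *(1), of G v] by blast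
  next
    fix l assume l: "l \<le> r"
    note sub = ball_verts_mono[OF l, of G v]
    show "edges_in G (ball_verts G l v) = pe ` (ball_verts G l v - {v})"
    proof
      show "edges_in G (ball_verts G l v) \<subseteq> pe ` (ball_verts G l v - {v})"
      proof
        fix e assume e: "e \<in> edges_in G (ball_verts G l v)"
        then have "e \<in> edges_in G ?C" using sub by (auto simp: edges_in_def)
        then obtain u where u: "u \<in> ?C - {v}" "e = pe u" using E by blast
        then have "u \<in># ends G e" using par by auto
        then show "e \<in> pe ` (ball_verts G l v - {v})" using u e by (auto simp: edges_in_def)
      qed
      show "pe ` (ball_verts G l v - {v}) \<subseteq> edges_in G (ball_verts G l v)"
        using par par'[OF l] sub by (fastforce simp: edges_in_def)
    qed
  next
    show "\<And>l u. Suc l \<le> r \<Longrightarrow> u \<in> ball_verts G (Suc l) v \<Longrightarrow> u \<noteq> v \<Longrightarrow> par u \<in> ball_verts G l v"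
      by (rule par'')
  qed (rule inj)
qed

text \<open>The distance of the ball magnetization to the full magnetization decreases in the radius and is bounded by a
  multiple of the next increment; the increments telescope.\<close>

lemma ising_mag_ball:
  assumes G: "finite_graph G" and v: "v \<in> verts G" and ac: "acyclic_graph (fst (nbhd L (G, v)))"
    and J: "0 \<le> J" and c: "0 < c" "\<And>u. u \<in> verts G \<Longrightarrow> c \<le> x u"
    and C: "1 \<le> C" "J \<le> C * leaf_field J c"
  shows "0 \<le> ising_mag G J x (verts G) v - ising_mag G J x (ball_verts G L v) v"
    and "real L * (ising_mag G J x (verts G) v - ising_mag G J x (ball_verts G L v) v) \<le> 2 * C"
proof -
  have wf: "wf_graph G" and fin: "finite (verts G)" "finite (edges G)" using G by (auto simp: finite_graph_def)
  have x: "0 \<le> x u" if "u \<in> verts G" for u using c(1) c(2)[OF that] by simp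
  let ?B = "\<lambda>l. ball_verts G l v"
  define M where "M = ising_mag G J x (verts G) v"
  define m where "m l = ising_mag G J x (?B l) v" for l
  have B: "?B l \<subseteq> verts G" "finite (?B l)" "v \<in> ?B l" for l
    using ball_verts_root[OF v] fin finite_subset[of "?B l" "verts G"] by (auto simp: ball_verts_def)
  have mM: "m l \<le> M" for l unfolding m_def M_def by (rule ising_mag_subset_le[OF G B(1) B(3) J x])
  show "0 \<le> ising_mag G J x (verts G) v - ising_mag G J x (?B L) v" using mM[of L] by (simp add: m_def M_def)
  obtain par pe where
    par: "\<And>l u. l \<le> L \<Longrightarrow> u \<in> ?B l \<Longrightarrow> u \<noteq> v \<Longrightarrow>
       par u \<in> ?B l \<and> ends G (pe u) = {#par u, u#} \<and> gdist G v (par u) < gdist G v u"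
    and par': "\<And>l u. Suc l \<le> L \<Longrightarrow> u \<in> ?B (Suc l) \<Longrightarrow> u \<noteq> v \<Longrightarrow> par u \<in> ?B l"
    and inj: "inj_on pe (?B L - {v})"
    and E: "\<And>l. l \<le> L \<Longrightarrow> edges_in G (?B l) = pe ` (?B l - {v})"
    using ball_tree[OF wf v ac] by metis
  have inj: "inj_on pe (?B l - {v})" if "l \<le> L" for l
    by (rule inj_on_subset[OF inj]) (use ball_verts_mono[OF that, of G v] in auto)
  have weight: "ising_weight G J x (?B l) \<sigma> = tree_weight (?B l) v par J x \<sigma>" if l: "l \<le> L" for l \<sigma>
  proof -
    have "(\<Sum>e\<in>edges_in G (?B l). spin_prod \<sigma> (ends G e)) = (\<Sum>u\<in>?B l - {v}. \<sigma> u * \<sigma> (par u))"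
      unfolding E[OF l] sum.reindex[OF inj[OF l]] using par[OF l] by (intro sum.cong) auto
    then show ?thesis by (simp add: ising_weight_def tree_weight_def)
  qed
  have m: "m l = tree_mag (?B l) v par J x" if "l \<le> L" for l
    unfolding m_def ising_mag_def tree_mag_def using weight[OF that] by presburger
  have tree: "rooted_tree (?B l) v par (gdist G v)" if "l \<le> L" for l
    by unfold_locales (use par[OF that] B in auto)
  have bound: "M - m l \<le> C * (m (Suc l) - m l)" if l: "Suc l \<le> L" for l
  proof -
    let ?W = "?B l" and ?D = "?B (Suc l) - ?B l"
    let ?n = "\<lambda>u. card {w \<in> ?D. par w = u}"
    let ?y = "\<lambda>u. x u + J * real (?n u)"
    define pin where "pin \<sigma> u = (if u \<in> verts G - ?W then 1 else \<sigma> u)" for \<sigma> :: "'a \<Rightarrow> real" and u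
    have sub: "?W \<subseteq> ?B (Suc l)" by (rule ball_verts_mono) simp
    have D: "finite ?D" "?D \<subseteq> verts G - ?W" using B[of "Suc l"] by auto
    \<comment> \<open>With all spins outside the ball of radius \<open>l\<close> at +1, the edges
      not inside the ball of radius \<open>Suc l\<close> and the fields outside the ball of radius
      \<open>l\<close> contribute a constant, which cancels in the magnetization.\<close>
    define K where "K = exp (J * card (edges G - edges_in G (?B (Suc l))) + (\<Sum>u\<in>verts G - ?W. x u))"
    have pinned: "ising_weight G J x (verts G) (pin \<sigma>) = K * tree_weight ?W v par J ?y \<sigma>" for \<sigma>
    proof -
      have pW: "pin \<sigma> u = \<sigma> u" if "u \<in> ?W" for u using that by (simp add: pin_def)
      have pV: "pin \<sigma> u = 1" if "u \<in> verts G - ?W" for u using that by (simp add: pin_def)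
      \<comment> \<open>An edge with an end in the ball of radius \<open>l\<close> has both ends in
        the ball of radius \<open>Suc l\<close>. Hence both ends of the remaining edges are
        pinned.\<close>
      have far: "spin_prod (pin \<sigma>) (ends G e) = 1" if e: "e \<in> edges G - edges_in G (?B (Suc l))" for e
      proof -
        obtain a b where ab: "ends G e = {#a, b#}" "a \<in> verts G" "b \<in> verts G"
          using wf_edge_obtain[OF wf] e by blast
        then have "(a, b) \<in> adj G (edges G)" "(b, a) \<in> adj G (edges G)"
          using e by (auto simp: adj_def add_mset_commute)
        then have "a \<notin> ?W \<and> b \<notin> ?W"
          using ball_verts_step[OF wf, of a l v b] ball_verts_step[OF wf, of b l v a] sub e ab
          by (auto simp: edges_in_def)
        then show ?thesis using ab pV by simp
      qed
      have split: "?B (Suc l) - {v} = (?W - {v}) \<union> ?D" using sub B(3)[of l] by auto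
      have "(\<Sum>e\<in>edges G. spin_prod (pin \<sigma>) (ends G e)) =
          (\<Sum>e\<in>edges_in G (?B (Suc l)). spin_prod (pin \<sigma>) (ends G e)) +
          (\<Sum>e\<in>edges G - edges_in G (?B (Suc l)). spin_prod (pin \<sigma>) (ends G e))"
        using fin by (subst sum.subset_diff[of "edges_in G (?B (Suc l))"]) (auto simp: edges_in_def)
      also have "(\<Sum>e\<in>edges G - edges_in G (?B (Suc l)). spin_prod (pin \<sigma>) (ends G e)) =
          card (edges G - edges_in G (?B (Suc l)))"
        using far by simp
      also have "(\<Sum>e\<in>edges_in G (?B (Suc l)). spin_prod (pin \<sigma>) (ends G e)) =
          (\<Sum>u\<in>?B (Suc l) - {v}. pin \<sigma> u * pin \<sigma> (par u))"
        unfolding E[OF l] sum.reindex[OF inj[OF l]] using par[OF l] by (intro sum.cong) auto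
      also have "\<dots> = (\<Sum>u\<in>?W - {v}. pin \<sigma> u * pin \<sigma> (par u)) + (\<Sum>u\<in>?D. pin \<sigma> u * pin \<sigma> (par u))"
        unfolding split using B(2)[of l] D by (intro sum.union_disjoint) auto
      also have "(\<Sum>u\<in>?W - {v}. pin \<sigma> u * pin \<sigma> (par u)) = (\<Sum>u\<in>?W - {v}. \<sigma> u * \<sigma> (par u))"
        using par[of l] l pW by (intro sum.cong) auto
      also have "(\<Sum>u\<in>?D. pin \<sigma> u * pin \<sigma> (par u)) = (\<Sum>u\<in>?D. \<sigma> (par u))"
      proof (rule sum.cong)
        fix u assume u: "u \<in> ?D"
        then have "u \<noteq> v" using B(3)[of l] by auto
        then have "par u \<in> ?W" using par'[OF l] u by auto
        then show "pin \<sigma> u * pin \<sigma> (par u) = \<sigma> (par u)" using pW pV D u by auto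
      qed simp
      \<comment> \<open>Sorting the pinned level by parents turns the plus boundary into the extra
        field \<open>J\<close> per child.\<close>
      also have "\<dots> = (\<Sum>u\<in>?W. \<Sum>w\<in>{w \<in> ?D. par w = u}. \<sigma> (par w))"
      proof (rule sum.group[symmetric])
        show "par ` ?D \<subseteq> ?W" using par'[OF l] B(3)[of l] by auto
      qed (use B D in auto)
      also have "\<dots> = (\<Sum>u\<in>?W. real (?n u) * \<sigma> u)" by simp
      finally have edges: "(\<Sum>e\<in>edges G. spin_prod (pin \<sigma>) (ends G e)) =
          (\<Sum>u\<in>?W - {v}. \<sigma> u * \<sigma> (par u)) + (\<Sum>u\<in>?W. real (?n u) * \<sigma> u) +
          card (edges G - edges_in G (?B (Suc l)))" .
      have "(\<Sum>u\<in>verts G. x u * pin \<sigma> u) = (\<Sum>u\<in>?W. x u * pin \<sigma> u) + (\<Sum>u\<in>verts G - ?W. x u * pin \<sigma> u)"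
        using fin B(1)[of l] by (subst sum.subset_diff[of ?W]) auto
      also have "(\<Sum>u\<in>?W. x u * pin \<sigma> u) = (\<Sum>u\<in>?W. x u * \<sigma> u)" using pW by (intro sum.cong) auto
      also have "(\<Sum>u\<in>verts G - ?W. x u * pin \<sigma> u) = (\<Sum>u\<in>verts G - ?W. x u)" using pV by (intro sum.cong) auto
      finally have fields: "(\<Sum>u\<in>verts G. x u * pin \<sigma> u) = (\<Sum>u\<in>?W. x u * \<sigma> u) + (\<Sum>u\<in>verts G - ?W. x u)" .
      show ?thesis
        unfolding ising_weight_def tree_weight_def K_def exp_add[symmetric] edges_in_verts[OF wf] edges fields
        by (simp add: algebra_simps sum.distrib sum_distrib_left)
    qed
    have "K \<noteq> 0" by (simp add: K_def)
    have "M \<le> spin_sum ?W (\<lambda>\<sigma>. \<sigma> v * ising_weight G J x (verts G) (pin \<sigma>)) /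
        spin_sum ?W (\<lambda>\<sigma>. ising_weight G J x (verts G) (pin \<sigma>))"
      using ising_mag_le_pinned[OF G B(1)[of l] B(3)[of l] J x] unfolding M_def pin_def by simp
    also have "\<dots> = tree_mag ?W v par J ?y"
      unfolding pinned tree_mag_def using \<open>K \<noteq> 0\<close>
      by (simp add: spin_sum_cmult mult.left_commute[of _ K])
    finally have "M \<le> tree_mag ?W v par J ?y" .
    moreover have "tree_mag ?W v par J ?y - tree_mag ?W v par J x
        \<le> C * (tree_mag (?W \<union> ?D) v par J x - tree_mag ?W v par J x)"
    proof (rule tree_mag_level_bound[OF tree D(1) _ _ J c(1) _ C])
      show "par ` ?D \<subseteq> ?W" using par'[OF l] B(3)[of l] by auto
      show "c \<le> x u" if "u \<in> ?W \<union> ?D" for u using that c(2) B(1)[of l] D by auto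
    qed (use l in auto)
    moreover have "?W \<union> ?D = ?B (Suc l)" using sub by auto
    ultimately show ?thesis using m[of l] m[OF l] l by simp
  qed
  \<comment> \<open>Growth in the radius needs no further use of Griffiths' inequality:
    \<open>bound\<close> places a nonnegative number below \<open>C\<close> times the
    increment.\<close>
  have mono: "m l \<le> m L" if "l \<le> L" for l
    using that
  proof (induction rule: inc_induct)
    case (step l)
    have "0 \<le> C * (m (Suc l) - m l)" using order.trans[OF _ bound[of l]] mM[of l] step.hyps by simp
    then have "m l \<le> m (Suc l)" using C by (simp add: zero_le_mult_iff)
    then show ?case using step.IH by simp
  qed simp
  have "real L * (M - m L) = (\<Sum>l<L. M - m L)" by simp
  also have "\<dots> \<le> (\<Sum>l<L. C * (m (Suc l) - m l))"
  proof (rule sum_mono)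
    fix l assume "l \<in> {..<L}"
    then show "M - m L \<le> C * (m (Suc l) - m l)" using bound[of l] mono[of l] by simp
  qed
  also have "\<dots> = C * (m L - m 0)" unfolding sum_distrib_left[symmetric] by (simp add: sum_lessThan_telescope)
  \<comment> \<open>Magnetizations lie between -1 and 1, so the telescoped increments add up to at
    most 2.\<close>
  also have "\<dots> \<le> C * 2"
    using ising_mag_bound[OF B(2,3), of G J x L] ising_mag_bound[OF B(2,3), of G J x 0] C
    by (intro mult_left_mono) (auto simp: m_def)
  finally show "real L * (ising_mag G J x (verts G) v - ising_mag G J x (ball_verts G L v) v) \<le> 2 * C"
    by (simp add: M_def m_def)
qed

section \<open>Isomorphism classes of rooted graphs\<close>

lemma edge_two:
  assumes "wf_graph G" "e \<in> edges G"
  shows "\<exists>a b. ends G e = {#a, b#} \<and> a \<in> verts G \<and> b \<in> verts G"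
  using wf_edge_obtain[OF assms] by metis

lemma relpow_mono_rel: "(a, b) \<in> R ^^ n \<Longrightarrow> R \<subseteq> (S :: ('a \<times> 'a) set) \<Longrightarrow> (a, b) \<in> S ^^ n"
  by (induction n arbitrary: b) auto

lemma ball_verts_nbhd:
  assumes wf: "wf_graph G" and v: "v \<in> verts G" and l: "l \<le> r"
  shows "ball_verts (fst (nbhd r (G, v))) l v = ball_verts G l v"
proof -
  let ?H = "fst (nbhd r (G, v))"
  have sub: "adj ?H (edges ?H) \<subseteq> adj G (edges G)" by (auto simp: adj_def edges_in_def)
  have path: "(v, u) \<in> adj ?H (edges ?H) ^^ j" if "(v, u) \<in> adj G (edges G) ^^ j" "j \<le> r" for j u
    using that
  proof (induction j arbitrary: u)
    case (Suc j)
    then obtain w where w: "(v, w) \<in> adj G (edges G) ^^ j" "(w, u) \<in> adj G (edges G)" by auto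
    have "w \<in> verts G" "u \<in> verts G" using adj_verts[OF wf order.refl w(2)] by auto
    then have "w \<in> ball_verts G r v" "u \<in> ball_verts G r v"
      using w(1) Suc.prems unfolding ball_verts_def by (blast dest: Suc_leD)+
    then have "(w, u) \<in> adj ?H (edges ?H)" using w(2) by (auto simp: adj_def edges_in_def)
    moreover have "(v, w) \<in> adj ?H (edges ?H) ^^ j" using Suc w by simp
    ultimately show ?case by auto
  qed auto
  show ?thesis
  proof
    show "ball_verts ?H l v \<subseteq> ball_verts G l v"
      using relpow_mono_rel[OF _ sub] by (fastforce simp: ball_verts_def)
    show "ball_verts G l v \<subseteq> ball_verts ?H l v"
    proof
      fix u assume u: "u \<in> ball_verts G l v"
      then obtain j where "j \<le> l" "(v, u) \<in> adj G (edges G) ^^ j" by (auto simp: ball_verts_def)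
      then show "u \<in> ball_verts ?H l v"
        using path[of u j] l u ball_verts_mono[OF l, of G v] by (auto simp: ball_verts_def[of ?H])
    qed
  qed
qed

text \<open>Vertices at distance \<open>r\<close> may have edges to distance \<open>Suc r\<close>,
  so their degrees are visible only in the larger ball.\<close>

lemma degree_nbhd:
  assumes wf: "wf_graph G" and u: "u \<in> ball_verts G r v"
  shows "degree (fst (nbhd (Suc r) (G, v))) u = degree G u"
proof -
  have "set_mset (ends G e) \<subseteq> ball_verts G (Suc r) v" if e: "e \<in> edges G" "u \<in># ends G e" for e
  proof -
    obtain a b where ab: "ends G e = {#a, b#}" using edge_two[OF wf e(1)] by auto
    then have "(a, b) \<in> adj G (edges G)" "(b, a) \<in> adj G (edges G)"
      using e by (auto simp: adj_def add_mset_commute)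
    then show ?thesis
      using ab e(2) u ball_verts_mono[of r "Suc r" G v] ball_verts_step[OF wf u, of a] ball_verts_step[OF wf u, of b]
      by auto
  qed
  then have "{e \<in> edges_in G (ball_verts G (Suc r) v). u \<in># ends G e} = {e \<in> edges G. u \<in># ends G e}"
    by (auto simp: edges_in_def)
  then show ?thesis by (simp add: degree_def)
qed

text \<open>The fields use degrees in the whole graph, so this quantity is determined by the ball of
  radius \<open>Suc r\<close> and not by that of radius \<open>r\<close>; see
  \<open>root_mag_nbhd\<close>.\<close>

definition root_mag :: "real \<Rightarrow> real \<Rightarrow> real \<Rightarrow> nat \<Rightarrow> ('v, 'e) rooted \<Rightarrow> real" where
  "root_mag J k h r R = ising_mag (fst R) J (\<lambda>u. k * real (degree (fst R) u) + h) (ball_verts (fst R) r (snd R)) (snd R)"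

lemma root_mag_nbhd:
  assumes wf: "wf_graph G" and v: "v \<in> verts G"
  shows "root_mag J k h r (nbhd (Suc r) (G, v)) = root_mag J k h r (G, v)"
proof -
  let ?H = "fst (nbhd (Suc r) (G, v))" and ?B = "ball_verts G r v"
  have B: "ball_verts ?H r v = ?B" by (rule ball_verts_nbhd[OF wf v]) simp
  have E: "edges_in ?H ?B = edges_in G ?B"
    using ball_verts_mono[of r "Suc r" G v] by (auto simp: edges_in_def)
  have "(\<Sum>u\<in>?B. (k * real (degree ?H u) + h) * \<sigma> u) = (\<Sum>u\<in>?B. (k * real (degree G u) + h) * \<sigma> u)" for \<sigma>
    using degree_nbhd[OF wf] by (intro sum.cong) auto
  then have "ising_weight ?H J (\<lambda>u. k * real (degree ?H u) + h) ?B = ising_weight G J (\<lambda>u. k * real (degree G u) + h) ?B"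
    by (intro ext) (simp add: ising_weight_def E)
  then show ?thesis by (simp add: root_mag_def B ising_mag_def)
qed

section \<open>Invariance under isomorphisms of rooted graphs\<close>

locale rooted_isomorphism =
  fixes R :: "('v, 'e) rooted" and S :: "('u, 'f) rooted" and f g
  assumes wf: "wf_graph (fst R)"
    and f: "bij_betw f (verts (fst R)) (verts (fst S))"
    and g: "bij_betw g (edges (fst R)) (edges (fst S))"
    and ends: "\<And>e. e \<in> edges (fst R) \<Longrightarrow> ends (fst S) (g e) = image_mset f (ends (fst R) e)"
    and root: "f (snd R) = snd S"
begin

lemma f_inj: "inj_on f (verts (fst R))" and f_img: "f ` verts (fst R) = verts (fst S)"
  and g_inj: "inj_on g (edges (fst R))" and g_img: "g ` edges (fst R) = edges (fst S)"
  using f g by (auto simp: bij_betw_def)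

lemma wf': "wf_graph (fst S)"
  unfolding wf_graph_def
proof
  fix e assume "e \<in> edges (fst S)"
  then obtain d where d: "d \<in> edges (fst R)" "e = g d" using g_img by auto
  with wf have "size (ends (fst R) d) = 2" "set_mset (ends (fst R) d) \<subseteq> verts (fst R)" by (auto simp: wf_graph_def)
  then show "size (ends (fst S) e) = 2 \<and> set_mset (ends (fst S) e) \<subseteq> verts (fst S)"
    using d ends[OF d(1)] f_img by auto
qed

lemma inverse: "rooted_isomorphism S R (inv_into (verts (fst R)) f) (inv_into (edges (fst R)) g)"
  if "snd R \<in> verts (fst R)"
proof (unfold_locales, goal_cases)
  case 1 show ?case by (rule wf')
next
  case 2 show ?case by (rule bij_betw_inv_into[OF f])
next
  case 3 show ?case by (rule bij_betw_inv_into[OF g])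
next
  case (4 e)
  then obtain d where d: "d \<in> edges (fst R)" "e = g d" using g_img by auto
  then have "set_mset (ends (fst R) d) \<subseteq> verts (fst R)" using wf by (auto simp: wf_graph_def)
  then have "image_mset (inv_into (verts (fst R)) f) (image_mset f (ends (fst R) d)) = image_mset id (ends (fst R) d)"
    unfolding multiset.map_comp using f_inj by (intro image_mset_cong) auto
  then show ?case using d ends[OF d(1)] g_inj by simp
next
  case 5 show ?case using root that f_inj by (metis inv_into_f_f)
qed

lemma adj_iso: "(a, b) \<in> adj (fst R) (edges (fst R)) \<Longrightarrow> (f a, f b) \<in> adj (fst S) (edges (fst S))"
  unfolding adj_def using ends g_img by fastforce

lemma relpow_iso: "(a, b) \<in> adj (fst R) (edges (fst R)) ^^ j \<Longrightarrow> (f a, f b) \<in> adj (fst S) (edges (fst S)) ^^ j"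
proof (induction j arbitrary: b)
  case (Suc j)
  then show ?case using adj_iso by fastforce
qed auto

lemma ball_iso_subset: "f ` ball_verts (fst R) r (snd R) \<subseteq> ball_verts (fst S) r (snd S)"
  using relpow_iso f_img root unfolding ball_verts_def by fastforce

lemma ball_iso:
  assumes r: "snd R \<in> verts (fst R)"
  shows "f ` ball_verts (fst R) r (snd R) = ball_verts (fst S) r (snd S)"
proof
  show "ball_verts (fst S) r (snd S) \<subseteq> f ` ball_verts (fst R) r (snd R)"
  proof
    fix u assume u: "u \<in> ball_verts (fst S) r (snd S)"
    then have "u \<in> verts (fst S)" by (simp add: ball_verts_def)
    then have "f (inv_into (verts (fst R)) f u) = u" using f by (rule bij_betw_inv_into_right[rotated])
    moreover have "inv_into (verts (fst R)) f u \<in> ball_verts (fst R) r (snd R)"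
      using rooted_isomorphism.ball_iso_subset[OF inverse[OF r], of r] u by auto
    ultimately show "u \<in> f ` ball_verts (fst R) r (snd R)" by (metis imageI)
  qed
qed (rule ball_iso_subset)

lemma degree_iso:
  assumes "u \<in> verts (fst R)" shows "degree (fst S) (f u) = degree (fst R) u"
proof -
  have cnt: "count (ends (fst S) (g e)) (f u) = count (ends (fst R) e) u" if "e \<in> edges (fst R)" for e
    using edge_two[OF wf that] ends[OF that] inj_on_eq_iff[OF f_inj] assms by auto
  have mem: "f u \<in># ends (fst S) (g e) \<longleftrightarrow> u \<in># ends (fst R) e" if "e \<in> edges (fst R)" for e
    using cnt[OF that] by (metis count_eq_zero_iff)
  have "{e \<in> edges (fst S). f u \<in># ends (fst S) e} = g ` {e \<in> edges (fst R). u \<in># ends (fst R) e}"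
    using mem unfolding g_img[symmetric] by auto
  moreover have "inj_on g {e \<in> edges (fst R). u \<in># ends (fst R) e}"
    by (rule inj_on_subset[OF g_inj]) auto
  ultimately show ?thesis using cnt by (simp add: degree_def sum.reindex)
qed

lemma root_mag_iso:
  assumes r: "snd R \<in> verts (fst R)"
  shows "root_mag J k h r S = root_mag J k h r R"
proof -
  let ?B = "ball_verts (fst R) r (snd R)" and ?C = "ball_verts (fst S) r (snd S)"
  let ?x = "\<lambda>u. k * real (degree (fst R) u) + h" and ?y = "\<lambda>u. k * real (degree (fst S) u) + h"
  have BV: "?B \<subseteq> verts (fst R)" by (auto simp: ball_verts_def)
  have inj: "inj_on f ?B" by (rule inj_on_subset[OF f_inj BV])
  have fB: "bij_betw f ?B ?C" using inj ball_iso[OF r] by (simp add: bij_betw_def)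
  define h' where "h' \<sigma> = (\<lambda>u\<in>?C. \<sigma> (inv_into ?B f u))" for \<sigma> :: "'v \<Rightarrow> real"
  have h': "h' \<sigma> (f u) = \<sigma> u" if "u \<in> ?B" for \<sigma> u
    using that fB inj by (auto simp: h'_def bij_betw_def)
  have E: "edges_in (fst S) ?C = g ` edges_in (fst R) ?B"
  proof -
    have "set_mset (ends (fst S) (g e)) \<subseteq> ?C \<longleftrightarrow> set_mset (ends (fst R) e) \<subseteq> ?B" if "e \<in> edges (fst R)" for e
    proof -
      have "f u \<in> ?C \<longleftrightarrow> u \<in> ?B" if "u \<in> verts (fst R)" for u
        using that BV ball_iso[OF r, of r, symmetric] f_inj by (auto simp: inj_on_image_mem_iff)
      moreover have "set_mset (ends (fst R) e) \<subseteq> verts (fst R)" using that wf by (auto simp: wf_graph_def)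
      ultimately show ?thesis using ends[OF that] by auto
    qed
    then show ?thesis unfolding edges_in_def g_img[symmetric] by auto
  qed
  have w: "ising_weight (fst S) J ?y ?C (h' \<sigma>) = ising_weight (fst R) J ?x ?B \<sigma>" for \<sigma>
  proof -
    have "inj_on g (edges_in (fst R) ?B)" by (rule inj_on_subset[OF g_inj]) (auto simp: edges_in_def)
    then have "(\<Sum>e\<in>edges_in (fst S) ?C. spin_prod (h' \<sigma>) (ends (fst S) e)) =
        (\<Sum>e\<in>edges_in (fst R) ?B. spin_prod (h' \<sigma>) (image_mset f (ends (fst R) e)))"
      unfolding E using ends by (simp add: sum.reindex edges_in_def)
    also have "\<dots> = (\<Sum>e\<in>edges_in (fst R) ?B. spin_prod \<sigma> (ends (fst R) e))"
    proof (rule sum.cong)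
      fix e assume "e \<in> edges_in (fst R) ?B"
      then have "set_mset (ends (fst R) e) \<subseteq> ?B" by (simp add: edges_in_def)
      then show "spin_prod (h' \<sigma>) (image_mset f (ends (fst R) e)) = spin_prod \<sigma> (ends (fst R) e)"
        unfolding spin_prod_def multiset.map_comp by (intro arg_cong[of _ _ prod_mset] image_mset_cong) (auto simp: h')
    qed simp
    moreover have "(\<Sum>u\<in>?C. ?y u * h' \<sigma> u) = (\<Sum>u\<in>?B. ?x u * \<sigma> u)"
      unfolding sum.reindex_bij_betw[OF fB, symmetric]
      using BV by (intro sum.cong) (auto simp: h' degree_iso subsetD)
    ultimately show ?thesis by (simp add: ising_weight_def)
  qed
  have o: "snd R \<in> ?B" by (rule ball_verts_root[OF r])
  have "h' \<sigma> (snd S) = \<sigma> (snd R)" for \<sigma> using h'[OF o] root by simp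
  then show ?thesis
    unfolding root_mag_def ising_mag_def spin_sum_bij[OF fB] h'_def[symmetric] w by simp
qed

lemma acyclic_iso:
  assumes "acyclic_graph (fst S)" shows "acyclic_graph (fst R)"
proof (rule ccontr)
  assume "\<not> acyclic_graph (fst R)"
  then obtain vs es where c: "is_cycle (fst R) vs es" by (auto simp: acyclic_graph_def)
  have "is_cycle (fst S) (map f vs) (map g es)"
    unfolding is_cycle_def
  proof (intro conjI allI impI)
    fix i assume i: "i < length (map f vs)"
    then have "es ! i \<in> edges (fst R)" "Suc i mod length vs < length vs" using c
      by (auto simp: is_cycle_def intro!: mod_less_divisor)
    then show "ends (fst S) (map g es ! i) = {#map f vs ! i, map f vs ! (Suc i mod length (map f vs))#}"
      using c i ends by (auto simp: is_cycle_def)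
  qed (use c f_inj g_inj in \<open>auto simp: is_cycle_def distinct_map f_img[symmetric] g_img[symmetric] intro: inj_on_subset\<close>)
  then show False using assms by (auto simp: acyclic_graph_def)
qed

end

lemma rooted_iso_locale: "wf_graph (fst R) \<Longrightarrow> rooted_iso R S \<longleftrightarrow> (\<exists>f g. rooted_isomorphism R S f g)"
  by (auto simp: rooted_iso_def rooted_isomorphism_def)

text \<open>The counterpart of \<open>finite_rooted\<close> for arbitrary label types, since
  neighbourhoods in the sequence and in the limit are not labelled by natural numbers.\<close>

definition finite_rooted_graph :: "('v, 'e) rooted \<Rightarrow> bool" where
  "finite_rooted_graph R \<longleftrightarrow> finite_graph (fst R) \<and> snd R \<in> verts (fst R)"

lemma rooted_iso_sym: "finite_rooted_graph R \<Longrightarrow> rooted_iso R S \<Longrightarrow> rooted_iso S R"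
  by (metis finite_graph_def finite_rooted_graph_def rooted_isomorphism.inverse rooted_isomorphism.wf' rooted_iso_locale)

lemma rooted_iso_finite:
  assumes "finite_rooted_graph R" "rooted_iso R S" shows "finite_rooted_graph S"
proof -
  have "wf_graph (fst R)" using assms(1) by (simp add: finite_rooted_graph_def finite_graph_def)
  then obtain f g where "rooted_isomorphism R S f g" using assms(2) rooted_iso_locale by blast
  then interpret rooted_isomorphism R S f g .
  have "finite (verts (fst S))" "finite (edges (fst S))" "snd S \<in> verts (fst S)"
    using assms(1) root unfolding finite_rooted_graph_def finite_graph_def f_img[symmetric] g_img[symmetric] root[symmetric] by auto
  then show ?thesis using wf' by (simp add: finite_rooted_graph_def finite_graph_def)
qed

lemma rooted_iso_trans:
  assumes "rooted_iso R S" "rooted_iso S T" shows "rooted_iso R T"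
proof -
  obtain f g where f: "bij_betw f (verts (fst R)) (verts (fst S))" "bij_betw g (edges (fst R)) (edges (fst S))"
    "\<forall>e\<in>edges (fst R). ends (fst S) (g e) = image_mset f (ends (fst R) e)" "f (snd R) = snd S"
    using assms(1) unfolding rooted_iso_def by blast
  obtain f' g' where f': "bij_betw f' (verts (fst S)) (verts (fst T))" "bij_betw g' (edges (fst S)) (edges (fst T))"
    "\<forall>e\<in>edges (fst S). ends (fst T) (g' e) = image_mset f' (ends (fst S) e)" "f' (snd S) = snd T"
    using assms(2) unfolding rooted_iso_def by blast
  have "\<forall>e\<in>edges (fst R). ends (fst T) ((g' \<circ> g) e) = image_mset (f' \<circ> f) (ends (fst R) e)"
  proof
    fix e assume e: "e \<in> edges (fst R)"
    then have "g e \<in> edges (fst S)" using f(2) by (auto simp: bij_betw_def)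
    then show "ends (fst T) ((g' \<circ> g) e) = image_mset (f' \<circ> f) (ends (fst R) e)"
      using f(3) f'(3) e by (simp add: multiset.map_comp)
  qed
  then show ?thesis
    unfolding rooted_iso_def using bij_betw_trans[OF f(1) f'(1)] bij_betw_trans[OF f(2) f'(2)] f f'
    by (intro exI[of _ "f' \<circ> f"] exI[of _ "g' \<circ> g"]) auto
qed

text \<open>An enumeration of all finite rooted graphs up to isomorphism: a number of vertices, the
  list of the ends of the edges, and a root. Some codes are not graphs, as the root or the listed
  ends may exceed the vertex range.\<close>

definition code_graph :: "nat \<Rightarrow> (nat, nat) rooted" where
  "code_graph i = (case from_nat i of (n, es, v) \<Rightarrow>
     (\<lparr>verts = {..<n}, edges = {..<length es},
       ends = (\<lambda>j. if j < length es then {#fst (es ! j), snd (es ! j)#} else {#})\<rparr>, v))"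

lemma code_graph_exists:
  assumes "finite_rooted_graph R" shows "\<exists>i. rooted_iso R (code_graph i)"
proof -
  obtain G v where R: "R = (G, v)" by (cases R)
  have wf: "wf_graph G" and fin: "finite (verts G)" "finite (edges G)"
    using assms by (auto simp: finite_rooted_graph_def finite_graph_def R)
  obtain f where f: "bij_betw f (verts G) {0..<card (verts G)}" using ex_bij_betw_finite_nat[OF fin(1)] by blast
  obtain g where g: "bij_betw g (edges G) {0..<card (edges G)}" using ex_bij_betw_finite_nat[OF fin(2)] by blast
  obtain a b where ab: "\<And>e. e \<in> edges G \<Longrightarrow> ends G e = {#a e, b e#}"
    using edge_two[OF wf] by metis
  define es where "es = map (\<lambda>j. (f (a (inv_into (edges G) g j)), f (b (inv_into (edges G) g j)))) [0..<card (edges G)]"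
  let ?c = "(card (verts G), es, f v)"
  have C: "code_graph (to_nat ?c) = (\<lparr>verts = {..<card (verts G)}, edges = {..<length es},
       ends = (\<lambda>j. if j < length es then {#fst (es ! j), snd (es ! j)#} else {#})\<rparr>, f v)"
    by (simp add: code_graph_def)
  have "g e < card (edges G)" if "e \<in> edges G" for e using g that by (auto simp: bij_betw_def)
  moreover have "inv_into (edges G) g (g e) = e" if "e \<in> edges G" for e
    using bij_betw_inv_into_left[OF g that] .
  ultimately have "\<forall>e\<in>edges G. ends (fst (code_graph (to_nat ?c))) (g e) = image_mset f (ends G e)"
    unfolding C by (auto simp: es_def ab)
  then have "rooted_iso R (code_graph (to_nat ?c))"
    unfolding rooted_iso_def R using f g
    by (intro exI[of _ f] exI[of _ g]) (simp add: C lessThan_atLeast0, simp add: es_def)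
  then show ?thesis by blast
qed

text \<open>The isomorphism class as a natural number. Local quantities of the graphs
  \<open>G n\<close> and of the limit become functions of numbers, although their label types
  differ.\<close>

definition graph_code :: "('v, 'e) rooted \<Rightarrow> nat" where
  "graph_code R = (LEAST i. rooted_iso R (code_graph i))"

lemma graph_code_iso: "finite_rooted_graph R \<Longrightarrow> rooted_iso R (code_graph (graph_code R))"
  unfolding graph_code_def using code_graph_exists by (metis LeastI)

text \<open>The values that \<open>graph_code\<close> takes on finite rooted graphs. For such
  \<open>i\<close> the event that the code is \<open>i\<close> is one of the isomorphism events for
  which local convergence is assumed.\<close>

definition minimal_code :: "nat \<Rightarrow> bool" where
  "minimal_code i \<longleftrightarrow> finite_rooted_graph (code_graph i) \<and> (\<forall>j<i. \<not> rooted_iso (code_graph i) (code_graph j))"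

lemma graph_code_eq_iff:
  assumes R: "finite_rooted_graph R"
  shows "graph_code R = i \<longleftrightarrow> minimal_code i \<and> rooted_iso R (code_graph i)"
proof
  assume i: "graph_code R = i"
  then have iso: "rooted_iso R (code_graph i)" using graph_code_iso[OF R] by simp
  have "\<not> rooted_iso R (code_graph j)" if "j < i" for j
    using not_less_Least[of j "\<lambda>i. rooted_iso R (code_graph i)"] that i by (simp add: graph_code_def)
  then have "\<not> rooted_iso (code_graph i) (code_graph j)" if "j < i" for j
    using rooted_iso_trans[OF iso, of "code_graph j"] that by blast
  then show "minimal_code i \<and> rooted_iso R (code_graph i)"
    using iso rooted_iso_finite[OF R iso] by (auto simp: minimal_code_def)
next
  assume i: "minimal_code i \<and> rooted_iso R (code_graph i)"
  show "graph_code R = i"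
    unfolding graph_code_def
  proof (rule Least_equality)
    fix j assume "rooted_iso R (code_graph j)"
    then have "rooted_iso (code_graph i) (code_graph j)"
      using rooted_iso_trans rooted_iso_sym[OF R] i by blast
    then show "i \<le> j" using i unfolding minimal_code_def by (meson not_le_imp_less)
  qed (use i in simp)
qed

lemma graph_code_inv:
  assumes "finite_rooted_graph R"
  obtains f g where "rooted_isomorphism R (code_graph (graph_code R)) f g"
  using graph_code_iso[OF assms] rooted_iso_locale assms by (metis finite_graph_def finite_rooted_graph_def)

lemma root_mag_code:
  assumes "finite_rooted_graph R" shows "root_mag J k h r (code_graph (graph_code R)) = root_mag J k h r R"
proof -
  obtain f g where *: "rooted_isomorphism R (code_graph (graph_code R)) f g" using graph_code_inv[OF assms] .
  show ?thesis using rooted_isomorphism.root_mag_iso[OF *] assms by (auto simp: finite_rooted_graph_def)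
qed

lemma acyclic_code:
  assumes R: "finite_rooted_graph R"
  shows "acyclic_graph (fst (code_graph (graph_code R))) \<longleftrightarrow> acyclic_graph (fst R)"
proof -
  obtain f g where *: "rooted_isomorphism R (code_graph (graph_code R)) f g" using graph_code_inv[OF R] .
  then have **: "rooted_isomorphism (code_graph (graph_code R)) R (inv_into (verts (fst R)) f) (inv_into (edges (fst R)) g)"
    using R by (intro rooted_isomorphism.inverse) (auto simp: finite_rooted_graph_def)
  show ?thesis using rooted_isomorphism.acyclic_iso[OF *] rooted_isomorphism.acyclic_iso[OF **] by blast
qed

lemma root_degree_code:
  assumes "finite_rooted_graph R"
  shows "degree (fst (code_graph (graph_code R))) (snd (code_graph (graph_code R))) = degree (fst R) (snd R)"
proof -
  obtain f g where *: "rooted_isomorphism R (code_graph (graph_code R)) f g" using graph_code_inv[OF assms] .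
  show ?thesis unfolding rooted_isomorphism.root[OF *, symmetric]
    by (rule rooted_isomorphism.degree_iso[OF *]) (use assms in \<open>simp add: finite_rooted_graph_def\<close>)
qed

lemma finite_nbhd:
  assumes wf: "wf_graph G" and lf: "locally_finite G" and v: "v \<in> verts G"
  shows "finite_rooted_graph (nbhd r (G, v))"
proof -
  have nb: "finite {w. (u, w) \<in> adj G (edges G)}" if "u \<in> verts G" for u
  proof -
    have "{w. (u, w) \<in> adj G (edges G)} \<subseteq> (\<Union>e\<in>{e \<in> edges G. u \<in># ends G e}. set_mset (ends G e))"
      by (auto simp: adj_def)
    moreover have "finite {e \<in> edges G. u \<in># ends G e}" using lf that by (auto simp: locally_finite_def)
    ultimately show ?thesis by (meson finite_UN_I finite_set_mset finite_subset)
  qed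
  have sphere: "finite {u. (v, u) \<in> adj G (edges G) ^^ j} \<and> {u. (v, u) \<in> adj G (edges G) ^^ j} \<subseteq> verts G" for j
  proof (induction j)
    case 0
    then show ?case using v by auto
  next
    case (Suc j)
    have "{u. (v, u) \<in> adj G (edges G) ^^ Suc j} = (\<Union>u\<in>{u. (v, u) \<in> adj G (edges G) ^^ j}. {w. (u, w) \<in> adj G (edges G)})"
      by auto
    then show ?case using Suc nb adj_verts[OF wf order.refl] by (auto intro!: finite_UN_I)
  qed
  have fB: "finite (ball_verts G r v)"
  proof (rule finite_subset)
    show "ball_verts G r v \<subseteq> (\<Union>j\<le>r. {u. (v, u) \<in> adj G (edges G) ^^ j})" by (auto simp: ball_verts_def)
  qed (use sphere in auto)
  have "edges_in G (ball_verts G r v) \<subseteq> (\<Union>u\<in>ball_verts G r v. {e \<in> edges G. u \<in># ends G e})"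
  proof
    fix e assume e: "e \<in> edges_in G (ball_verts G r v)"
    then obtain a b where "ends G e = {#a, b#}" using edge_two[OF wf, of e] by (auto simp: edges_in_def)
    then show "e \<in> (\<Union>u\<in>ball_verts G r v. {e \<in> edges G. u \<in># ends G e})" using e by (auto simp: edges_in_def)
  qed
  moreover have "finite (\<Union>u\<in>ball_verts G r v. {e \<in> edges G. u \<in># ends G e})"
    using fB lf by (intro finite_UN_I) (auto simp: locally_finite_def ball_verts_def)
  ultimately have "finite (edges_in G (ball_verts G r v))" by (rule finite_subset)
  moreover have "wf_graph (fst (nbhd r (G, v)))" using wf by (auto simp: wf_graph_def edges_in_def)
  ultimately show ?thesis
    using fB ball_verts_root[OF v] by (simp add: finite_rooted_graph_def finite_graph_def)
qed

lemma finite_graph_locally_finite: "finite_graph G \<Longrightarrow> locally_finite G"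
  by (simp add: finite_graph_def locally_finite_def)

lemma acyclic_nbhd: "acyclic_graph G \<Longrightarrow> acyclic_graph (fst (nbhd r (G, v)))"
proof -
  have "edges_in G (ball_verts G r v) \<subseteq> edges G" "ball_verts G r v \<subseteq> verts G"
    by (auto simp: edges_in_def ball_verts_def)
  then have "is_cycle (fst (nbhd r (G, v))) vs es \<Longrightarrow> is_cycle G vs es" for vs es
    unfolding is_cycle_def nbhd_simps by blast
  then show "acyclic_graph G \<Longrightarrow> acyclic_graph (fst (nbhd r (G, v)))" by (auto simp: acyclic_graph_def)
qed

section \<open>Convergence in probability to a constant\<close>

text \<open>One number bounds both the deviation and its probability, as in the Ky Fan metric, so
  that the triangle inequality is additive in \<epsilon>.\<close>

definition approx_in_prob ::
  "(nat \<Rightarrow> 'g pmf) \<Rightarrow> (nat \<Rightarrow> 'g \<Rightarrow> real) \<Rightarrow> (nat \<Rightarrow> 'g \<Rightarrow> real) \<Rightarrow> real \<Rightarrow> bool" where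
  "approx_in_prob G X Y \<epsilon> \<longleftrightarrow>
     (\<forall>\<^sub>F n in sequentially. measure_pmf.prob (G n) {g. \<bar>X n g - Y n g\<bar> > \<epsilon>} \<le> \<epsilon>)"

lemma prob_mono_ae:
  assumes "\<And>g. g \<in> set_pmf p \<Longrightarrow> g \<in> A \<Longrightarrow> g \<in> B"
  shows "measure_pmf.prob p A \<le> measure_pmf.prob p B"
  using assms by (intro measure_pmf.finite_measure_mono_AE) (auto simp: AE_measure_pmf_iff)

lemma approx_in_prob_sym: "approx_in_prob G X Y \<epsilon> \<Longrightarrow> approx_in_prob G Y X \<epsilon>"
  by (simp add: approx_in_prob_def abs_minus_commute)

lemma approx_in_prob_mono:
  assumes "approx_in_prob G X Y \<epsilon>" "\<epsilon> \<le> \<delta>" shows "approx_in_prob G X Y \<delta>"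
  using assms(1) unfolding approx_in_prob_def
proof eventually_elim
  case (elim n)
  have "measure_pmf.prob (G n) {g. \<bar>X n g - Y n g\<bar> > \<delta>} \<le> measure_pmf.prob (G n) {g. \<bar>X n g - Y n g\<bar> > \<epsilon>}"
    using assms(2) by (intro prob_mono_ae) auto
  then show ?case using elim assms(2) by simp
qed

lemma approx_in_prob_ae:
  assumes "\<forall>\<^sub>F n in sequentially. \<forall>g\<in>set_pmf (G n). \<bar>X n g - Y n g\<bar> \<le> \<epsilon>" "0 \<le> \<epsilon>"
  shows "approx_in_prob G X Y \<epsilon>"
  using assms(1) unfolding approx_in_prob_def
proof eventually_elim
  case (elim n)
  then have "measure_pmf.prob (G n) {g. \<bar>X n g - Y n g\<bar> > \<epsilon>} \<le> measure_pmf.prob (G n) {}"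
    by (intro prob_mono_ae) force
  then show ?case using assms(2) by simp
qed

lemma approx_in_prob_combine:
  assumes "approx_in_prob G X Y \<epsilon>" "approx_in_prob G X' Y' \<delta>"
    and "\<And>n g. \<bar>U n g - V n g\<bar> \<le> \<bar>X n g - Y n g\<bar> + \<bar>X' n g - Y' n g\<bar>"
  shows "approx_in_prob G U V (\<epsilon> + \<delta>)"
  using assms(1,2) unfolding approx_in_prob_def
proof eventually_elim
  case (elim n)
  let ?A = "{g. \<bar>X n g - Y n g\<bar> > \<epsilon>}" and ?B = "{g. \<bar>X' n g - Y' n g\<bar> > \<delta>}"
  have "measure_pmf.prob (G n) {g. \<bar>U n g - V n g\<bar> > \<epsilon> + \<delta>} \<le> measure_pmf.prob (G n) (?A \<union> ?B)"
  proof (rule prob_mono_ae)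
    fix g assume "g \<in> {g. \<bar>U n g - V n g\<bar> > \<epsilon> + \<delta>}"
    then show "g \<in> ?A \<union> ?B" using assms(3)[of n g] by auto
  qed
  also have "\<dots> \<le> measure_pmf.prob (G n) ?A + measure_pmf.prob (G n) ?B" by (rule measure_Un_le) auto
  finally show ?case using elim by linarith
qed

lemma approx_in_prob_trans:
  "approx_in_prob G X Y \<epsilon> \<Longrightarrow> approx_in_prob G Y Z \<delta> \<Longrightarrow> approx_in_prob G X Z (\<epsilon> + \<delta>)"
  by (rule approx_in_prob_combine) auto

text \<open>For constants the event has probability 0 or 1, so a bound below 1 excludes it.\<close>

lemma approx_in_prob_const:
  assumes "approx_in_prob G (\<lambda>_ _. a) (\<lambda>_ _. b) \<epsilon>" "\<epsilon> < 1" shows "\<bar>a - b\<bar> \<le> \<epsilon>"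
proof (rule ccontr)
  assume "\<not> \<bar>a - b\<bar> \<le> \<epsilon>"
  then have "\<bar>a - b\<bar> > \<epsilon>" by simp
  then show False using assms by (simp add: approx_in_prob_def)
qed

lemma tendsto_in_prob_iff: "tendsto_in_prob G X c \<longleftrightarrow> (\<forall>\<epsilon>>0. approx_in_prob G X (\<lambda>_ _. c) \<epsilon>)"
proof (intro iffI allI impI)
  fix \<epsilon> :: real assume "tendsto_in_prob G X c" "0 < \<epsilon>"
  then have "\<forall>\<^sub>F n in sequentially. measure_pmf.prob (G n) {g. \<bar>X n g - c\<bar> > \<epsilon>} < \<epsilon>"
    by (intro order_tendstoD(2)[where y = 0]) (auto simp: tendsto_in_prob_def)
  then show "approx_in_prob G X (\<lambda>_ _. c) \<epsilon>"
    unfolding approx_in_prob_def by (rule eventually_mono) simp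
next
  assume R: "\<forall>\<epsilon>>0. approx_in_prob G X (\<lambda>_ _. c) \<epsilon>"
  show "tendsto_in_prob G X c"
    unfolding tendsto_in_prob_def
  proof (intro allI impI, rule tendstoI)
    fix \<eta> e :: real assume pos: "0 < \<eta>" "0 < e"
    define \<epsilon> where "\<epsilon> = min \<eta> (e / 2)"
    have \<epsilon>: "0 < \<epsilon>" "\<epsilon> \<le> \<eta>" "\<epsilon> < e" using pos by (auto simp: \<epsilon>_def)
    then have "\<forall>\<^sub>F n in sequentially. measure_pmf.prob (G n) {g. \<bar>X n g - c\<bar> > \<epsilon>} \<le> \<epsilon>"
      using R by (simp add: approx_in_prob_def)
    then show "\<forall>\<^sub>F n in sequentially. dist (measure_pmf.prob (G n) {g. \<eta> < \<bar>X n g - c\<bar>}) 0 < e"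
    proof eventually_elim
      case (elim n)
      have "measure_pmf.prob (G n) {g. \<eta> < \<bar>X n g - c\<bar>} \<le> measure_pmf.prob (G n) {g. \<bar>X n g - c\<bar> > \<epsilon>}"
        using \<epsilon> by (intro prob_mono_ae) auto
      then show ?case using elim \<epsilon> by simp
    qed
  qed
qed

lemma tendsto_in_prob_approx:
  assumes "\<And>\<epsilon>. 0 < \<epsilon> \<Longrightarrow> \<exists>Y d. tendsto_in_prob G Y d \<and> \<bar>d - c\<bar> \<le> \<epsilon> \<and> approx_in_prob G X Y \<epsilon>"
  shows "tendsto_in_prob G X c"
  unfolding tendsto_in_prob_iff
proof (intro allI impI)
  fix \<epsilon> :: real assume "0 < \<epsilon>"
  then have \<epsilon>: "0 < \<epsilon> / 3" by simp
  then obtain Y d where Y: "tendsto_in_prob G Y d" "\<bar>d - c\<bar> \<le> \<epsilon> / 3" "approx_in_prob G X Y (\<epsilon> / 3)"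
    using assms by blast
  have "approx_in_prob G Y (\<lambda>_ _. d) (\<epsilon> / 3)" using Y(1) \<epsilon> unfolding tendsto_in_prob_iff by blast
  moreover have "approx_in_prob G (\<lambda>_ _. d) (\<lambda>_ _. c) (\<epsilon> / 3)" using Y(2) \<epsilon> by (intro approx_in_prob_ae) auto
  ultimately have "approx_in_prob G X (\<lambda>_ _. c) (\<epsilon> / 3 + (\<epsilon> / 3 + \<epsilon> / 3))"
    by (intro approx_in_prob_trans[OF Y(3)] approx_in_prob_trans)
  then show "approx_in_prob G X (\<lambda>_ _. c) \<epsilon>" by simp
qed

text \<open>Completeness: the approximations may change with \<epsilon> and the limit is not known
  in advance. The approximating constants are close to each other, hence Cauchy along a sequence of
  tolerances, and their limit is the limit in probability.\<close>

lemma tendsto_in_prob_approx_const: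
  assumes "\<And>\<epsilon>. 0 < \<epsilon> \<Longrightarrow> \<exists>Y d. tendsto_in_prob G Y d \<and> approx_in_prob G X Y \<epsilon>"
  shows "\<exists>c. tendsto_in_prob G X c"
proof -
  have "\<exists>d. approx_in_prob G X (\<lambda>_ _. d) \<epsilon>" if "0 < \<epsilon>" for \<epsilon>
  proof -
    have \<epsilon>: "0 < \<epsilon> / 2" using that by simp
    then obtain Y d where "tendsto_in_prob G Y d" "approx_in_prob G X Y (\<epsilon> / 2)" using assms by blast
    moreover from this have "approx_in_prob G Y (\<lambda>_ _. d) (\<epsilon> / 2)" using \<epsilon> unfolding tendsto_in_prob_iff by blast
    ultimately have "approx_in_prob G X (\<lambda>_ _. d) (\<epsilon> / 2 + \<epsilon> / 2)" by (intro approx_in_prob_trans)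
    then show ?thesis by auto
  qed
  then have "\<forall>\<epsilon>. \<exists>d. 0 < \<epsilon> \<longrightarrow> approx_in_prob G X (\<lambda>_ _. d) \<epsilon>" by blast
  then obtain d where d: "\<And>\<epsilon>. 0 < \<epsilon> \<Longrightarrow> approx_in_prob G X (\<lambda>_ _. d \<epsilon>) \<epsilon>" unfolding choice_iff by blast
  have close: "\<bar>d \<epsilon> - d \<delta>\<bar> \<le> \<epsilon> + \<delta>" if "0 < \<epsilon>" "0 < \<delta>" "\<epsilon> + \<delta> < 1" for \<epsilon> \<delta>
    using approx_in_prob_const[OF approx_in_prob_trans[OF approx_in_prob_sym[OF d[OF that(1)]] d[OF that(2)]] that(3)] .
  \<comment> \<open>The values are at most 1/4, so any two add up to less than 1, as
    \<open>close\<close> requires.\<close>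
  define s where "s m = inverse (real m + 4)" for m :: nat
  have s: "0 < s m" "s m \<le> 1 / 4" for m by (auto simp: s_def field_simps)
  have s0: "s \<longlonglongrightarrow> 0"
    unfolding s_def by (intro tendsto_inverse_0_at_top filterlim_tendsto_add_at_top[OF tendsto_const] filterlim_real_sequentially
        | subst add.commute)+
  have close_s: "\<bar>d (s m) - d (s k)\<bar> \<le> s m + s k" for m k using s[of m] s[of k] by (intro close) auto
  have "Cauchy (\<lambda>m. d (s m))"
  proof (rule metric_CauchyI)
    fix e :: real assume "0 < e"
    then have "\<forall>\<^sub>F m in sequentially. s m < e / 2" by (intro order_tendstoD(2)[OF s0]) simp
    then obtain N where N: "\<And>m. m \<ge> N \<Longrightarrow> s m < e / 2" by (auto simp: eventually_sequentially)
    have "dist (d (s m)) (d (s k)) < e" if "m \<ge> N" "k \<ge> N" for m k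
      using close_s[of m k] N[OF that(1)] N[OF that(2)] by (simp add: dist_real_def)
    then show "\<exists>M. \<forall>m\<ge>M. \<forall>n\<ge>M. dist (d (s m)) (d (s n)) < e" by blast
  qed
  then obtain c where c: "(\<lambda>m. d (s m)) \<longlonglongrightarrow> c" using Cauchy_convergent convergent_def by blast
  have "approx_in_prob G X (\<lambda>_ _. c) \<epsilon>" if "0 < \<epsilon>" for \<epsilon>
  proof -
    have "\<forall>\<^sub>F m in sequentially. s m < \<epsilon> / 2" "\<forall>\<^sub>F m in sequentially. dist (d (s m)) c < \<epsilon> / 2"
      by (rule order_tendstoD(2)[OF s0], use that in simp) (rule tendstoD[OF c], use that in simp)
    then have "\<forall>\<^sub>F m in sequentially. s m < \<epsilon> / 2 \<and> dist (d (s m)) c < \<epsilon> / 2" by eventually_elim simp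
    then obtain m where m: "s m < \<epsilon> / 2" "dist (d (s m)) c < \<epsilon> / 2" by (auto simp: eventually_sequentially)
    have "approx_in_prob G (\<lambda>_ _. d (s m)) (\<lambda>_ _. c) (\<epsilon> / 2)"
      using m(2) that by (intro approx_in_prob_ae) (auto simp: dist_real_def)
    from approx_in_prob_trans[OF d[OF s(1)] this] show ?thesis
      by (rule approx_in_prob_mono) (use m in simp)
  qed
  then show ?thesis unfolding tendsto_in_prob_iff by blast
qed

lemma tendsto_in_prob_cong:
  assumes "tendsto_in_prob G Y c" "\<forall>\<^sub>F n in sequentially. \<forall>g\<in>set_pmf (G n). X n g = Y n g"
  shows "tendsto_in_prob G X c"
proof (rule tendsto_in_prob_approx)
  fix \<epsilon> :: real assume \<epsilon>: "0 < \<epsilon>"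
  have "approx_in_prob G X Y \<epsilon>"
    by (rule approx_in_prob_ae[OF eventually_mono[OF assms(2)]]) (use \<epsilon> in auto)
  then show "\<exists>Y d. tendsto_in_prob G Y d \<and> \<bar>d - c\<bar> \<le> \<epsilon> \<and> approx_in_prob G X Y \<epsilon>"
    using assms(1) \<epsilon> by (intro exI[of _ Y] exI[of _ c]) auto
qed

lemma tendsto_in_prob_const: "tendsto_in_prob G (\<lambda>n g. c) c"
  by (simp add: tendsto_in_prob_def)

lemma tendsto_in_prob_add:
  assumes "tendsto_in_prob G X c" "tendsto_in_prob G Y d"
  shows "tendsto_in_prob G (\<lambda>n g. X n g + Y n g) (c + d)"
  unfolding tendsto_in_prob_iff
proof (intro allI impI)
  fix \<epsilon> :: real assume "0 < \<epsilon>"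
  then have "0 < \<epsilon> / 2" by simp
  then have "approx_in_prob G X (\<lambda>_ _. c) (\<epsilon> / 2)" "approx_in_prob G Y (\<lambda>_ _. d) (\<epsilon> / 2)"
    using assms unfolding tendsto_in_prob_iff by blast+
  from approx_in_prob_combine[OF this, of "\<lambda>n g. X n g + Y n g" "\<lambda>_ _. c + d"]
  show "approx_in_prob G (\<lambda>n g. X n g + Y n g) (\<lambda>_ _. c + d) \<epsilon>" by simp
qed

lemma tendsto_in_prob_cmult:
  assumes "tendsto_in_prob G X c" shows "tendsto_in_prob G (\<lambda>n g. a * X n g) (a * c)"
proof (cases "a = 0")
  case False
  have "\<epsilon> < \<bar>a * x - a * c\<bar> \<longleftrightarrow> \<epsilon> / \<bar>a\<bar> < \<bar>x - c\<bar>" for \<epsilon> x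
  proof -
    have "\<bar>a * x - a * c\<bar> = \<bar>x - c\<bar> * \<bar>a\<bar>" by (metis abs_mult mult.commute right_diff_distrib)
    then show ?thesis using False by (simp add: pos_divide_less_eq)
  qed
  then show ?thesis using assms False by (simp add: tendsto_in_prob_def)
qed (simp add: tendsto_in_prob_const)

lemma tendsto_in_prob_diff:
  "tendsto_in_prob G X c \<Longrightarrow> tendsto_in_prob G Y d \<Longrightarrow> tendsto_in_prob G (\<lambda>n g. X n g - Y n g) (c - d)"
  using tendsto_in_prob_add[OF _ tendsto_in_prob_cmult[of G Y d "-1"], of X c] by simp

lemma tendsto_in_prob_sum:
  assumes "\<And>i. i \<in> I \<Longrightarrow> tendsto_in_prob G (X i) (c i)"
  shows "tendsto_in_prob G (\<lambda>n g. \<Sum>i\<in>I. X i n g) (\<Sum>i\<in>I. c i)"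
  using assms
  by (induction I rule: infinite_finite_induct) (auto simp: tendsto_in_prob_const intro!: tendsto_in_prob_add)

text \<open>The dominating variables need not vanish; a limit below \<epsilon> is enough. Errors
  that combine a fixed small part with a part tending to 0 in probability are handled in one
  go.\<close>

lemma approx_in_prob_dominated:
  assumes Z: "tendsto_in_prob G Z z" "z < \<epsilon>" and \<epsilon>: "0 < \<epsilon>"
    and le: "\<And>n g. n \<ge> 1 \<Longrightarrow> g \<in> set_pmf (G n) \<Longrightarrow> \<bar>X n g - Y n g\<bar> \<le> Z n g"
  shows "approx_in_prob G X Y \<epsilon>"
proof -
  \<comment> \<open>A deviation above \<epsilon> forces \<open>Z\<close> above \<epsilon>, hence
    more than \<delta> above its limit \<open>z\<close>.\<close>
  define \<delta> where "\<delta> = min \<epsilon> (\<epsilon> - z)"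
  have \<delta>: "0 < \<delta>" "\<delta> \<le> \<epsilon>" "\<delta> \<le> \<epsilon> - z" using Z(2) \<epsilon> by (auto simp: \<delta>_def)
  have "approx_in_prob G Z (\<lambda>_ _. z) \<delta>" using Z(1) \<delta>(1) by (simp add: tendsto_in_prob_iff)
  then show ?thesis
    unfolding approx_in_prob_def using eventually_ge_at_top[of 1]
  proof eventually_elim
    case (elim n)
    have "measure_pmf.prob (G n) {g. \<bar>X n g - Y n g\<bar> > \<epsilon>} \<le> measure_pmf.prob (G n) {g. \<bar>Z n g - z\<bar> > \<delta>}"
    proof (rule prob_mono_ae)
      fix g assume "g \<in> set_pmf (G n)" "g \<in> {g. \<bar>X n g - Y n g\<bar> > \<epsilon>}"
      then show "g \<in> {g. \<bar>Z n g - z\<bar> > \<delta>}" using le[OF elim(2), of g] \<delta>(3) by auto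
    qed
    then show ?case using elim(1) \<delta>(2) by linarith
  qed
qed

lemma tendsto_in_prob_expectation:
  assumes X: "tendsto_in_prob G X c" and K: "\<And>n g. \<bar>X n g\<bar> \<le> K"
  shows "(\<lambda>n. measure_pmf.expectation (G n) (X n)) \<longlonglongrightarrow> c"
proof (rule tendstoI)
  fix e :: real assume e: "0 < e"
  have int: "integrable (measure_pmf (G n)) (X n)" for n
    using K by (intro measure_pmf.integrable_const_bound[of _ K]) auto
  define M where "M = K + \<bar>c\<bar>"
  have M: "\<bar>X n g - c\<bar> \<le> M" for n g using K[of n g] by (simp add: M_def)
  have M0: "0 \<le> M" using M by (rule order.trans[OF abs_ge_zero])
  have "(\<lambda>n. M * measure_pmf.prob (G n) {g. \<bar>X n g - c\<bar> > e / 2}) \<longlonglongrightarrow> M * 0"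
    using X e unfolding tendsto_in_prob_def by (intro tendsto_mult tendsto_const) (meson half_gt_zero)
  then have "\<forall>\<^sub>F n in sequentially. M * measure_pmf.prob (G n) {g. \<bar>X n g - c\<bar> > e / 2} < e / 2"
    using e by (intro order_tendstoD(2)[where y = "M * 0"]) auto
  then show "\<forall>\<^sub>F n in sequentially. dist (measure_pmf.expectation (G n) (X n)) c < e"
  proof eventually_elim
    case (elim n)
    let ?A = "{g. \<bar>X n g - c\<bar> > e / 2}"
    have "\<bar>measure_pmf.expectation (G n) (X n) - c\<bar> = \<bar>measure_pmf.expectation (G n) (\<lambda>g. X n g - c)\<bar>"
      using int by simp
    also have "\<dots> \<le> measure_pmf.expectation (G n) (\<lambda>g. \<bar>X n g - c\<bar>)" by (rule integral_abs_bound)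
    also have "\<dots> \<le> measure_pmf.expectation (G n) (\<lambda>g. e / 2 + M * indicator ?A g)"
    proof (rule integral_mono)
      show "integrable (measure_pmf (G n)) (\<lambda>g. \<bar>X n g - c\<bar>)" using int by simp
      show "integrable (measure_pmf (G n)) (\<lambda>g. e / 2 + M * indicator ?A g)"
        by (intro measure_pmf.integrable_const_bound[of _ "e / 2 + M"]) (use e M0 in \<open>auto simp: indicator_def\<close>)
      fix g show "\<bar>X n g - c\<bar> \<le> e / 2 + M * indicator ?A g" using M[of n g] e by (auto simp: indicator_def)
    qed
    also have "\<dots> = e / 2 + M * measure_pmf.prob (G n) ?A"
    proof -
      have "integrable (measure_pmf (G n)) (\<lambda>g. M * indicator ?A g)"
        by (intro measure_pmf.integrable_const_bound[of _ M]) (use M0 in \<open>auto simp: indicator_def\<close>)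
      from Bochner_Integration.integral_add[OF measure_pmf.integrable_const this, of "e / 2"]
      show ?thesis by simp
    qed
    finally show ?case using elim by (simp add: dist_real_def)
  qed
qed

section \<open>Empirical averages of local functions\<close>

locale tree_like_sequence =
  fixes G :: "nat \<Rightarrow> ('v, 'e) mgraph pmf" and P :: "'a measure" and R :: "'a \<Rightarrow> ('u, 'f) rooted"
  assumes graphs: "\<And>n g. n \<ge> 1 \<Longrightarrow> g \<in> set_pmf (G n) \<Longrightarrow> finite_graph g \<and> card (verts g) = n"
    and tree_like: "locally_tree_like G P R"
begin

lemma local_limit: "local_limit_in_prob G P R"
  using tree_like by (simp add: locally_tree_like_def)

lemma limit_graph: "random_rooted_graph P R"
  using local_limit by (simp add: local_limit_in_prob_def)

sublocale P: prob_space P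
  using limit_graph by (simp add: random_rooted_graph_def)

lemma limit_nbhd_finite: "x \<in> space P \<Longrightarrow> finite_rooted_graph (nbhd r (R x))"
  using limit_graph finite_nbhd[of "fst (R x)" "snd (R x)" r] by (auto simp: random_rooted_graph_def)

lemma nbhd_finite: "n \<ge> 1 \<Longrightarrow> g \<in> set_pmf (G n) \<Longrightarrow> v \<in> verts g \<Longrightarrow> finite_rooted_graph (nbhd r (g, v))"
  using graphs[of n g] by (intro finite_nbhd) (auto intro: finite_graph_locally_finite simp: finite_graph_def)

definition limit_code :: "nat \<Rightarrow> 'a \<Rightarrow> nat" where
  "limit_code r x = graph_code (nbhd r (R x))"

definition freq :: "nat \<Rightarrow> nat \<Rightarrow> ('v, 'e) mgraph \<Rightarrow> real" where
  "freq r i g = real (card {v \<in> verts g. graph_code (nbhd r (g, v)) = i}) / real (card (verts g))"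

definition empirical :: "(nat \<Rightarrow> real) \<Rightarrow> nat \<Rightarrow> ('v, 'e) mgraph \<Rightarrow> real" where
  "empirical \<phi> r g = (\<Sum>v\<in>verts g. \<phi> (graph_code (nbhd r (g, v)))) / real (card (verts g))"

lemma limit_code_set:
  "{x \<in> space P. limit_code r x = i} =
     (if minimal_code i then {x \<in> space P. rooted_iso (nbhd r (R x)) (code_graph i)} else {})"
  using graph_code_eq_iff[OF limit_nbhd_finite] by (auto simp: limit_code_def)

lemma minimal_code_finite: "minimal_code i \<Longrightarrow> finite_rooted (code_graph i)"
  by (auto simp: minimal_code_def finite_rooted_def finite_rooted_graph_def)

lemma limit_code_measurable [measurable]: "limit_code r \<in> measurable P (count_space UNIV)"
proof -
  have "limit_code r -` {i} \<inter> space P \<in> sets P" for i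
  proof -
    have "limit_code r -` {i} \<inter> space P = {x \<in> space P. limit_code r x = i}" by auto
    also have "\<dots> \<in> sets P"
    proof (cases "minimal_code i")
      case True
      then have "{x \<in> space P. rooted_iso (nbhd r (R x)) (code_graph i)} \<in> sets P"
        using limit_graph minimal_code_finite[of i] unfolding random_rooted_graph_def by blast
      with True show ?thesis unfolding limit_code_set by simp
    next
      case False
      then show ?thesis unfolding limit_code_set by simp
    qed
    finally show ?thesis .
  qed
  then show ?thesis by (auto simp: measurable_count_space_eq2_countable)
qed

lemma tendsto_freq: "tendsto_in_prob G (\<lambda>n. freq r i) (P.prob {x \<in> space P. limit_code r x = i})"
proof (cases "minimal_code i")
  case True
  have "tendsto_in_prob G (\<lambda>n g. real (card {v \<in> verts g. rooted_iso (nbhd r (g, v)) (code_graph i)}) / real (card (verts g)))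
     (P.prob {x \<in> space P. rooted_iso (nbhd r (R x)) (code_graph i)})"
    using local_limit minimal_code_finite[OF True] unfolding local_limit_in_prob_def by blast
  then show ?thesis
    unfolding limit_code_set if_P[OF True]
  proof (rule tendsto_in_prob_cong)
    show "\<forall>\<^sub>F n in sequentially. \<forall>g\<in>set_pmf (G n). freq r i g =
        real (card {v \<in> verts g. rooted_iso (nbhd r (g, v)) (code_graph i)}) / real (card (verts g))"
      using eventually_ge_at_top[of 1]
    proof eventually_elim
      case (elim n)
      have "{v \<in> verts g. graph_code (nbhd r (g, v)) = i} = {v \<in> verts g. rooted_iso (nbhd r (g, v)) (code_graph i)}"
        if "g \<in> set_pmf (G n)" for g
        using graph_code_eq_iff[OF nbhd_finite[OF elim that]] True by auto
      then show ?case by (simp add: freq_def)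
    qed
  qed
next
  case False
  have "tendsto_in_prob G (\<lambda>n. freq r i) 0"
  proof (rule tendsto_in_prob_cong[OF tendsto_in_prob_const])
    show "\<forall>\<^sub>F n in sequentially. \<forall>g\<in>set_pmf (G n). freq r i g = 0"
      using eventually_ge_at_top[of 1]
    proof eventually_elim
      case (elim n)
      have "freq r i g = 0" if "g \<in> set_pmf (G n)" for g
      proof -
        have *: "{v \<in> verts g. graph_code (nbhd r (g, v)) = i} = {}"
          using graph_code_eq_iff[OF nbhd_finite[OF elim that]] False by auto
        show ?thesis unfolding freq_def * by simp
      qed
      then show ?case by simp
    qed
  qed
  then show ?thesis unfolding limit_code_set using False by simp
qed

text \<open>The error comes from the vertices whose code is at least \<open>N\<close>. Each
  contributes at most \<open>K\<close>, and their proportion is the missing mass of the first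
  \<open>N\<close> classes.\<close>

lemma empirical_freq_split:
  assumes g: "finite (verts g)" "verts g \<noteq> {}" and \<phi>: "\<And>i. \<bar>\<phi> i\<bar> \<le> K"
  shows "\<bar>empirical \<phi> r g - (\<Sum>i<N. \<phi> i * freq r i g)\<bar> \<le> K * (1 - (\<Sum>i<N. freq r i g))"
proof -
  let ?c = "\<lambda>v. graph_code (nbhd r (g, v))"
  let ?A = "{v \<in> verts g. ?c v < N}" and ?B = "{v \<in> verts g. \<not> ?c v < N}"
  have n: "card (verts g) > 0" using g by (simp add: card_gt_0_iff)
  have fibre: "(\<Sum>i<N. \<psi> i * freq r i g) = (\<Sum>v\<in>?A. \<psi> (?c v)) / card (verts g)" for \<psi> :: "nat \<Rightarrow> real"
  proof -
    have "(\<Sum>v\<in>?A. \<psi> (?c v)) = (\<Sum>i<N. \<Sum>v\<in>{v \<in> ?A. ?c v = i}. \<psi> (?c v))"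
      using g by (intro sum.group[symmetric]) auto
    also have "\<dots> = (\<Sum>i<N. \<psi> i * real (card {v \<in> verts g. ?c v = i}))"
    proof (rule sum.cong)
      fix i assume "i \<in> {..<N}"
      then have "{v \<in> ?A. ?c v = i} = {v \<in> verts g. ?c v = i}" by auto
      then show "(\<Sum>v\<in>{v \<in> ?A. ?c v = i}. \<psi> (?c v)) = \<psi> i * real (card {v \<in> verts g. ?c v = i})" by simp
    qed simp
    finally show ?thesis by (simp add: freq_def sum_divide_distrib)
  qed
  have split: "(\<Sum>v\<in>verts g. f v) = (\<Sum>v\<in>?A. f v) + (\<Sum>v\<in>?B. f v)" for f :: "'v \<Rightarrow> real"
    using g by (subst sum.union_disjoint[symmetric]) (auto intro!: sum.cong)
  have "empirical \<phi> r g - (\<Sum>i<N. \<phi> i * freq r i g) = (\<Sum>v\<in>?B. \<phi> (?c v)) / card (verts g)"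
    unfolding empirical_def fibre split[of "\<lambda>v. \<phi> (?c v)"] by (simp add: add_divide_distrib)
  also have "\<bar>\<dots>\<bar> \<le> (\<Sum>v\<in>?B. K) / card (verts g)"
    unfolding abs_divide using \<phi> n by (intro divide_mono order.trans[OF sum_abs] sum_mono) (auto intro!: sum_nonneg)
  also have "\<dots> = K * (1 - (\<Sum>i<N. freq r i g))"
  proof -
    have "(\<Sum>i<N. freq r i g) = real (card ?A) / card (verts g)" using fibre[of "\<lambda>_. 1"] by simp
    moreover have "real (card (verts g)) = real (card ?A) + real (card ?B)" using split[of "\<lambda>_. 1"] by simp
    ultimately show ?thesis using n by (simp add: field_simps)
  qed
  finally show ?thesis .
qed

text \<open>Local convergence speaks of one isomorphism class at a time, and there are infinitely
  many. The limit law puts little mass on codes beyond some \<open>N\<close>; as the first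
  \<open>N\<close> frequencies converge, the graphs inherit this bound on the remaining
  mass.\<close>

lemma tendsto_empirical:
  assumes \<phi>: "\<And>i. \<bar>\<phi> i\<bar> \<le> K"
  shows "tendsto_in_prob G (\<lambda>n. empirical \<phi> r) (\<integral>x. \<phi> (limit_code r x) \<partial>P)"
proof (rule tendsto_in_prob_approx)
  fix \<epsilon> :: real assume \<epsilon>: "0 < \<epsilon>"
  have K0: "0 \<le> K" using \<phi>[of 0] by (rule order.trans[OF abs_ge_zero])
  define p where "p i = P.prob {x \<in> space P. limit_code r x = i}" for i
  define T where "T N = {x \<in> space P. limit_code r x \<ge> N}" for N
  have T[measurable]: "T N \<in> sets P" for N unfolding T_def by measurable
  have partial: "(\<integral>x. (if limit_code r x < N then \<psi> (limit_code r x) else 0) \<partial>P) = (\<Sum>i<N. \<psi> i * p i)" for N and \<psi> :: "nat \<Rightarrow> real"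
  proof -
    have "(\<integral>x. (if limit_code r x < N then \<psi> (limit_code r x) else 0) \<partial>P) =
        (\<integral>x. (\<Sum>i<N. \<psi> i * indicator {x \<in> space P. limit_code r x = i} x) \<partial>P)"
    proof (rule Bochner_Integration.integral_cong)
      fix x assume x: "x \<in> space P"
      have "(\<Sum>i<N. \<psi> i * indicator {x \<in> space P. limit_code r x = i} x) = (\<Sum>i<N. if i = limit_code r x then \<psi> i else 0)"
        using x by (intro sum.cong) (auto simp: indicator_def)
      then show "(if limit_code r x < N then \<psi> (limit_code r x) else 0) =
          (\<Sum>i<N. \<psi> i * indicator {x \<in> space P. limit_code r x = i} x)" by (auto simp: sum.delta)
    qed simp
    also have "\<dots> = (\<Sum>i<N. \<psi> i * p i)"
      by (subst Bochner_Integration.integral_sum) (auto simp: p_def P.emeasure_eq_measure)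
    finally show ?thesis .
  qed
  have "(\<lambda>N. P.prob (T N)) \<longlonglongrightarrow> P.prob (\<Inter>N. T N)"
    by (rule P.finite_Lim_measure_decseq) (auto simp: decseq_def T_def)
  moreover have "(\<Inter>N. T N) = {}" unfolding T_def using not_less_eq_eq by blast
  ultimately have "(\<lambda>N. P.prob (T N)) \<longlonglongrightarrow> 0" by simp
  \<comment> \<open>The denominator has \<open>K + 1\<close> because \<open>K\<close> may be
    0.\<close>
  then have "\<forall>\<^sub>F N in sequentially. P.prob (T N) < \<epsilon> / (2 * (K + 1))"
    using \<epsilon> K0 by (intro order_tendstoD(2)) auto
  then obtain N where N: "P.prob (T N) < \<epsilon> / (2 * (K + 1))" by (auto simp: eventually_sequentially)
  have small: "(K + 1) * P.prob (T N) < \<epsilon> / 2" using N K0 by (simp add: field_simps)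
  have KT: "K * P.prob (T N) < \<epsilon>"
    using mult_right_mono[of K "K + 1" "P.prob (T N)"] small \<epsilon> by simp
  define Y where "Y n g = (\<Sum>i<N. \<phi> i * freq r i g)" for n :: nat and g
  define d where "d = (\<Sum>i<N. \<phi> i * p i)"
  have Y: "tendsto_in_prob G Y d"
    unfolding Y_def [abs_def] d_def p_def by (intro tendsto_in_prob_sum tendsto_in_prob_cmult tendsto_freq)
  have tail: "1 - (\<Sum>i<N. p i) = P.prob (T N)"
  proof -
    have "(\<Sum>i<N. p i) = (\<integral>x. (if limit_code r x < N then 1 else 0) \<partial>P)" using partial[of N "\<lambda>_. 1"] by simp
    also have "\<dots> = (\<integral>x. 1 - indicator (T N) x \<partial>P)"
      by (rule Bochner_Integration.integral_cong) (auto simp: T_def indicator_def)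
    also have "\<dots> = 1 - P.prob (T N)" by (subst Bochner_Integration.integral_diff) (auto simp: P.emeasure_eq_measure P.prob_space)
    finally show ?thesis by simp
  qed
  have int: "integrable P (\<lambda>x. \<phi> (limit_code r x))" "integrable P (\<lambda>x. if limit_code r x < N then \<phi> (limit_code r x) else 0)"
    using \<phi> K0 by (auto intro!: P.integrable_const_bound[of _ K])
  have intT: "integrable P (\<lambda>x. K * indicator (T N) x)"
    using K0 by (intro P.integrable_const_bound[of _ K]) (auto simp: indicator_def)
  have "\<bar>d - (\<integral>x. \<phi> (limit_code r x) \<partial>P)\<bar> = \<bar>(\<integral>x. (if limit_code r x < N then \<phi> (limit_code r x) else 0) - \<phi> (limit_code r x) \<partial>P)\<bar>"
    using int by (simp add: d_def partial)
  also have "\<dots> \<le> (\<integral>x. \<bar>(if limit_code r x < N then \<phi> (limit_code r x) else 0) - \<phi> (limit_code r x)\<bar> \<partial>P)"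
    by (rule integral_abs_bound)
  also have "\<dots> \<le> (\<integral>x. K * indicator (T N) x \<partial>P)"
  proof (rule integral_mono[OF _ intT])
    fix x assume "x \<in> space P"
    then show "\<bar>(if limit_code r x < N then \<phi> (limit_code r x) else 0) - \<phi> (limit_code r x)\<bar> \<le> K * indicator (T N) x"
      using \<phi> by (auto simp: T_def indicator_def)
  qed (use int in simp)
  also have "\<dots> = K * P.prob (T N)" by simp
  also have "\<dots> \<le> \<epsilon>" using KT by simp
  finally have d: "\<bar>d - (\<integral>x. \<phi> (limit_code r x) \<partial>P)\<bar> \<le> \<epsilon>" .
  have "approx_in_prob G (\<lambda>n. empirical \<phi> r) Y \<epsilon>"
  proof (rule approx_in_prob_dominated[OF _ _ \<epsilon>])
    show "tendsto_in_prob G (\<lambda>n g. K * (1 - (\<Sum>i<N. freq r i g))) (K * (1 - (\<Sum>i<N. p i)))"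
      unfolding p_def
      by (intro tendsto_in_prob_cmult tendsto_in_prob_diff tendsto_in_prob_const tendsto_in_prob_sum tendsto_freq)
    show "K * (1 - (\<Sum>i<N. p i)) < \<epsilon>" unfolding tail by (rule KT)
    fix n g assume n: "n \<ge> (1::nat)" and g: "g \<in> set_pmf (G n)"
    have "finite (verts g)" "verts g \<noteq> {}" using graphs[OF n g] n by (auto simp: finite_graph_def)
    then show "\<bar>empirical \<phi> r g - Y n g\<bar> \<le> K * (1 - (\<Sum>i<N. freq r i g))"
      unfolding Y_def by (rule empirical_freq_split) (rule \<phi>)
  qed
  with Y d show "\<exists>Y d. tendsto_in_prob G Y d \<and> \<bar>d - (\<integral>x. \<phi> (limit_code r x) \<partial>P)\<bar> \<le> \<epsilon> \<and>
      approx_in_prob G (\<lambda>n. empirical \<phi> r) Y \<epsilon>" by blast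
qed

definition cyclic_fraction :: "nat \<Rightarrow> ('v, 'e) mgraph \<Rightarrow> real" where
  "cyclic_fraction r g = real (card {v \<in> verts g. \<not> acyclic_graph (fst (nbhd r (g, v)))}) / real (card (verts g))"

text \<open>Having a cycle in the ball of radius \<open>r\<close> is a bounded local quantity, and
  it vanishes almost surely in the limit tree.\<close>

lemma tendsto_cyclic_fraction: "tendsto_in_prob G (\<lambda>n. cyclic_fraction r) 0"
proof -
  define \<phi> where "\<phi> i = (if acyclic_graph (fst (code_graph i)) then 0 else 1 :: real)" for i
  have "AE x in P. \<phi> (limit_code r x) = 0"
  proof -
    have "AE x in P. is_tree (fst (R x))" using tree_like by (simp add: locally_tree_like_def)
    with AE_space show ?thesis
    proof eventually_elim
      case (elim x)
      then have "acyclic_graph (fst (R x))" by (simp add: is_tree_def acyclic_graph_def)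
      then have "acyclic_graph (fst (nbhd r (R x)))" using acyclic_nbhd[of "fst (R x)" r "snd (R x)"] by simp
      then show ?case using acyclic_code[OF limit_nbhd_finite[OF elim(1)]] by (simp add: \<phi>_def limit_code_def)
    qed
  qed
  then have "(\<integral>x. \<phi> (limit_code r x) \<partial>P) = 0" by (simp add: integral_eq_zero_AE)
  then have "tendsto_in_prob G (\<lambda>n. empirical \<phi> r) 0"
    using tendsto_empirical[of \<phi> 1 r] by (auto simp: \<phi>_def)
  then show ?thesis
  proof (rule tendsto_in_prob_cong)
    show "\<forall>\<^sub>F n in sequentially. \<forall>g\<in>set_pmf (G n). cyclic_fraction r g = empirical \<phi> r g"
      using eventually_ge_at_top[of 1]
    proof (eventually_elim, intro ballI)
      fix n g assume n: "n \<ge> (1::nat)" and g: "g \<in> set_pmf (G n)"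
      have fin: "finite (verts g)" using graphs[OF n g] by (simp add: finite_graph_def)
      have "(\<Sum>v\<in>verts g. \<phi> (graph_code (nbhd r (g, v)))) =
          (\<Sum>v\<in>verts g. if \<not> acyclic_graph (fst (nbhd r (g, v))) then 1 else 0)"
        using acyclic_code[OF nbhd_finite[OF n g]] by (intro sum.cong) (auto simp: \<phi>_def)
      also have "\<dots> = real (card {v \<in> verts g. \<not> acyclic_graph (fst (nbhd r (g, v)))})"
        using fin by (simp flip: sum.inter_filter)
      finally show "cyclic_fraction r g = empirical \<phi> r g" by (simp add: cyclic_fraction_def empirical_def)
    qed
  qed
qed

end

text \<open>The truncations are bounded and continuous in the value of \<open>f\<close>, so weak
  convergence applies to them. The maximum with 0 matches \<open>ennreal\<close>, which sends
  negative numbers to 0.\<close>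

lemma nn_integral_truncation:
  fixes f :: "'a \<Rightarrow> real"
  assumes [measurable]: "f \<in> borel_measurable M"
  shows "(\<integral>\<^sup>+ x. ennreal (f x) \<partial>M) = (SUP K. \<integral>\<^sup>+ x. ennreal (min (max (f x) 0) (real K)) \<partial>M)"
proof -
  have "(SUP K. ennreal (min (max y 0) (real K))) = ennreal y" for y :: real
  proof (rule SUP_eqI)
    fix K show "ennreal (min (max y 0) (real K)) \<le> ennreal y" by (auto simp: ennreal_le_iff2 min_def max_def)
  next
    fix z assume z: "\<And>K. K \<in> UNIV \<Longrightarrow> ennreal (min (max y 0) (real K)) \<le> z"
    obtain K where "max y 0 \<le> real K" using real_arch_simple by blast
    then have "min (max y 0) (real K) = max y 0" by simp
    moreover have "ennreal (max y 0) = ennreal y" by (auto simp: max_def ennreal_neg)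
    ultimately show "ennreal y \<le> z" using z[of K] by simp
  qed
  then have "(\<integral>\<^sup>+ x. ennreal (f x) \<partial>M) = (\<integral>\<^sup>+ x. (SUP K. ennreal (min (max (f x) 0) (real K))) \<partial>M)" by simp
  also have "\<dots> = (SUP K. \<integral>\<^sup>+ x. ennreal (min (max (f x) 0) (real K)) \<partial>M)"
    by (rule nn_integral_monotone_convergence_SUP) (auto simp: incseq_def le_fun_def intro!: ennreal_leI)
  finally show ?thesis .
qed

section \<open>Convergence of the mean degree\<close>

context tree_like_sequence
begin

definition mean_degree :: "('v, 'e) mgraph \<Rightarrow> real" where
  "mean_degree g = (\<Sum>v\<in>verts g. real (degree g v)) / real (card (verts g))"

definition trunc_degree :: "real \<Rightarrow> ('v, 'e) mgraph \<Rightarrow> real" where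
  "trunc_degree K g = (\<Sum>v\<in>verts g. min (real (degree g v)) K) / real (card (verts g))"

definition limit_degree :: "'a \<Rightarrow> real" where
  "limit_degree x = real (degree (fst (R x)) (snd (R x)))"

lemma limit_degree_code:
  assumes "x \<in> space P"
  shows "limit_degree x = real (degree (fst (code_graph (limit_code 1 x))) (snd (code_graph (limit_code 1 x))))"
proof -
  obtain g v where Rx: "R x = (g, v)" by (cases "R x")
  have "wf_graph g" "v \<in> verts g" using limit_graph assms by (auto simp: random_rooted_graph_def Rx dest!: bspec)
  then have "degree (fst (nbhd (Suc 0) (g, v))) v = degree g v" by (intro degree_nbhd ball_verts_root)
  then show ?thesis
    using root_degree_code[OF limit_nbhd_finite[OF assms, of 1]] by (simp add: limit_degree_def limit_code_def Rx)
qed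

lemma limit_degree_measurable [measurable]: "limit_degree \<in> borel_measurable P"
proof -
  have "(\<lambda>x. real (degree (fst (code_graph (limit_code 1 x))) (snd (code_graph (limit_code 1 x))))) \<in> borel_measurable P"
    by measurable
  then show ?thesis using limit_degree_code by (simp cong: measurable_cong)
qed

lemma limit_degree_nonneg: "0 \<le> limit_degree x"
  by (simp add: limit_degree_def)

lemma tendsto_trunc_degree:
  assumes "0 \<le> K" shows "tendsto_in_prob G (\<lambda>n. trunc_degree K) (\<integral>x. min (limit_degree x) K \<partial>P)"
proof -
  define \<phi> where "\<phi> i = min (real (degree (fst (code_graph i)) (snd (code_graph i)))) K" for i
  have "\<bar>\<phi> i\<bar> \<le> K" for i using assms by (auto simp: \<phi>_def)
  then have "tendsto_in_prob G (\<lambda>n. empirical \<phi> 1) (\<integral>x. \<phi> (limit_code 1 x) \<partial>P)" by (rule tendsto_empirical)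
  also have "(\<integral>x. \<phi> (limit_code 1 x) \<partial>P) = (\<integral>x. min (limit_degree x) K \<partial>P)"
    by (rule Bochner_Integration.integral_cong) (simp_all add: \<phi>_def limit_degree_code)
  finally have lim: "tendsto_in_prob G (\<lambda>n. empirical \<phi> 1) (\<integral>x. min (limit_degree x) K \<partial>P)" .
  have "\<forall>\<^sub>F n in sequentially. \<forall>g\<in>set_pmf (G n). trunc_degree K g = empirical \<phi> 1 g"
    using eventually_ge_at_top[of 1]
  proof (eventually_elim, intro ballI)
    fix n g assume n: "n \<ge> (1::nat)" and g: "g \<in> set_pmf (G n)"
    have wf: "wf_graph g" using graphs[OF n g] by (simp add: finite_graph_def)
    have "\<phi> (graph_code (nbhd 1 (g, v))) = min (real (degree g v)) K" if "v \<in> verts g" for v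
      using root_degree_code[OF nbhd_finite[OF n g that, of 1]] degree_nbhd[OF wf ball_verts_root[OF that, of 0]]
      by (simp add: \<phi>_def)
    then show "trunc_degree K g = empirical \<phi> 1 g" by (simp add: trunc_degree_def empirical_def)
  qed
  then show ?thesis by (rule tendsto_in_prob_cong[OF lim])
qed

lemma nn_integral_degree_law:
  assumes n: "n \<ge> 1" and f: "\<And>d. 0 \<le> f d"
  shows "(\<integral>\<^sup>+ d. ennreal (f d) \<partial>measure_pmf (degree_law (G n))) =
    (\<integral>\<^sup>+ g. ennreal ((\<Sum>v\<in>verts g. f (degree g v)) / real (card (verts g))) \<partial>measure_pmf (G n))"
  unfolding degree_law_def nn_integral_bind_pmf
proof (rule nn_integral_cong_AE, unfold AE_measure_pmf_iff, intro ballI)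
  fix g assume g: "g \<in> set_pmf (G n)"
  have fin: "finite (verts g)" "verts g \<noteq> {}" "card (verts g) > 0" using graphs[OF n g] n by (auto simp: finite_graph_def card_gt_0_iff)
  have "(\<integral>\<^sup>+ v. \<integral>\<^sup>+ d. ennreal (f d) \<partial>measure_pmf (return_pmf (degree g v)) \<partial>measure_pmf (pmf_of_set (verts g))) =
      (\<Sum>v\<in>verts g. ennreal (f (degree g v))) / card (verts g)"
    using fin by (simp add: nn_integral_pmf_of_set)
  also have "\<dots> = ennreal ((\<Sum>v\<in>verts g. f (degree g v)) / real (card (verts g)))"
    using f fin by (simp add: sum_ennreal divide_ennreal sum_nonneg ennreal_of_nat_eq_real_of_nat)
  finally show "(\<integral>\<^sup>+ v. \<integral>\<^sup>+ d. ennreal (f d) \<partial>measure_pmf (return_pmf (degree g v)) \<partial>measure_pmf (pmf_of_set (verts g))) =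
      ennreal ((\<Sum>v\<in>verts g. f (degree g v)) / real (card (verts g)))" .
qed

lemma trunc_degree_bounds:
  assumes "0 \<le> K" shows "0 \<le> trunc_degree K g" "trunc_degree K g \<le> K" "\<bar>trunc_degree K g\<bar> \<le> K"
proof -
  show 1: "0 \<le> trunc_degree K g" using assms by (auto simp: trunc_degree_def intro!: divide_nonneg_nonneg sum_nonneg)
  have "(\<Sum>v\<in>verts g. min (real (degree g v)) K) \<le> real (card (verts g)) * K" by (rule sum_bounded_above) simp
  then show 2: "trunc_degree K g \<le> K" using assms by (simp add: trunc_degree_def divide_le_eq mult.commute)
  show "\<bar>trunc_degree K g\<bar> \<le> K" using 1 2 by simp
qed

text \<open>Uniform sparsity provides some limit law \<mu> of the degree, with no stated relation to
  the limit graph. The two have the same truncated means, since weak convergence and local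
  convergence compute the limit of the same sequence; removing the truncation identifies the
  means.\<close>

lemma nn_integral_limit_degree:
  assumes "real_distribution \<mu>" "weak_conv_m (\<lambda>n. distr (measure_pmf (degree_law (G n))) borel real) \<mu>"
  shows "(\<integral>\<^sup>+ x. ennreal x \<partial>\<mu>) = (\<integral>\<^sup>+ x. ennreal (limit_degree x) \<partial>P)"
proof -
  interpret \<mu>: real_distribution \<mu> by fact
  have trunc: "(\<integral>\<^sup>+ x. ennreal (min (max x 0) (real K)) \<partial>\<mu>) = (\<integral>\<^sup>+ x. ennreal (min (max (limit_degree x) 0) (real K)) \<partial>P)" for K :: nat
  proof -
    let ?f = "\<lambda>x::real. min (max x 0) (real K)"
    have cont: "isCont ?f x" for x by (intro continuous_intros)
    have mu: "real_distribution (distr (measure_pmf (degree_law (G n))) borel real)" for n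
      by (rule prob_space.real_distribution_distr[OF prob_space_measure_pmf]) simp
    have "(\<lambda>n. integral\<^sup>L (distr (measure_pmf (degree_law (G n))) borel real) ?f) \<longlonglongrightarrow> integral\<^sup>L \<mu> ?f"
      by (rule weak_conv_imp_integral_bdd_continuous_conv[OF mu assms(1,2) cont, of "real K"]) auto
    moreover have "(\<lambda>n. integral\<^sup>L (distr (measure_pmf (degree_law (G n))) borel real) ?f) \<longlonglongrightarrow>
        (\<integral>x. min (limit_degree x) (real K) \<partial>P)"
    proof (rule Lim_transform_eventually)
      show "(\<lambda>n. measure_pmf.expectation (G n) (trunc_degree (real K))) \<longlonglongrightarrow> (\<integral>x. min (limit_degree x) (real K) \<partial>P)"
        by (rule tendsto_in_prob_expectation[OF tendsto_trunc_degree, of _ "real K"]) (auto simp: trunc_degree_bounds)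
      show "\<forall>\<^sub>F n in sequentially. measure_pmf.expectation (G n) (trunc_degree (real K)) =
          integral\<^sup>L (distr (measure_pmf (degree_law (G n))) borel real) ?f"
        using eventually_ge_at_top[of 1]
      proof eventually_elim
        case (elim n)
        have "integral\<^sup>L (distr (measure_pmf (degree_law (G n))) borel real) ?f =
            measure_pmf.expectation (degree_law (G n)) (\<lambda>d. min (real d) (real K))"
          by (subst integral_distr) auto
        also have "\<dots> = enn2real (\<integral>\<^sup>+ d. ennreal (min (real d) (real K)) \<partial>measure_pmf (degree_law (G n)))"
          by (rule integral_eq_nn_integral) auto
        also have "\<dots> = enn2real (\<integral>\<^sup>+ g. ennreal (trunc_degree (real K) g) \<partial>measure_pmf (G n))"
          unfolding trunc_degree_def by (subst nn_integral_degree_law[OF elim]) auto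
        also have "\<dots> = measure_pmf.expectation (G n) (trunc_degree (real K))"
          by (rule integral_eq_nn_integral[symmetric]) (auto simp: trunc_degree_bounds)
        finally show ?case by simp
      qed
    qed
    ultimately have eq: "integral\<^sup>L \<mu> ?f = (\<integral>x. min (limit_degree x) (real K) \<partial>P)" by (rule LIMSEQ_unique)
    have "(\<integral>\<^sup>+ x. ennreal (?f x) \<partial>\<mu>) = ennreal (integral\<^sup>L \<mu> ?f)"
      by (intro nn_integral_eq_integral \<mu>.integrable_const_bound[of _ "real K"]) auto
    also have "\<dots> = (\<integral>\<^sup>+ x. ennreal (min (limit_degree x) (real K)) \<partial>P)"
      unfolding eq using limit_degree_nonneg
      by (intro nn_integral_eq_integral[symmetric] P.integrable_const_bound[of _ "real K"]) (auto simp: abs_of_nonneg)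
    finally show ?thesis using limit_degree_nonneg by (simp add: max_absorb1)
  qed
  have "(\<integral>\<^sup>+ x. ennreal x \<partial>\<mu>) = (SUP K. \<integral>\<^sup>+ x. ennreal (min (max x 0) (real K)) \<partial>\<mu>)"
    by (rule nn_integral_truncation) simp
  also have "\<dots> = (\<integral>\<^sup>+ x. ennreal (limit_degree x) \<partial>P)"
    unfolding trunc by (rule nn_integral_truncation[symmetric]) simp
  finally show ?thesis .
qed

text \<open>Only truncated degrees are bounded local quantities. Convergence of the untruncated
  means makes the expected loss by truncation small, and as this loss is nonnegative, Markov's
  inequality makes it small in probability.\<close>

lemma tendsto_mean_degree: "tendsto_in_prob G (\<lambda>n. mean_degree) (\<integral>x. limit_degree x \<partial>P)"
proof -
  obtain \<mu> where \<mu>: "real_distribution \<mu>" "weak_conv_m (\<lambda>n. distr (measure_pmf (degree_law (G n))) borel real) \<mu>"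
    "(\<lambda>n. \<integral>\<^sup>+ d. ennreal (real d) \<partial>measure_pmf (degree_law (G n))) \<longlonglongrightarrow> (\<integral>\<^sup>+ x. ennreal x \<partial>\<mu>)"
    "(\<integral>\<^sup>+ x. ennreal x \<partial>\<mu>) < \<infinity>"
    using tree_like by (auto simp: locally_tree_like_def uniformly_sparse_def)
  define y where "y = (\<integral>x. limit_degree x \<partial>P)"
  have fin: "(\<integral>\<^sup>+ x. ennreal (limit_degree x) \<partial>P) < \<infinity>" using \<mu>(4) nn_integral_limit_degree[OF \<mu>(1,2)] by simp
  then have int: "integrable P limit_degree" by (intro integrableI_nonneg) (auto simp: limit_degree_nonneg)
  have y: "(\<integral>\<^sup>+ x. ennreal (limit_degree x) \<partial>P) = ennreal y"
    unfolding y_def using int limit_degree_nonneg by (intro nn_integral_eq_integral) auto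
  have y0: "0 \<le> y" unfolding y_def using limit_degree_nonneg by simp
  define a where "a n = (\<integral>\<^sup>+ g. ennreal (mean_degree g) \<partial>measure_pmf (G n))" for n
  have mean0: "0 \<le> mean_degree g" for g by (auto simp: mean_degree_def intro!: divide_nonneg_nonneg sum_nonneg)
  have a: "a \<longlonglongrightarrow> ennreal y"
  proof (rule Lim_transform_eventually)
    show "(\<lambda>n. \<integral>\<^sup>+ d. ennreal (real d) \<partial>measure_pmf (degree_law (G n))) \<longlonglongrightarrow> ennreal y"
      using \<mu>(3) nn_integral_limit_degree[OF \<mu>(1,2)] y by simp
    show "\<forall>\<^sub>F n in sequentially. (\<integral>\<^sup>+ d. ennreal (real d) \<partial>measure_pmf (degree_law (G n))) = a n"
      using eventually_ge_at_top[of 1] by eventually_elim (simp add: nn_integral_degree_law a_def mean_degree_def)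
  qed
  then have ea: "(\<lambda>n. enn2real (a n)) \<longlonglongrightarrow> y" by (rule tendsto_enn2real) (rule y0)
  \<comment> \<open>For finitely many \<open>n\<close> the mean could be infinite, and
    \<open>enn2real\<close> would then return 0.\<close>
  have afin: "\<forall>\<^sub>F n in sequentially. a n < \<infinity>" using a by (rule order_tendstoD) simp
  have trunc: "(\<lambda>K. \<integral>x. min (limit_degree x) (real K) \<partial>P) \<longlonglongrightarrow> y"
    unfolding y_def
  proof (rule integral_dominated_convergence[where w = limit_degree])
    show "AE x in P. (\<lambda>K. min (limit_degree x) (real K)) \<longlonglongrightarrow> limit_degree x"
    proof (rule AE_I2, rule tendsto_eventually)
      fix x
      obtain N where "limit_degree x \<le> real N" using real_arch_simple by blast
      then show "\<forall>\<^sub>F K in sequentially. min (limit_degree x) (real K) = limit_degree x"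
        unfolding eventually_sequentially by (intro exI[of _ N]) auto
    qed
  qed (use int limit_degree_nonneg in auto)
  show ?thesis
    unfolding y_def[symmetric]
  proof (rule tendsto_in_prob_approx)
    fix \<epsilon> :: real assume \<epsilon>: "0 < \<epsilon>"
    \<comment> \<open>The square of \<epsilon> survives the division by \<epsilon> in Markov's
      inequality.\<close>
    then have "\<forall>\<^sub>F K in sequentially. dist (\<integral>x. min (limit_degree x) (real K) \<partial>P) y < min \<epsilon> (\<epsilon> * \<epsilon>)"
      by (intro tendstoD[OF trunc]) simp
    then obtain K where K: "dist (\<integral>x. min (limit_degree x) (real K) \<partial>P) y < min \<epsilon> (\<epsilon> * \<epsilon>)"
      by (auto simp: eventually_sequentially)
    define d where "d = (\<integral>x. min (limit_degree x) (real K) \<partial>P)"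
    have d: "\<bar>d - y\<bar> < \<epsilon>" "y - d < \<epsilon> * \<epsilon>" using K by (auto simp: d_def dist_real_def)
    have Y: "tendsto_in_prob G (\<lambda>n. trunc_degree (real K)) d" unfolding d_def by (rule tendsto_trunc_degree) simp
    have "(\<lambda>n. enn2real (a n) - measure_pmf.expectation (G n) (trunc_degree (real K))) \<longlonglongrightarrow> y - d"
      by (intro tendsto_diff ea tendsto_in_prob_expectation[OF Y, of "real K"]) (auto simp: trunc_degree_bounds)
    then have "\<forall>\<^sub>F n in sequentially. enn2real (a n) - measure_pmf.expectation (G n) (trunc_degree (real K)) < \<epsilon> * \<epsilon>"
      using d(2) by (rule order_tendstoD)
    with afin have "approx_in_prob G (\<lambda>n. mean_degree) (\<lambda>n. trunc_degree (real K)) \<epsilon>"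
      unfolding approx_in_prob_def
    proof eventually_elim
      case (elim n)
      have X: "integrable (measure_pmf (G n)) mean_degree"
        using elim(1) mean0 by (intro integrableI_nonneg) (auto simp: a_def)
      have ia: "enn2real (a n) = measure_pmf.expectation (G n) mean_degree"
        unfolding a_def by (rule integral_eq_nn_integral[symmetric]) (use mean0 in auto)
      have Yi: "integrable (measure_pmf (G n)) (trunc_degree (real K))"
        by (intro measure_pmf.integrable_const_bound[of _ "real K"]) (auto simp: trunc_degree_bounds)
      have le: "trunc_degree (real K) g \<le> mean_degree g" for g
        unfolding trunc_degree_def mean_degree_def by (intro divide_right_mono sum_mono) auto
      have "measure_pmf.prob (G n) {g. \<bar>mean_degree g - trunc_degree (real K) g\<bar> > \<epsilon>} \<le>
          measure_pmf.prob (G n) {g \<in> space (measure_pmf (G n)). mean_degree g - trunc_degree (real K) g \<ge> \<epsilon>}"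
        using le by (intro measure_pmf.finite_measure_mono) auto
      also have "\<dots> \<le> measure_pmf.expectation (G n) (\<lambda>g. mean_degree g - trunc_degree (real K) g) / \<epsilon>"
        by (rule integral_Markov_inequality_measure[where A = "{}"]) (use X Yi le \<epsilon> in auto)
      also have "\<dots> \<le> \<epsilon>" using elim(2) X Yi \<epsilon> by (simp add: ia divide_le_eq)
      finally show ?case .
    qed
    with Y d show "\<exists>Y d. tendsto_in_prob G Y d \<and> \<bar>d - y\<bar> \<le> \<epsilon> \<and> approx_in_prob G (\<lambda>n. mean_degree) Y \<epsilon>"
      by (intro exI[of _ "\<lambda>n. trunc_degree (real K)"] exI[of _ d]) auto
  qed
qed

end

section \<open>The random cluster model and its rank-2 approximation\<close>

lemma Z_RC_subsets:
  assumes "finite (edges G)"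
  shows "Z_RC q w B G = (\<Sum>A\<in>Pow (edges G). w ^ card A *
     (\<Prod>C\<in>components G A. 1 + (q - 1) * exp (- B * real (card C))))"
  unfolding Z_RC_def
proof (rule sum.reindex_bij_witness[of _ "\<lambda>A. \<lambda>e\<in>edges G. if e \<in> A then 1 else 0" "\<lambda>\<omega>. {e \<in> edges G. \<omega> e = 1}"])
  fix \<omega> :: "_ \<Rightarrow> nat" assume \<omega>: "\<omega> \<in> edges G \<rightarrow>\<^sub>E {0, 1}"
  show "(\<lambda>e\<in>edges G. if e \<in> {e \<in> edges G. \<omega> e = 1} then 1 else 0) = \<omega>"
    using \<omega> by (intro ext) (auto simp: PiE_iff extensional_def)
  have "(\<Prod>e\<in>edges G. w ^ \<omega> e) = w ^ (\<Sum>e\<in>edges G. \<omega> e)" by (simp add: power_sum)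
  also have "(\<Sum>e\<in>edges G. \<omega> e) = card {e \<in> edges G. \<omega> e = 1}"
  proof -
    have "(\<Sum>e\<in>edges G. \<omega> e) = (\<Sum>e\<in>edges G. if \<omega> e = 1 then 1 else 0)"
      using \<omega> by (intro sum.cong) (auto simp: PiE_iff)
    also have "\<dots> = card {e \<in> edges G. \<omega> e = 1}" using assms by (simp flip: sum.inter_filter)
    finally show ?thesis .
  qed
  finally show "w ^ card {e \<in> edges G. \<omega> e = 1} *
      (\<Prod>C\<in>components G {e \<in> edges G. \<omega> e = 1}. 1 + (q - 1) * exp (- B * real (card C))) =
    (\<Prod>e\<in>edges G. w ^ \<omega> e) * (\<Prod>C\<in>components G {e \<in> edges G. \<omega> e = 1}. 1 + (q - 1) * exp (- B * real (card C)))"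
    by simp
qed (auto simp: PiE_iff)

section \<open>Components of a set of open edges\<close>

locale edge_subset =
  fixes G :: "('v, 'e) mgraph" and A :: "'e set"
  assumes G: "finite_graph G" and A: "A \<subseteq> edges G"
begin

lemma wf: "wf_graph G" and finite_verts: "finite (verts G)" and finite_A: "finite A"
  using G A finite_subset by (auto simp: finite_graph_def)

definition rel :: "('v \<times> 'v) set" where
  "rel = (adj G A)\<^sup>* \<inter> verts G \<times> verts G"

definition cls :: "'v \<Rightarrow> 'v set" where
  "cls v = rel `` {v}"

text \<open>For an open edge the choice of the end does not matter, by
  \<open>ends_cls\<close>.\<close>

definition ecls :: "'e \<Rightarrow> 'v set" where
  "ecls e = cls (SOME u. u \<in># ends G e)"

definition comp_edges :: "'v set \<Rightarrow> 'e set" where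
  "comp_edges C = {e \<in> A. set_mset (ends G e) \<subseteq> C}"

lemma equiv_rel: "equiv (verts G) rel"
  unfolding equiv_def refl_on_def sym_def trans_def rel_def
  using adj_rtrancl_sym by (auto intro: rtrancl_trans)

lemma components_eq: "components G A = cls ` verts G"
  by (auto simp: components_def quotient_def rel_def cls_def)

lemma finite_components: "finite (components G A)"
  using finite_verts by (simp add: components_eq)

lemma cls_eq_iff: "u \<in> verts G \<Longrightarrow> v \<in> verts G \<Longrightarrow> cls u = cls v \<longleftrightarrow> (u, v) \<in> (adj G A)\<^sup>*"
  unfolding cls_def using eq_equiv_class_iff[OF equiv_rel] by (auto simp: rel_def)

lemma in_cls_iff: "u \<in> verts G \<Longrightarrow> v \<in> cls u \<longleftrightarrow> v \<in> verts G \<and> cls v = cls u"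
  using cls_eq_iff[of u v] by (auto simp: cls_def rel_def)

lemma component_fibre: "C \<in> components G A \<Longrightarrow> {v \<in> verts G. cls v = C} = C"
  using in_cls_iff by (auto simp: components_eq)

lemma component_subset: "C \<in> components G A \<Longrightarrow> C \<subseteq> verts G"
  using component_fibre by blast

lemma component_finite: "C \<in> components G A \<Longrightarrow> finite C"
  using component_subset finite_verts finite_subset by blast

lemma component_nonempty: "C \<in> components G A \<Longrightarrow> C \<noteq> {}"
  using in_cls_iff by (auto simp: components_eq)

lemma component_member: "C \<in> components G A \<Longrightarrow> u \<in> C \<longleftrightarrow> u \<in> verts G \<and> cls u = C"
  using component_fibre by blast

lemma component_connected:
  assumes "C \<in> components G A" "u \<in> C" "v \<in> C" shows "(u, v) \<in> (adj G A)\<^sup>*"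
  using cls_eq_iff[of u v] assms(2,3) unfolding component_member[OF assms(1)] by simp

lemma component_closed:
  assumes "C \<in> components G A" "u \<in> C" "(u, v) \<in> adj G A" shows "v \<in> C"
  using cls_eq_iff[of u v] assms(2) adj_verts[OF wf A assms(3)] r_into_rtrancl[OF assms(3)]
  unfolding component_member[OF assms(1)] by simp

lemma ends_cls:
  assumes "e \<in> A" "u \<in># ends G e" shows "cls u = ecls e" "u \<in> verts G"
proof -
  obtain a b where ab: "ends G e = {#a, b#}" "a \<in> verts G" "b \<in> verts G"
    using edge_two[OF wf] assms A by blast
  then have "(a, b) \<in> adj G A" using assms by (auto simp: adj_def)
  then have "cls a = cls b" using ab cls_eq_iff by blast
  moreover define s where "s = (SOME u. u \<in># ends G e)"
  have "s \<in># ends G e" unfolding s_def using assms(2) by (rule someI)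
  then have "s = a \<or> s = b" using ab by auto
  moreover have "u = a \<or> u = b" using assms(2) ab by auto
  ultimately show "cls u = ecls e" unfolding ecls_def s_def[symmetric] by auto
  show "u \<in> verts G" using ab assms(2) by auto
qed

lemma ecls_component: "e \<in> A \<Longrightarrow> ecls e \<in> components G A"
  using edge_two[OF wf, of e] ends_cls A by (fastforce simp: components_eq)

lemma comp_edges_fibre:
  assumes "C \<in> components G A" shows "{e \<in> A. ecls e = C} = comp_edges C"
proof -
  have "set_mset (ends G e) \<subseteq> C \<longleftrightarrow> ecls e = C" if e: "e \<in> A" for e
  proof -
    obtain a b where ab: "ends G e = {#a, b#}" using edge_two[OF wf] e A by blast
    have "u \<in> C \<longleftrightarrow> ecls e = C" if "u \<in># ends G e" for u
      using ends_cls[OF e that] component_member[OF assms, of u] by simp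
    then show ?thesis using ab by auto
  qed
  then show ?thesis by (auto simp: comp_edges_def)
qed

lemma prod_components:
  fixes f :: "'v \<Rightarrow> real"
  shows "(\<Prod>v\<in>verts G. f v) = (\<Prod>C\<in>components G A. \<Prod>v\<in>C. f v)"
proof -
  have "(\<Prod>v\<in>verts G. f v) = (\<Prod>C\<in>components G A. \<Prod>v\<in>{v \<in> verts G. cls v = C}. f v)"
    by (rule prod.group[symmetric]) (auto simp: components_eq finite_verts)
  then show ?thesis using component_fibre by (simp cong: prod.cong)
qed

lemma prod_comp_edges:
  fixes f :: "'e \<Rightarrow> real"
  shows "(\<Prod>e\<in>A. f e) = (\<Prod>C\<in>components G A. \<Prod>e\<in>comp_edges C. f e)"
proof -
  have "(\<Prod>e\<in>A. f e) = (\<Prod>C\<in>components G A. \<Prod>e\<in>{e \<in> A. ecls e = C}. f e)"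
    by (rule prod.group[symmetric]) (auto simp: finite_A finite_components ecls_component)
  then show ?thesis using comp_edges_fibre by (simp cong: prod.cong)
qed

lemma sum_card_components: "(\<Sum>C\<in>components G A. card C) = card (verts G)"
proof -
  have "card (verts G) = (\<Sum>v\<in>verts G. 1)" by simp
  also have "\<dots> = (\<Sum>C\<in>components G A. \<Sum>v\<in>{v \<in> verts G. cls v = C}. 1)"
    by (rule sum.group[symmetric]) (auto simp: components_eq finite_verts)
  finally show ?thesis using component_fibre by (simp cong: sum.cong)
qed

text \<open>By a breadth-first spanning tree of \<open>C\<close>.\<close>

lemma component_edges:
  assumes C: "C \<in> components G A"
  shows "card C \<le> Suc (card (comp_edges C))"
    and "(\<And>vs es. set es \<subseteq> comp_edges C \<Longrightarrow> \<not> is_cycle G vs es) \<Longrightarrow> card C = Suc (card (comp_edges C))"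
proof -
  obtain r where r: "r \<in> C" using component_nonempty[OF C] by blast
  let ?H = "G\<lparr>edges := A\<rparr>"
  have H: "wf_graph ?H" "adj ?H = adj G" "edges ?H = A" "verts ?H = verts G" using wf A by (auto simp: wf_graph_def adj_def fun_eq_iff)
  have down: "\<exists>p\<in>C. \<exists>e\<in>A. ends G e = {#p, u#} \<and> gdist ?H r p < gdist ?H r u" if u: "u \<in> C" "u \<noteq> r" for u
  proof -
    have "(r, u) \<in> (adj G A)\<^sup>*" using component_connected[OF C r u(1)] .
    then obtain j where "(r, u) \<in> adj G A ^^ j" by (auto simp: rtrancl_power)
    then have "u \<in> ball_verts ?H j r" using u component_subset[OF C] by (auto simp: ball_verts_def H)
    from ball_verts_parent[OF H(1) this u(2)] obtain p
      where p: "(p, u) \<in> adj G A" "gdist ?H r p < gdist ?H r u" by (auto simp: H)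
    have "p \<in> C" using component_closed[OF C u(1)] adj_sym[OF p(1)] by blast
    then show ?thesis using p by (auto simp: adj_def)
  qed
  obtain par pe where
    "\<forall>u\<in>C. u \<noteq> r \<longrightarrow> par u \<in> C \<and> pe u \<in> A \<and> ends G (pe u) = {#par u, u#} \<and> gdist ?H r (par u) < gdist ?H r u"
    and inj: "inj_on pe (C - {r})"
    and sub: "pe ` (C - {r}) \<subseteq> {e \<in> A. set_mset (ends G e) \<subseteq> C}"
    and E: "r \<in> C \<and> (\<forall>vs es. set es \<subseteq> {e \<in> A. set_mset (ends G e) \<subseteq> C} \<longrightarrow> \<not> is_cycle G vs es) \<longrightarrow>
       pe ` (C - {r}) = {e \<in> A. set_mset (ends G e) \<subseteq> C}"
    using parent_structure[OF wf A down] by blast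
  have "card (pe ` (C - {r})) = card C - 1" using inj r component_finite[OF C] by (simp add: card_image)
  then have card: "card C = Suc (card (pe ` (C - {r})))" using r component_finite[OF C]
    by (metis One_nat_def Suc_pred card_gt_0_iff empty_iff)
  have "card (pe ` (C - {r})) \<le> card (comp_edges C)"
    using sub finite_A by (intro card_mono) (auto simp: comp_edges_def)
  with card show "card C \<le> Suc (card (comp_edges C))" by simp
  assume "\<And>vs es. set es \<subseteq> comp_edges C \<Longrightarrow> \<not> is_cycle G vs es"
  then have "pe ` (C - {r}) = comp_edges C" using E r unfolding comp_edges_def by blast
  with card show "card C = Suc (card (comp_edges C))" by simp
qed

text \<open>The radius is crude: the path length is bounded by the number of adjacent pairs in
  \<open>C\<close>. Any radius depending on \<open>L\<close> alone serves the purpose, as cyclic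
  vertices are rare at every fixed radius.\<close>

lemma component_in_ball:
  assumes C: "C \<in> components G A" "card C \<le> L" and v: "v \<in> C"
  shows "C \<subseteq> ball_verts G (L * L) v"
proof
  fix u assume u: "u \<in> C"
  let ?R = "adj G A \<inter> C \<times> C"
  have fin: "finite ?R" using component_finite[OF C(1)] by auto
  have "(v, u) \<in> (adj G A)\<^sup>*" by (rule component_connected[OF C(1) v u])
  then have "(v, u) \<in> ?R\<^sup>* \<and> u \<in> C"
  proof (induction rule: rtrancl_induct)
    case (step y z)
    then have "z \<in> C" using component_closed[OF C(1)] by blast
    then have "(y, z) \<in> ?R" using step by blast
    then show ?case using step \<open>z \<in> C\<close> by (meson rtrancl.rtrancl_into_rtrancl)
  qed (use v in auto)
  then obtain j where j: "j \<le> card ?R" "(v, u) \<in> ?R ^^ j"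
    unfolding rtrancl_finite_eq_relpow[OF fin] by auto
  have "card ?R \<le> card (C \<times> C)" using component_finite[OF C(1)] by (intro card_mono) auto
  also have "\<dots> \<le> L * L" using C(2) by (simp add: card_cartesian_product mult_le_mono)
  finally have "j \<le> L * L" using j by simp
  moreover have "(v, u) \<in> adj G (edges G) ^^ j"
    by (rule relpow_mono_rel[OF j(2)]) (use adj_mono[OF A] in auto)
  ultimately show "u \<in> ball_verts G (L * L) v"
    using u component_subset[OF C(1)] by (auto simp: ball_verts_def)
qed

text \<open>The components for which the two weights may differ. By \<open>component_edges\<close>
  each of them contains a cycle of open edges.\<close>

definition cyclic_components :: "'v set set" where
  "cyclic_components = {C \<in> components G A. card C \<noteq> Suc (card (comp_edges C))}"

lemma card_cyclic_components:
  assumes L: "L > 0"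
  shows "real (card cyclic_components) \<le> real (card (verts G)) / real L +
    real (card {v \<in> verts G. \<not> acyclic_graph (fst (nbhd (L * L) (G, v)))})"
proof -
  let ?big = "{C \<in> components G A. L < card C}"
  let ?small = "{C \<in> cyclic_components. card C \<le> L}"
  let ?cyc = "{v \<in> verts G. \<not> acyclic_graph (fst (nbhd (L * L) (G, v)))}"
  have "real L * real (card ?big) = (\<Sum>C\<in>?big. real L)" by simp
  also have "\<dots> \<le> (\<Sum>C\<in>?big. real (card C))" by (rule sum_mono) auto
  also have "\<dots> \<le> (\<Sum>C\<in>components G A. real (card C))" using finite_components by (intro sum_mono2) auto
  also have "\<dots> = real (card (verts G))" unfolding of_nat_sum[symmetric] sum_card_components ..
  finally have big: "real (card ?big) \<le> real (card (verts G)) / real L" using L by (simp add: field_simps)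
  have small: "C \<subseteq> ?cyc" if C: "C \<in> ?small" for C
  proof
    fix v assume v: "v \<in> C"
    have comp: "C \<in> components G A" "card C \<le> L" using C by (auto simp: cyclic_components_def)
    obtain vs es where c: "set es \<subseteq> comp_edges C" "is_cycle G vs es"
      using component_edges(2)[OF comp(1)] C by (auto simp: cyclic_components_def)
    have es: "set es \<subseteq> edges_in G (ball_verts G (L * L) v)"
      using c(1) component_in_ball[OF comp v] A by (auto simp: comp_edges_def edges_in_def)
    have "\<not> acyclic_graph (fst (nbhd (L * L) (G, v)))"
    proof
      assume "acyclic_graph (fst (nbhd (L * L) (G, v)))"
      from acyclic_nbhd_no_cycle[OF this es, of vs] c(2) show False by simp
    qed
    then show "v \<in> ?cyc" using v component_subset[OF comp(1)] by auto
  qed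
  \<comment> \<open>Components are disjoint, so choosing a vertex from each is injective. Every
    vertex of a small cyclic component sees a cycle in its ball of radius
    \<open>L * L\<close>.\<close>
  have "card ?small \<le> card ?cyc"
  proof (rule card_inj_on_le[where f = "\<lambda>C. SOME v. v \<in> C"])
    have some: "(SOME v. v \<in> C) \<in> C" if "C \<in> ?small" for C
      using component_nonempty that by (auto simp: cyclic_components_def some_in_eq)
    show "inj_on (\<lambda>C. SOME v. v \<in> C) ?small"
    proof (rule inj_onI)
      fix C D assume CD: "C \<in> ?small" "D \<in> ?small" and eq: "(SOME v. v \<in> C) = (SOME v. v \<in> D)"
      then have "(SOME v. v \<in> C) \<in> C" "(SOME v. v \<in> C) \<in> D" using some[OF CD(1)] some[OF CD(2)] by auto
      moreover have "C \<in> components G A" "D \<in> components G A" using CD by (auto simp: cyclic_components_def)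
      ultimately show "C = D" using component_member[of C] component_member[of D] by simp
    qed
    show "(\<lambda>C. SOME v. v \<in> C) ` ?small \<subseteq> ?cyc" using some small by blast
  qed (use finite_verts in simp)
  moreover have "card cyclic_components \<le> card ?big + card ?small"
  proof -
    have "card cyclic_components \<le> card (?big \<union> ?small)"
      using finite_components by (intro card_mono) (auto simp: cyclic_components_def)
    also have "\<dots> \<le> card ?big + card ?small" by (rule card_Un_le)
    finally show ?thesis .
  qed
  ultimately show ?thesis using big by linarith
qed

definition rc_factor :: "real \<Rightarrow> real \<Rightarrow> 'v set \<Rightarrow> real" where
  "rc_factor q B C = 1 + (q - 1) * exp (- B * real (card C))"

text \<open>A quotient of two powers, because \<open>C\<close> may have more edges than vertices and
  the exponent |C| - m is then negative.\<close>

definition rank2_factor :: "real \<Rightarrow> real \<Rightarrow> 'v set \<Rightarrow> real" where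
  "rank2_factor q B C = 1 + (q - 1) ^ card C / (q - 1) ^ card (comp_edges C) * exp (- B * real (card C))"

text \<open>A component has at least |C| - 1 open edges, so the quotient of powers is at most
  \<open>q - 1\<close>. The crude bound by the factor \<open>q\<close> uses that the true weight is
  at most \<open>q\<close> and the approximate one at least 1.\<close>

lemma rank2_factor_bounds:
  assumes q: "2 \<le> q" and B: "0 \<le> B" and C: "C \<in> components G A"
  shows "1 \<le> rank2_factor q B C" "rank2_factor q B C \<le> rc_factor q B C"
    "rc_factor q B C \<le> (if C \<in> cyclic_components then q else 1) * rank2_factor q B C"
proof -
  show 1: "1 \<le> rank2_factor q B C" using q by (simp add: rank2_factor_def)
  have "(q - 1) ^ card C \<le> (q - 1) ^ Suc (card (comp_edges C))"
    using q component_edges(1)[OF C] by (intro power_increasing) auto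
  then have "(q - 1) ^ card C / (q - 1) ^ card (comp_edges C) \<le> q - 1"
    using q by (simp add: divide_le_eq)
  then show "rank2_factor q B C \<le> rc_factor q B C"
    unfolding rank2_factor_def rc_factor_def by (intro add_left_mono mult_right_mono) auto
  have "exp (- B * real (card C)) \<le> 1" using B by simp
  then have "rc_factor q B C \<le> 1 + (q - 1) * 1"
    unfolding rc_factor_def using q by (intro add_left_mono mult_left_mono) auto
  then have le_q: "rc_factor q B C \<le> q" by simp
  show "rc_factor q B C \<le> (if C \<in> cyclic_components then q else 1) * rank2_factor q B C"
  proof (cases "C \<in> cyclic_components")
    case True
    have "q * 1 \<le> q * rank2_factor q B C" using 1 q by (intro mult_left_mono) auto
    then show ?thesis using True le_q by simp
  next
    case False
    then have "card C = Suc (card (comp_edges C))" using C by (auto simp: cyclic_components_def)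
    then show ?thesis using q False by (simp add: rank2_factor_def rc_factor_def)
  qed
qed

lemma prod_rc_factor_bounds:
  assumes q: "2 \<le> q" and B: "0 \<le> B" and L: "L > 0"
  shows "(\<Prod>C\<in>components G A. rank2_factor q B C) \<le> (\<Prod>C\<in>components G A. rc_factor q B C)"
    and "(\<Prod>C\<in>components G A. rc_factor q B C) \<le>
      q powr (real (card (verts G)) / real L + real (card {v \<in> verts G. \<not> acyclic_graph (fst (nbhd (L * L) (G, v)))})) *
      (\<Prod>C\<in>components G A. rank2_factor q B C)"
proof -
  note bounds = rank2_factor_bounds[OF q B]
  show "(\<Prod>C\<in>components G A. rank2_factor q B C) \<le> (\<Prod>C\<in>components G A. rc_factor q B C)"
    using bounds by (intro prod_mono) (force intro: order.trans[of 0 1])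
  have rc0: "0 \<le> rc_factor q B C" for C using q by (auto simp: rc_factor_def intro!: add_nonneg_nonneg)
  have "(\<Prod>C\<in>components G A. rc_factor q B C) \<le>
      (\<Prod>C\<in>components G A. (if C \<in> cyclic_components then q else 1) * rank2_factor q B C)"
    using bounds(3) rc0 by (intro prod_mono) auto
  also have "\<dots> = (\<Prod>C\<in>components G A. if C \<in> cyclic_components then q else 1) * (\<Prod>C\<in>components G A. rank2_factor q B C)"
    by (rule prod.distrib)
  also have "(\<Prod>C\<in>components G A. if C \<in> cyclic_components then q else 1) = q ^ card cyclic_components"
  proof -
    have "{C \<in> components G A. C \<in> cyclic_components} = cyclic_components" by (auto simp: cyclic_components_def)
    then show ?thesis using finite_components by (simp flip: prod.inter_filter)
  qed
  also have "q ^ card cyclic_components = q powr real (card cyclic_components)" using q by (simp add: powr_realpow)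
  also have "\<dots> * (\<Prod>C\<in>components G A. rank2_factor q B C) \<le>
      q powr (real (card (verts G)) / real L + real (card {v \<in> verts G. \<not> acyclic_graph (fst (nbhd (L * L) (G, v)))})) *
      (\<Prod>C\<in>components G A. rank2_factor q B C)"
    using card_cyclic_components[OF L] q bounds(1)
    by (intro mult_right_mono powr_mono prod_nonneg) (force intro: order.trans[of 0 1])+
  finally show "(\<Prod>C\<in>components G A. rc_factor q B C) \<le>
      q powr (real (card (verts G)) / real L + real (card {v \<in> verts G. \<not> acyclic_graph (fst (nbhd (L * L) (G, v)))})) *
      (\<Prod>C\<in>components G A. rank2_factor q B C)" .
qed

end

text \<open>The weight of an open edge after merging colours; it vanishes when the two ends
  disagree. Dividing by \<open>q - 1\<close> at spin -1 compensates for the factor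
  \<open>q - 1\<close> that every vertex of spin -1 carries, up to one such factor per tree.\<close>

definition edge_wt :: "real \<Rightarrow> real \<Rightarrow> ('v \<Rightarrow> real) \<Rightarrow> 'v multiset \<Rightarrow> real" where
  "edge_wt w q \<sigma> M = (if \<forall>u\<in>#M. \<sigma> u = 1 then w else if \<forall>u\<in>#M. \<sigma> u = -1 then w / (q - 1) else 0)"

definition site_wt :: "real \<Rightarrow> real \<Rightarrow> real" where
  "site_wt p s = (if s = 1 then 1 else p)"

context edge_subset
begin

text \<open>An Edwards-Sokal coupling. Only configurations constant on the components of
  \<open>A\<close> have nonzero weight; they are the lifts of one spin per component. The sum over
  these spins factorizes, the spin +1 giving the summand 1 of \<open>rank2_factor\<close> and the
  spin -1 the other.\<close>

lemma spin_sum_components: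
  fixes q w B :: real
  assumes q: "2 \<le> q"
  defines "p \<equiv> (q - 1) * exp (- B)"
  shows "spin_sum (verts G) (\<lambda>\<sigma>. (\<Prod>e\<in>A. edge_wt w q \<sigma> (ends G e)) * (\<Prod>v\<in>verts G. site_wt p (\<sigma> v))) =
    w ^ card A * (\<Prod>C\<in>components G A. rank2_factor q B C)"
proof -
  let ?V = "verts G" and ?K = "components G A"
  define F where "F \<sigma> = (\<Prod>e\<in>A. edge_wt w q \<sigma> (ends G e)) * (\<Prod>v\<in>?V. site_wt p (\<sigma> v))" for \<sigma> :: "'v \<Rightarrow> real"
  define lift where "lift \<tau> = (\<lambda>v\<in>?V. \<tau> (cls v))" for \<tau> :: "'v set \<Rightarrow> real"
  define m where "m C = card (comp_edges C)" for C
  define g where "g C s = (if s = 1 then w ^ m C else (w / (q - 1)) ^ m C * p ^ card C)" for C and s :: real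
  have cls_K: "cls v \<in> ?K" if "v \<in> ?V" for v using that by (simp add: components_eq)
  have lift_spin: "lift \<tau> \<in> ?V \<rightarrow>\<^sub>E {-1, 1}" if "\<tau> \<in> ?K \<rightarrow>\<^sub>E {-1, 1}" for \<tau>
    using that cls_K by (auto simp: lift_def PiE_iff)
  have image: "\<sigma> \<in> lift ` (?K \<rightarrow>\<^sub>E {-1, 1})" if \<sigma>: "\<sigma> \<in> ?V \<rightarrow>\<^sub>E {-1, 1}" and nz: "F \<sigma> \<noteq> 0" for \<sigma>
  proof -
    have edge: "\<sigma> a = \<sigma> b" if ab: "(a, b) \<in> adj G A" for a b
    proof -
      obtain e where e: "e \<in> A" "ends G e = {#a, b#}" using ab by (auto simp: adj_def)
      then have "edge_wt w q \<sigma> (ends G e) \<noteq> 0" using nz finite_A by (auto simp: F_def)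
      then show ?thesis using e by (auto simp: edge_wt_def split: if_splits)
    qed
    have const: "\<sigma> a = \<sigma> b" if "(a, b) \<in> (adj G A)\<^sup>*" for a b
      using that by (induction rule: rtrancl_induct) (auto simp: edge)
    define \<tau> where "\<tau> = (\<lambda>C\<in>?K. \<sigma> (SOME v. v \<in> C))"
    have some: "(SOME v. v \<in> C) \<in> C" if "C \<in> ?K" for C
      using component_nonempty[OF that] by (simp add: some_in_eq)
    have "\<tau> \<in> ?K \<rightarrow>\<^sub>E {-1, 1}"
      unfolding \<tau>_def using some component_subset spin_values[OF \<sigma>] by fastforce
    moreover have "\<sigma> = lift \<tau>"
    proof
      fix v show "\<sigma> v = lift \<tau> v"
      proof (cases "v \<in> ?V")
        case True
        have "v \<in> cls v" using in_cls_iff[OF True] True by simp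
        then have "\<sigma> (SOME u. u \<in> cls v) = \<sigma> v"
          by (intro const component_connected[OF cls_K[OF True]] some[OF cls_K[OF True]])
        then show ?thesis using True cls_K[OF True] by (simp add: lift_def \<tau>_def)
      qed (use \<sigma> in \<open>auto simp: lift_def PiE_iff extensional_def\<close>)
    qed
    ultimately show ?thesis by blast
  qed
  have inj: "inj_on lift (?K \<rightarrow>\<^sub>E {-1, 1})"
  proof (rule inj_onI)
    fix \<tau> \<tau>' assume t: "\<tau> \<in> ?K \<rightarrow>\<^sub>E {-1, 1}" "\<tau>' \<in> ?K \<rightarrow>\<^sub>E {-1, 1}" and eq: "lift \<tau> = lift \<tau>'"
    show "\<tau> = \<tau>'"
    proof
      fix C show "\<tau> C = \<tau>' C"
      proof (cases "C \<in> ?K")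
        case True
        then obtain v where "v \<in> ?V" "C = cls v" by (auto simp: components_eq)
        then show ?thesis using fun_cong[OF eq, of v] by (simp add: lift_def)
      qed (use t in \<open>auto simp: PiE_iff extensional_def\<close>)
    qed
  qed
  have F_lift: "F (lift \<tau>) = (\<Prod>C\<in>?K. g C (\<tau> C))" if \<tau>: "\<tau> \<in> ?K \<rightarrow>\<^sub>E {-1, 1}" for \<tau>
  proof -
    have edge: "edge_wt w q (lift \<tau>) (ends G e) = (if \<tau> C = 1 then w else w / (q - 1))"
      if C: "C \<in> ?K" and e: "e \<in> comp_edges C" for C e
    proof -
      have eA: "e \<in> A" "ecls e = C" using e comp_edges_fibre[OF C] by auto
      obtain a b where ab: "ends G e = {#a, b#}" using edge_two[OF wf] eA A by blast
      have l: "lift \<tau> u = \<tau> C" if "u \<in># ends G e" for u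
        using ends_cls[OF eA(1) that] eA(2) by (simp add: lift_def)
      have "\<tau> C = -1 \<or> \<tau> C = 1" using spin_values[OF \<tau> C] .
      then show ?thesis using l[of a] l[of b] ab by (auto simp: edge_wt_def)
    qed
    have site: "site_wt p (lift \<tau> v) = site_wt p (\<tau> C)" if "C \<in> ?K" "v \<in> C" for C v
      using that component_member[OF that(1)] by (simp add: lift_def)
    have "F (lift \<tau>) = (\<Prod>C\<in>?K. (\<Prod>e\<in>comp_edges C. edge_wt w q (lift \<tau>) (ends G e)) * (\<Prod>v\<in>C. site_wt p (lift \<tau> v)))"
      unfolding F_def prod_components prod_comp_edges prod.distrib ..
    also have "\<dots> = (\<Prod>C\<in>?K. g C (\<tau> C))"
    proof (rule prod.cong)
      fix C assume C: "C \<in> ?K"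
      show "(\<Prod>e\<in>comp_edges C. edge_wt w q (lift \<tau>) (ends G e)) * (\<Prod>v\<in>C. site_wt p (lift \<tau> v)) = g C (\<tau> C)"
        using edge[OF C] site[OF C] by (simp add: g_def site_wt_def m_def)
    qed simp
    finally show ?thesis .
  qed
  have "spin_sum ?V F = (\<Sum>\<sigma>\<in>lift ` (?K \<rightarrow>\<^sub>E {-1, 1}). F \<sigma>)"
    unfolding spin_sum_def using lift_spin image finite_spins[OF finite_verts]
    by (intro sum.mono_neutral_right) blast+
  also have "\<dots> = spin_sum ?K (\<lambda>\<tau>. F (lift \<tau>))"
    unfolding spin_sum_def by (simp add: sum.reindex[OF inj])
  also have "\<dots> = spin_sum ?K (\<lambda>\<tau>. \<Prod>C\<in>?K. g C (\<tau> C))"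
    by (rule spin_sum_cong) (rule F_lift)
  also have "\<dots> = (\<Prod>C\<in>?K. g C 1 + g C (-1))" by (rule spin_sum_prod[OF finite_components])
  also have "\<dots> = (\<Prod>C\<in>?K. (\<Prod>e\<in>comp_edges C. w) * rank2_factor q B C)"
  proof (rule prod.cong)
    fix C :: "'v set"
    have "exp (- B) ^ card C = exp (- B * real (card C))" by (simp add: exp_of_nat_mult[symmetric] mult.commute)
    then have "p ^ card C = (q - 1) ^ card C * exp (- B * real (card C))"
      unfolding p_def power_mult_distrib by simp
    then show "g C 1 + g C (-1) = (\<Prod>e\<in>comp_edges C. w) * rank2_factor q B C"
      by (simp add: g_def m_def rank2_factor_def power_divide distrib_left)
  qed simp
  also have "\<dots> = w ^ card A * (\<Prod>C\<in>?K. rank2_factor q B C)"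
    unfolding prod.distrib prod_comp_edges[symmetric] by simp
  finally show ?thesis unfolding F_def .
qed

end

text \<open>Here the state of every edge is summed out, 1 for closed and \<open>edge_wt\<close> for
  open. The interaction is the two-by-two matrix with diagonal 1 + w, 1 + w / (q - 1) and
  off-diagonal entries 1.\<close>

definition Z_rank2 :: "real \<Rightarrow> real \<Rightarrow> real \<Rightarrow> ('v, 'e) mgraph \<Rightarrow> real" where
  "Z_rank2 q w B G = spin_sum (verts G) (\<lambda>\<sigma>. (\<Prod>e\<in>edges G. 1 + edge_wt w q \<sigma> (ends G e)) *
     (\<Prod>v\<in>verts G. site_wt ((q - 1) * exp (- B)) (\<sigma> v)))"

lemma Z_rank2_subsets:
  assumes G: "finite_graph G" and q: "2 \<le> q"
  shows "Z_rank2 q w B G = (\<Sum>A\<in>Pow (edges G). w ^ card A * (\<Prod>C\<in>components G A. edge_subset.rank2_factor G A q B C))"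
proof -
  have fin: "finite (edges G)" using G by (simp add: finite_graph_def)
  have "Z_rank2 q w B G = spin_sum (verts G) (\<lambda>\<sigma>. \<Sum>A\<in>Pow (edges G).
      (\<Prod>e\<in>A. edge_wt w q \<sigma> (ends G e)) * (\<Prod>v\<in>verts G. site_wt ((q - 1) * exp (- B)) (\<sigma> v)))"
    unfolding Z_rank2_def
    by (subst add.commute, subst prod_add[OF fin]) (simp add: sum_distrib_right)
  also have "\<dots> = (\<Sum>A\<in>Pow (edges G). w ^ card A * (\<Prod>C\<in>components G A. edge_subset.rank2_factor G A q B C))"
    unfolding spin_sum_sum
  proof (rule sum.cong)
    fix A assume "A \<in> Pow (edges G)"
    then interpret edge_subset G A using G by unfold_locales auto
    show "spin_sum (verts G) (\<lambda>\<sigma>. (\<Prod>e\<in>A. edge_wt w q \<sigma> (ends G e)) * (\<Prod>v\<in>verts G. site_wt ((q - 1) * exp (- B)) (\<sigma> v))) =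
      w ^ card A * (\<Prod>C\<in>components G A. edge_subset.rank2_factor G A q B C)"
      by (rule spin_sum_components[OF q])
  qed simp
  finally show ?thesis .
qed

lemma Z_RC_bounds:
  assumes G: "finite_graph G" and q: "2 \<le> q" and B: "0 \<le> B" and w: "0 \<le> w"
  shows "Z_rank2 q w B G \<le> Z_RC q w B G"
    and "L > 0 \<Longrightarrow> Z_RC q w B G \<le> q powr (real (card (verts G)) / real L +
      real (card {v \<in> verts G. \<not> acyclic_graph (fst (nbhd (L * L) (G, v)))})) * Z_rank2 q w B G"
proof -
  have fin: "finite (edges G)" using G by (simp add: finite_graph_def)
  have rc: "Z_RC q w B G = (\<Sum>A\<in>Pow (edges G). w ^ card A * (\<Prod>C\<in>components G A. edge_subset.rc_factor q B C))"
  proof -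
    have "edge_subset.rc_factor q B C = 1 + (q - 1) * exp (- B * real (card C))" if "A \<subseteq> edges G" for A and C :: "'a set"
    proof -
      interpret edge_subset G A using G that by unfold_locales auto
      show ?thesis by (rule rc_factor_def)
    qed
    then show ?thesis unfolding Z_RC_subsets[OF fin] by auto
  qed
  show "Z_rank2 q w B G \<le> Z_RC q w B G"
    unfolding rc Z_rank2_subsets[OF G q]
  proof (intro sum_mono mult_left_mono)
    fix A assume "A \<in> Pow (edges G)"
    then interpret edge_subset G A using G by unfold_locales auto
    show "(\<Prod>C\<in>components G A. rank2_factor q B C) \<le> (\<Prod>C\<in>components G A. rc_factor q B C)"
      by (rule prod_rc_factor_bounds(1)[OF q B, of 1]) simp
  qed (use w in simp)
  assume L: "L > 0"
  let ?c = "q powr (real (card (verts G)) / real L + real (card {v \<in> verts G. \<not> acyclic_graph (fst (nbhd (L * L) (G, v)))}))"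
  show "Z_RC q w B G \<le> ?c * Z_rank2 q w B G"
    unfolding rc Z_rank2_subsets[OF G q] sum_distrib_left
  proof (rule sum_mono)
    fix A assume "A \<in> Pow (edges G)"
    then interpret edge_subset G A using G by unfold_locales auto
    have "w ^ card A * (\<Prod>C\<in>components G A. rc_factor q B C) \<le> w ^ card A * (?c * (\<Prod>C\<in>components G A. rank2_factor q B C))"
      by (intro mult_left_mono prod_rc_factor_bounds(2)[OF q B L]) (use w in simp)
    then show "w ^ card A * (\<Prod>C\<in>components G A. rc_factor q B C) \<le> ?c * (w ^ card A * (\<Prod>C\<in>components G A. rank2_factor q B C))"
      by (simp add: mult_ac)
  qed
qed

text \<open>Both sides count incidences with multiplicity, so a loop counts twice on each. This
  collects the fields \<open>k\<close> that the edges exert on their ends into the field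
  \<open>k * degree\<close> at each vertex.\<close>

lemma sum_degree:
  assumes G: "finite_graph G"
  shows "(\<Sum>v\<in>verts G. real (degree G v) * f v) = (\<Sum>e\<in>edges G. \<Sum>u\<in>#ends G e. f u)"
proof -
  have fin: "finite (verts G)" "finite (edges G)" and wf: "wf_graph G" using G by (auto simp: finite_graph_def)
  have ends: "(\<Sum>u\<in>#ends G e. f u) = (\<Sum>v\<in>verts G. real (count (ends G e) v) * f v)" if "e \<in> edges G" for e
  proof -
    obtain a b where ab: "ends G e = {#a, b#}" "a \<in> verts G" "b \<in> verts G" using edge_two[OF wf \<open>e \<in> edges G\<close>] by blast
    have "(\<Sum>v\<in>verts G. real (count (ends G e) v) * f v) =
        (\<Sum>v\<in>verts G. (if v = a then f v else 0) + (if v = b then f v else 0))"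
      using ab by (intro sum.cong) (auto simp: algebra_simps)
    then show ?thesis using ab fin by (simp add: sum.distrib)
  qed
  have deg: "real (degree G v) = (\<Sum>e\<in>edges G. real (count (ends G e) v))" for v
    unfolding degree_def of_nat_sum using fin by (intro sum.mono_neutral_left) (auto simp: not_in_iff)
  show ?thesis
    unfolding deg sum_distrib_right by (subst sum.swap) (simp add: ends)
qed

lemma sum_degree_edges:
  assumes "finite_graph G" shows "(\<Sum>v\<in>verts G. real (degree G v)) = 2 * real (card (edges G))"
proof -
  have "(\<Sum>u\<in>#ends G e. 1) = (2 :: real)" if "e \<in> edges G" for e
    using assms that by (simp add: finite_graph_def wf_graph_def)
  then show ?thesis using sum_degree[OF assms, of "\<lambda>_. 1"] by simp
qed

lemma Z_eIsing_spin_sum: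
  assumes "wf_graph G"
  shows "Z_eIsing J k h G = spin_sum (verts G) (ising_weight G J (\<lambda>v. k * real (degree G v) + h) (verts G))"
  by (simp add: Z_eIsing_def spin_sum_def ising_weight_def edges_in_verts[OF assms] spin_prod_def)

text \<open>The edge factor for spins s, t is exp (J + J s t + k (s + t)): agreeing spins require 2J
  + 2k = ln (1 + w) and 2J - 2k = ln (1 + w / (q - 1)), and for disagreeing spins the exponent
  vanishes. With p the site weight of spin -1, a site contributes the square root of p times exp (h
  s), where h = - (ln p) / 2.\<close>

lemma Z_rank2_eIsing:
  assumes G: "finite_graph G" and q: "2 \<le> q" and w: "0 \<le> w"
    and k: "k = 1/4 * ln ((1 + w) / (1 + w / (q - 1)))"
    and J: "J = 1/4 * ln ((1 + w) * (1 + w / (q - 1)))"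
    and h: "h = 1/2 * ln (exp B / (q - 1))"
  shows "Z_rank2 q w B G = exp (J * real (card (edges G)) +
     real (card (verts G)) * (1/2 * ln (exp (- B) * (q - 1)))) * Z_eIsing J k h G"
proof -
  have fin: "finite (verts G)" "finite (edges G)" and wf: "wf_graph G" using G by (auto simp: finite_graph_def)
  define p where "p = (q - 1) * exp (- B)"
  have p: "0 < p" using q by (simp add: p_def)
  have a: "0 < 1 + w" "0 < 1 + w / (q - 1)" using w q by (auto intro: add_pos_nonneg)
  have lns: "ln ((1 + w) * (1 + w / (q - 1))) = ln (1 + w) + ln (1 + w / (q - 1))"
    "ln ((1 + w) / (1 + w / (q - 1))) = ln (1 + w) - ln (1 + w / (q - 1))"
    using a by (simp_all add: ln_mult ln_div)
  have plus: "2 * J + 2 * k = ln (1 + w)" and minus: "2 * J - 2 * k = ln (1 + w / (q - 1))"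
    unfolding J k lns by (simp_all add: field_simps)
  have "ln p = ln (q - 1) - B" "ln (exp B / (q - 1)) = B - ln (q - 1)"
    unfolding p_def using q by (simp_all add: ln_mult ln_div)
  then have hp: "h = - (1/2 * ln p)" unfolding h by (simp add: field_simps)
  have site: "site_wt p s = exp (1/2 * ln p + h * s)" if "s = -1 \<or> s = 1" for s
    using that p by (auto simp: site_wt_def hp)
  have edge: "1 + edge_wt w q \<sigma> (ends G e) = exp (J + J * spin_prod \<sigma> (ends G e) + k * (\<Sum>u\<in>#ends G e. \<sigma> u))"
    if \<sigma>: "\<sigma> \<in> verts G \<rightarrow>\<^sub>E {-1, 1}" and e: "e \<in> edges G" for \<sigma> e
  proof -
    obtain a b where ab: "ends G e = {#a, b#}" "a \<in> verts G" "b \<in> verts G" using edge_two[OF wf e] by blast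
    have pp: "J + J + k * 2 = ln (1 + w)" and mm: "J + J - k * 2 = ln (1 + w / (q - 1))" using plus minus by simp_all
    show ?thesis
      using spin_values[OF \<sigma> ab(2)] spin_values[OF \<sigma> ab(3)] a pp mm
      by (auto simp: ab(1) edge_wt_def)
  qed
  have "Z_rank2 q w B G = spin_sum (verts G) (\<lambda>\<sigma>. exp (J * real (card (edges G)) + real (card (verts G)) * (1/2 * ln p)) *
      ising_weight G J (\<lambda>v. k * real (degree G v) + h) (verts G) \<sigma>)"
    unfolding Z_rank2_def p_def[symmetric]
  proof (rule spin_sum_cong)
    fix \<sigma> assume \<sigma>: "\<sigma> \<in> verts G \<rightarrow>\<^sub>E {-1, 1::real}"
    have 1: "(\<Prod>e\<in>edges G. 1 + edge_wt w q \<sigma> (ends G e)) =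
        exp (\<Sum>e\<in>edges G. J + J * spin_prod \<sigma> (ends G e) + k * (\<Sum>u\<in>#ends G e. \<sigma> u))"
      unfolding exp_sum[OF fin(2)] using edge[OF \<sigma>] by (intro prod.cong) auto
    have 2: "(\<Prod>v\<in>verts G. site_wt p (\<sigma> v)) = exp (\<Sum>v\<in>verts G. 1/2 * ln p + h * \<sigma> v)"
      unfolding exp_sum[OF fin(1)] using site[OF spin_values[OF \<sigma>]] by (intro prod.cong) auto
    have 3: "(\<Sum>e\<in>edges G. J + J * spin_prod \<sigma> (ends G e) + k * (\<Sum>u\<in>#ends G e. \<sigma> u)) =
        J * real (card (edges G)) + J * (\<Sum>e\<in>edges G. spin_prod \<sigma> (ends G e)) + (\<Sum>v\<in>verts G. k * real (degree G v) * \<sigma> v)"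
      using sum_degree[OF G, of \<sigma>] by (simp add: sum.distrib mult.assoc flip: sum_distrib_left)
    have 4: "(\<Sum>v\<in>verts G. 1/2 * ln p + h * \<sigma> v) = real (card (verts G)) * (1/2 * ln p) + (\<Sum>v\<in>verts G. h * \<sigma> v)"
      by (simp add: sum.distrib)
    show "(\<Prod>e\<in>edges G. 1 + edge_wt w q \<sigma> (ends G e)) * (\<Prod>v\<in>verts G. site_wt p (\<sigma> v)) =
      exp (J * real (card (edges G)) + real (card (verts G)) * (1/2 * ln p)) *
      ising_weight G J (\<lambda>v. k * real (degree G v) + h) (verts G) \<sigma>"
      unfolding 1 2 3 4 ising_weight_def edges_in_verts[OF wf] exp_add[symmetric]
      by (simp add: distrib_right sum.distrib algebra_simps)
  qed
  then show ?thesis unfolding spin_sum_cmult Z_eIsing_spin_sum[OF wf] by (simp add: p_def mult.commute)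
qed

section \<open>The pressure of the Ising model\<close>

text \<open>Jensen's inequality, obtained by averaging exp (Y - m) >= 1 + (Y - m) at the mean m of
  \<open>Y\<close>. It replaces differentiation of the pressure.\<close>

lemma jensen_exp:
  assumes "finite V" and W: "\<And>\<sigma>. \<sigma> \<in> V \<rightarrow>\<^sub>E {-1, 1} \<Longrightarrow> 0 < W \<sigma>"
  shows "spin_sum V (\<lambda>\<sigma>. Y \<sigma> * W \<sigma>) / spin_sum V W \<le> ln (spin_sum V (\<lambda>\<sigma>. exp (Y \<sigma>) * W \<sigma>)) - ln (spin_sum V W)"
proof -
  define Z where "Z = spin_sum V W"
  define m where "m = spin_sum V (\<lambda>\<sigma>. Y \<sigma> * W \<sigma>) / Z"
  have Z: "0 < Z" unfolding Z_def using assms by (rule spin_sum_pos)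
  have "exp m * Z = exp m * (Z + spin_sum V (\<lambda>\<sigma>. Y \<sigma> * W \<sigma>) - m * Z)" using Z by (simp add: m_def)
  also have "\<dots> = spin_sum V (\<lambda>\<sigma>. exp m * ((1 + (Y \<sigma> - m)) * W \<sigma>))"
    unfolding spin_sum_cmult Z_def by (simp add: algebra_simps spin_sum_add spin_sum_diff spin_sum_cmult)
  also have "\<dots> \<le> spin_sum V (\<lambda>\<sigma>. exp (Y \<sigma>) * W \<sigma>)"
  proof (rule spin_sum_mono)
    fix \<sigma> assume "\<sigma> \<in> V \<rightarrow>\<^sub>E {-1, 1::real}"
    then have "exp m * ((1 + (Y \<sigma> - m)) * W \<sigma>) \<le> exp m * (exp (Y \<sigma> - m) * W \<sigma>)"
      using W[of \<sigma>] by (intro mult_left_mono mult_right_mono exp_ge_add_one_self) auto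
    then show "exp m * ((1 + (Y \<sigma> - m)) * W \<sigma>) \<le> exp (Y \<sigma>) * W \<sigma>" by (simp add: exp_diff)
  qed
  finally have le: "exp m * Z \<le> spin_sum V (\<lambda>\<sigma>. exp (Y \<sigma>) * W \<sigma>)" .
  have "m + ln Z = ln (exp m * Z)" using Z by (simp add: ln_mult)
  also have "\<dots> \<le> ln (spin_sum V (\<lambda>\<sigma>. exp (Y \<sigma>) * W \<sigma>))" using le Z by (intro ln_mono) auto
  finally show ?thesis by (simp add: m_def Z_def)
qed

text \<open>Convexity of the pressure in a uniform field. The second bound is the first with the
  increment reversed, starting from \<open>x'\<close>.\<close>

lemma ln_Z_increment:
  fixes G :: "('v, 'e) mgraph" and J :: real
  assumes G: "finite_graph G" and x': "\<And>v. x' v = x v + \<delta>"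
  defines "Z \<equiv> \<lambda>x. spin_sum (verts G) (ising_weight G J x (verts G))"
  shows "\<delta> * (\<Sum>v\<in>verts G. ising_mag G J x (verts G) v) \<le> ln (Z x') - ln (Z x)"
    and "ln (Z x') - ln (Z x) \<le> \<delta> * (\<Sum>v\<in>verts G. ising_mag G J x' (verts G) v)"
proof -
  let ?V = "verts G"
  have fin: "finite ?V" using G by (simp add: finite_graph_def)
  have key: "a * (\<Sum>v\<in>?V. ising_mag G J y ?V v) \<le> ln (Z z) - ln (Z y)" if z: "\<And>v. z v = y v + a" for a y z
  proof -
    have mag: "a * (\<Sum>v\<in>?V. ising_mag G J y ?V v) =
        spin_sum ?V (\<lambda>\<sigma>. (a * (\<Sum>v\<in>?V. \<sigma> v)) * ising_weight G J y ?V \<sigma>) / spin_sum ?V (ising_weight G J y ?V)"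
      by (simp add: ising_mag_def mult.assoc sum_distrib_right spin_sum_cmult spin_sum_sum flip: sum_divide_distrib)
    have "exp (a * (\<Sum>v\<in>?V. \<sigma> v)) * ising_weight G J y ?V \<sigma> = ising_weight G J z ?V \<sigma>" for \<sigma>
      unfolding ising_weight_def z exp_add[symmetric]
      by (simp add: algebra_simps sum.distrib sum_distrib_left)
    then have "spin_sum ?V (\<lambda>\<sigma>. exp (a * (\<Sum>v\<in>?V. \<sigma> v)) * ising_weight G J y ?V \<sigma>) = Z z" by (simp add: Z_def)
    then show ?thesis
      using jensen_exp[OF fin, of "ising_weight G J y ?V" "\<lambda>\<sigma>. a * (\<Sum>v\<in>?V. \<sigma> v)"] unfolding mag by (simp add: Z_def)
  qed
  show "\<delta> * (\<Sum>v\<in>?V. ising_mag G J x ?V v) \<le> ln (Z x') - ln (Z x)" by (rule key) (rule x')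
  have "(- \<delta>) * (\<Sum>v\<in>?V. ising_mag G J x' ?V v) \<le> ln (Z x) - ln (Z x')" by (rule key) (simp add: x')
  then show "ln (Z x') - ln (Z x) \<le> \<delta> * (\<Sum>v\<in>?V. ising_mag G J x' ?V v)" by simp
qed

text \<open>The lower bound is the all-plus term. For the upper bound every edge is replaced by its
  maximum, so the vertices decouple, and exp x + exp (- x) = exp x (1 + exp (- 2 x)) is at most exp
  (x + exp (- 2 c)).\<close>

lemma ln_Z_ground_state:
  fixes G :: "('v, 'e) mgraph" and J :: real
  assumes G: "finite_graph G" and J: "0 \<le> J" and x: "\<And>v. v \<in> verts G \<Longrightarrow> c \<le> x v"
  defines "Z \<equiv> spin_sum (verts G) (ising_weight G J x (verts G))"
    and "S \<equiv> J * real (card (edges G)) + (\<Sum>v\<in>verts G. x v)"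
  shows "S \<le> ln Z" "ln Z \<le> S + real (card (verts G)) * exp (- 2 * c)"
proof -
  let ?V = "verts G"
  have fin: "finite ?V" and wf: "wf_graph G" using G by (auto simp: finite_graph_def)
  have Z: "0 < Z" unfolding Z_def by (rule ising_sum_pos[OF fin])
  let ?one = "\<lambda>v\<in>?V. 1 :: real"
  have one: "?one \<in> ?V \<rightarrow>\<^sub>E {-1, 1}" by auto
  have "spin_prod ?one (ends G e) = 1" if "e \<in> edges G" for e
    using edge_two[OF wf that] by auto
  then have "exp S = ising_weight G J x ?V ?one"
    by (simp add: ising_weight_def S_def edges_in_verts[OF wf])
  also have "\<dots> \<le> Z"
    unfolding Z_def spin_sum_def using one finite_spins[OF fin]
    by (intro member_le_sum) (auto intro: less_imp_le)
  finally show "S \<le> ln Z" using Z by (simp add: ln_ge_iff)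
  have "Z \<le> spin_sum ?V (\<lambda>\<sigma>. exp (J * real (card (edges G))) * (\<Prod>v\<in>?V. exp (x v * \<sigma> v)))"
    unfolding Z_def
  proof (rule spin_sum_mono)
    fix \<sigma> assume \<sigma>: "\<sigma> \<in> ?V \<rightarrow>\<^sub>E {-1, 1::real}"
    have "(\<Sum>e\<in>edges G. spin_prod \<sigma> (ends G e)) \<le> (\<Sum>e\<in>edges G. 1)"
    proof (rule sum_mono)
      fix e assume "e \<in> edges G"
      then have "set_mset (ends G e) \<subseteq> ?V" using wf by (simp add: wf_graph_def)
      from spin_prod_values[OF \<sigma> this] show "spin_prod \<sigma> (ends G e) \<le> 1" by auto
    qed
    then have "J * (\<Sum>e\<in>edges G. spin_prod \<sigma> (ends G e)) \<le> J * real (card (edges G))"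
      using J by (intro mult_left_mono) auto
    then show "ising_weight G J x ?V \<sigma> \<le> exp (J * real (card (edges G))) * (\<Prod>v\<in>?V. exp (x v * \<sigma> v))"
      by (simp add: ising_weight_def edges_in_verts[OF wf] fin flip: exp_sum exp_add)
  qed
  also have "\<dots> = exp (J * real (card (edges G))) * (\<Prod>v\<in>?V. exp (x v) + exp (- x v))"
    unfolding spin_sum_cmult using spin_sum_prod[OF fin, of "\<lambda>v s. exp (x v * s)"] by simp
  also have "\<dots> \<le> exp (J * real (card (edges G))) * (\<Prod>v\<in>?V. exp (x v + exp (- 2 * c)))"
  proof (intro mult_left_mono prod_mono conjI)
    fix v assume v: "v \<in> ?V"
    have "exp (x v) + exp (- x v) = exp (x v) * (1 + exp (- 2 * x v))"
      by (simp add: distrib_left flip: exp_add)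
    also have "\<dots> \<le> exp (x v) * (1 + exp (- 2 * c))" using x[OF v] by simp
    also have "\<dots> \<le> exp (x v) * exp (exp (- 2 * c))" by (intro mult_left_mono exp_ge_add_one_self) auto
    finally show "exp (x v) + exp (- x v) \<le> exp (x v + exp (- 2 * c))" by (simp add: exp_add)
  qed (auto intro: add_nonneg_nonneg)
  also have "\<dots> = exp (S + real (card ?V) * exp (- 2 * c))"
    by (simp add: S_def sum.distrib fin flip: exp_sum exp_add)
  finally show "ln Z \<le> S + real (card ?V) * exp (- 2 * c)" using Z by (simp add: ln_le_cancel_iff[symmetric] del: ln_le_cancel_iff)
qed

text \<open>The bound \<open>c\<close> is uniform over \<open>n\<close>, the graph and the vertex.
  It gives one constant in \<open>ising_mag_ball\<close> for all balls, whatever their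
  degrees.\<close>

locale ising_sequence = tree_like_sequence G P R
  for G :: "nat \<Rightarrow> ('v, 'e) mgraph pmf" and P :: "'a measure" and R :: "'a \<Rightarrow> ('u, 'f) rooted" +
  fixes J k h c :: real
  assumes J: "0 \<le> J" and c: "0 < c"
    and field: "\<And>n g v. n \<ge> 1 \<Longrightarrow> g \<in> set_pmf (G n) \<Longrightarrow> v \<in> verts g \<Longrightarrow> c \<le> k * real (degree g v) + h"
begin

definition site_field :: "real \<Rightarrow> ('v, 'e) mgraph \<Rightarrow> 'v \<Rightarrow> real" where
  "site_field t g v = k * real (degree g v) + (h + t)"

definition mean_mag :: "real \<Rightarrow> ('v, 'e) mgraph \<Rightarrow> real" where
  "mean_mag t g = (\<Sum>v\<in>verts g. ising_mag g J (site_field t g) (verts g) v) / real (card (verts g))"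

definition pressure :: "real \<Rightarrow> ('v, 'e) mgraph \<Rightarrow> real" where
  "pressure t g = ln (Z_eIsing J k (h + t) g) / real (card (verts g))"

lemma pressure_eq:
  "wf_graph g \<Longrightarrow> pressure t g = ln (spin_sum (verts g) (ising_weight g J (site_field t g) (verts g))) / real (card (verts g))"
  by (simp add: pressure_def Z_eIsing_spin_sum site_field_def [abs_def])

lemma mean_mag_bound:
  assumes "n \<ge> 1" "g \<in> set_pmf (G n)" shows "\<bar>mean_mag t g\<bar> \<le> 1"
proof -
  have fin: "finite (verts g)" "card (verts g) > 0" using graphs[OF assms] assms by (auto simp: finite_graph_def)
  have "\<bar>\<Sum>v\<in>verts g. ising_mag g J (site_field t g) (verts g) v\<bar> \<le> (\<Sum>v\<in>verts g. 1)"
    by (rule order.trans[OF sum_abs], rule sum_mono) (rule ising_mag_bound[OF fin(1)])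
  then show ?thesis using fin by (simp add: mean_mag_def abs_divide)
qed

text \<open>The magnetization of a vertex is replaced by that in its ball of radius \<open>L\<close>
  with free boundary, a bounded local quantity. The error is at most \<open>2 * C / real L\<close>
  where the ball is acyclic and at most 2 elsewhere.\<close>

lemma tendsto_mean_mag:
  assumes t: "0 \<le> t" shows "\<exists>d. tendsto_in_prob G (\<lambda>n. mean_mag t) d"
proof (rule tendsto_in_prob_approx_const)
  fix \<epsilon> :: real assume \<epsilon>: "0 < \<epsilon>"
  \<comment> \<open>For zero coupling \<open>leaf_field\<close> vanishes identically and
    \<open>C = 1\<close> works; otherwise the ratio of \<open>J\<close> to
    \<open>leaf_field J c\<close> is raised to at least 1.\<close>
  obtain C where C: "1 \<le> C" "J \<le> C * leaf_field J c"
  proof (cases "J = 0")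
    case True
    then show ?thesis using that[of 1] leaf_field_nonneg[of J c] c by simp
  next
    case False
    then have "0 < leaf_field J c" using J c leaf_field_pos by simp
    then show ?thesis using that[of "max 1 (J / leaf_field J c)"] by (simp add: pos_divide_le_eq[symmetric])
  qed
  obtain L :: nat where "4 * C / \<epsilon> < real L" using reals_Archimedean2 by blast
  moreover have "0 < 4 * C / \<epsilon>" using C \<epsilon> by simp
  ultimately have L: "L > 0" and "4 * C < \<epsilon> * real L"
    using C \<epsilon> by (auto simp: pos_divide_less_eq mult.commute intro!: Nat.gr0I)
  then have L2: "2 * C / real L \<le> \<epsilon> / 2" by (simp add: pos_divide_le_eq)
  \<comment> \<open>Clipping makes the local function bounded on all codes, also on those that no
    neighbourhood attains. On the neighbourhoods that occur it changes nothing, since magnetizations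
    lie between -1 and 1.\<close>
  define clip where "clip y = max (-1) (min 1 y)" for y :: real
  define \<phi> where "\<phi> i = clip (root_mag J k (h + t) L (code_graph i))" for i
  \<comment> \<open>The radius is \<open>Suc L\<close> because the fields in the ball of radius
    \<open>L\<close> depend on the degrees at its boundary.\<close>
  have "tendsto_in_prob G (\<lambda>n. empirical \<phi> (Suc L)) (\<integral>x. \<phi> (limit_code (Suc L) x) \<partial>P)"
    by (rule tendsto_empirical[of _ 1]) (auto simp: \<phi>_def clip_def)
  moreover have "approx_in_prob G (\<lambda>n. mean_mag t) (\<lambda>n. empirical \<phi> (Suc L)) \<epsilon>"
  proof (rule approx_in_prob_dominated[OF _ _ \<epsilon>])
    show "tendsto_in_prob G (\<lambda>n g. 2 * C / real L + 2 * cyclic_fraction L g) (2 * C / real L + 2 * 0)"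
      by (intro tendsto_in_prob_add tendsto_in_prob_cmult tendsto_in_prob_const tendsto_cyclic_fraction)
    show "2 * C / real L + 2 * 0 < \<epsilon>" using L2 \<epsilon> by simp
    fix n g assume n: "n \<ge> (1::nat)" and g: "g \<in> set_pmf (G n)"
    have G: "finite_graph g" and fin: "finite (verts g)" "card (verts g) > 0" and wf: "wf_graph g"
      using graphs[OF n g] n by (auto simp: finite_graph_def)
    let ?m = "\<lambda>v. ising_mag g J (site_field t g) (verts g) v"
    let ?b = "\<lambda>v. ising_mag g J (site_field t g) (ball_verts g L v) v"
    have root: "\<phi> (graph_code (nbhd (Suc L) (g, v))) = ?b v" if v: "v \<in> verts g" for v
    proof -
      have "root_mag J k (h + t) L (code_graph (graph_code (nbhd (Suc L) (g, v)))) = ?b v"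
        unfolding root_mag_code[OF nbhd_finite[OF n g v]] root_mag_nbhd[OF wf v]
        by (simp add: root_mag_def site_field_def [abs_def])
      moreover have "\<bar>?b v\<bar> \<le> 1"
        using fin v by (intro ising_mag_bound ball_verts_root) (auto simp: ball_verts_def)
      ultimately show ?thesis by (simp add: \<phi>_def clip_def)
    qed
    have bound: "\<bar>?m v - ?b v\<bar> \<le> 2 * C / real L + (if acyclic_graph (fst (nbhd L (g, v))) then 0 else 2)" if v: "v \<in> verts g" for v
    proof (cases "acyclic_graph (fst (nbhd L (g, v)))")
      case True
      have x: "c \<le> site_field t g u" if "u \<in> verts g" for u
        using field[OF n g that] t by (simp add: site_field_def)
      note ball = ising_mag_ball[OF G v True J c x C]
      have "?m v - ?b v \<le> 2 * C / real L" using ball(2) L by (simp add: pos_le_divide_eq mult.commute)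
      then show ?thesis using ball(1) True by simp
    next
      case False
      have "\<bar>?m v\<bar> \<le> 1" "\<bar>?b v\<bar> \<le> 1"
        using fin v by (auto intro!: ising_mag_bound ball_verts_root simp: ball_verts_def)
      moreover have "0 \<le> 2 * C / real L" using C by simp
      ultimately show ?thesis using False by auto
    qed
    have "\<bar>mean_mag t g - empirical \<phi> (Suc L) g\<bar> = \<bar>\<Sum>v\<in>verts g. ?m v - ?b v\<bar> / real (card (verts g))"
      using root by (simp add: mean_mag_def empirical_def sum_subtractf abs_divide flip: diff_divide_distrib)
    also have "\<dots> \<le> (\<Sum>v\<in>verts g. 2 * C / real L + (if acyclic_graph (fst (nbhd L (g, v))) then 0 else 2)) / real (card (verts g))"
      by (intro divide_right_mono order.trans[OF sum_abs] sum_mono bound) auto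
    also have "\<dots> = 2 * C / real L + 2 * cyclic_fraction L g"
    proof -
      have "(\<Sum>v\<in>verts g. if acyclic_graph (fst (nbhd L (g, v))) then 0 else 2) =
          (\<Sum>v\<in>verts g. if \<not> acyclic_graph (fst (nbhd L (g, v))) then 2 else (0 :: real))" by (intro sum.cong) auto
      also have "\<dots> = 2 * real (card {v \<in> verts g. \<not> acyclic_graph (fst (nbhd L (g, v)))})"
        using fin by (simp flip: sum.inter_filter)
      finally show ?thesis using fin by (auto simp: sum.distrib cyclic_fraction_def add_divide_distrib)
    qed
    finally show "\<bar>mean_mag t g - empirical \<phi> (Suc L) g\<bar> \<le> 2 * C / real L + 2 * cyclic_fraction L g" .
  qed
  ultimately show "\<exists>Y d. tendsto_in_prob G Y d \<and> approx_in_prob G (\<lambda>n. mean_mag t) Y \<epsilon>" by blast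
qed

lemma pressure_increment:
  assumes n: "n \<ge> 1" and g: "g \<in> set_pmf (G n)"
  shows "\<delta> * mean_mag t g \<le> pressure (t + \<delta>) g - pressure t g"
    and "pressure (t + \<delta>) g - pressure t g \<le> \<delta> * mean_mag (t + \<delta>) g"
proof -
  have G: "finite_graph g" and wf: "wf_graph g" using graphs[OF n g] by (auto simp: finite_graph_def)
  have sf: "site_field (t + \<delta>) g v = site_field t g v + \<delta>" for v by (simp add: site_field_def)
  note inc = ln_Z_increment[OF G sf, of J]
  show "\<delta> * mean_mag t g \<le> pressure (t + \<delta>) g - pressure t g"
    using divide_right_mono[OF inc(1), of "real (card (verts g))"]
    by (simp add: pressure_eq[OF wf] mean_mag_def flip: diff_divide_distrib)
  show "pressure (t + \<delta>) g - pressure t g \<le> \<delta> * mean_mag (t + \<delta>) g"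
    using divide_right_mono[OF inc(2), of "real (card (verts g))"]
    by (simp add: pressure_eq[OF wf] mean_mag_def flip: diff_divide_distrib)
qed

text \<open>The increment of the pressure lies between the left and the right Riemann sum. These
  differ by \<delta> times the difference of the two end magnetizations, so the error does not grow
  with the length of the interval.\<close>

lemma pressure_riemann_sum:
  assumes n: "n \<ge> 1" and g: "g \<in> set_pmf (G n)" and \<delta>: "0 \<le> \<delta>"
  shows "\<bar>pressure (real N * \<delta>) g - pressure 0 g - (\<Sum>i<N. \<delta> * mean_mag (real i * \<delta>) g)\<bar> \<le> 2 * \<delta>"
proof -
  have tele: "(\<Sum>i<N. pressure (real (Suc i) * \<delta>) g - pressure (real i * \<delta>) g) = pressure (real N * \<delta>) g - pressure 0 g"
    using sum_lessThan_telescope[of "\<lambda>i. pressure (real i * \<delta>) g" N] by simp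
  have S: "real (Suc i) * \<delta> = real i * \<delta> + \<delta>" for i by (simp add: algebra_simps)
  have lower: "(\<Sum>i<N. \<delta> * mean_mag (real i * \<delta>) g) \<le> pressure (real N * \<delta>) g - pressure 0 g"
    unfolding tele[symmetric] S by (intro sum_mono pressure_increment(1)[OF n g])
  have "pressure (real N * \<delta>) g - pressure 0 g \<le> (\<Sum>i<N. \<delta> * mean_mag (real (Suc i) * \<delta>) g)"
    unfolding tele[symmetric] S by (intro sum_mono pressure_increment(2)[OF n g])
  also have "\<dots> = (\<Sum>i<N. \<delta> * mean_mag (real i * \<delta>) g) + \<delta> * (mean_mag (real N * \<delta>) g - mean_mag 0 g)"
    using sum_lessThan_telescope[of "\<lambda>i. \<delta> * mean_mag (real i * \<delta>) g" N] by (simp add: sum_subtractf right_diff_distrib)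
  also have "\<delta> * (mean_mag (real N * \<delta>) g - mean_mag 0 g) \<le> \<delta> * 2"
    using mean_mag_bound[OF n g, of "real N * \<delta>"] mean_mag_bound[OF n g, of 0] \<delta> by (intro mult_left_mono) auto
  finally show ?thesis using lower \<delta> by simp
qed

lemma pressure_ground_state:
  assumes n: "n \<ge> 1" and g: "g \<in> set_pmf (G n)" and t: "0 \<le> t"
  shows "\<bar>pressure t g - ((J / 2 + k) * mean_degree g + (h + t))\<bar> \<le> exp (- 2 * t)"
proof -
  have G: "finite_graph g" and wf: "wf_graph g" and card: "card (verts g) > 0"
    using graphs[OF n g] n by (auto simp: finite_graph_def)
  have x: "t \<le> site_field t g v" if "v \<in> verts g" for v
    using field[OF n g that] c by (simp add: site_field_def)
  let ?S = "J * real (card (edges g)) + (\<Sum>v\<in>verts g. site_field t g v)"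
  have "(\<Sum>v\<in>verts g. site_field t g v) = k * (2 * real (card (edges g))) + real (card (verts g)) * (h + t)"
    unfolding sum_degree_edges[OF G, symmetric] by (simp add: site_field_def sum.distrib sum_distrib_left)
  moreover have "mean_degree g = 2 * real (card (edges g)) / real (card (verts g))"
    by (simp add: mean_degree_def sum_degree_edges[OF G])
  ultimately have S: "?S / real (card (verts g)) = (J / 2 + k) * mean_degree g + (h + t)"
    using card by (simp add: field_simps)
  let ?Z = "spin_sum (verts g) (ising_weight g J (site_field t g) (verts g))"
  have gs: "?S \<le> ln ?Z" "ln ?Z \<le> ?S + real (card (verts g)) * exp (- 2 * t)"
    by (rule ln_Z_ground_state[OF G J x], assumption)+
  have "?S / real (card (verts g)) \<le> pressure t g"
    using divide_right_mono[OF gs(1), of "real (card (verts g))"] by (simp add: pressure_eq[OF wf])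
  moreover have "pressure t g \<le> ?S / real (card (verts g)) + exp (- 2 * t)"
    using divide_right_mono[OF gs(2), of "real (card (verts g))"] card by (simp add: pressure_eq[OF wf] add_divide_distrib)
  ultimately show ?thesis unfolding S by simp
qed

lemma tendsto_pressure: "\<exists>\<phi>. tendsto_in_prob G (\<lambda>n. pressure 0) \<phi>"
proof (rule tendsto_in_prob_approx_const)
  fix \<epsilon> :: real assume \<epsilon>: "0 < \<epsilon>"
  \<comment> \<open>The Riemann sum error \<open>2 * \<delta>\<close> then equals \<epsilon> /
    2.\<close>
  define \<delta> where "\<delta> = \<epsilon> / 4"
  have \<delta>: "0 < \<delta>" using \<epsilon> by (simp add: \<delta>_def)
  \<comment> \<open>The integration extends to a field \<open>T\<close> so large that the ground
    state error \<open>exp (- 2 * T)\<close> is at most \<epsilon> / 2.\<close>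
  obtain N :: nat where N: "- ln (\<epsilon> / 2) / (2 * \<delta>) \<le> real N" using real_arch_simple by blast
  define T where "T = real N * \<delta>"
  have T: "0 \<le> T" using \<delta> by (simp add: T_def)
  have "- ln (\<epsilon> / 2) \<le> real N * (2 * \<delta>)" using N \<delta> by (subst (asm) pos_divide_le_eq) auto
  then have "- ln (\<epsilon> / 2) \<le> 2 * T" by (simp add: T_def mult_ac)
  then have "exp (- 2 * T) \<le> exp (ln (\<epsilon> / 2))" by simp
  then have small: "exp (- 2 * T) \<le> \<epsilon> / 2" using \<epsilon> by simp
  have "\<forall>i. \<exists>d. tendsto_in_prob G (\<lambda>n. mean_mag (real i * \<delta>)) d"
    by (intro allI tendsto_mean_mag) (use \<delta> in simp)
  then obtain d where d: "\<And>i. tendsto_in_prob G (\<lambda>n. mean_mag (real i * \<delta>)) (d i)"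
    unfolding choice_iff by blast
  define Y where "Y n g = (J / 2 + k) * mean_degree g + (h + T) - (\<Sum>i<N. \<delta> * mean_mag (real i * \<delta>) g)" for n :: nat and g
  have "tendsto_in_prob G Y ((J / 2 + k) * (\<integral>x. limit_degree x \<partial>P) + (h + T) - (\<Sum>i<N. \<delta> * d i))"
    unfolding Y_def [abs_def]
    by (intro tendsto_in_prob_diff tendsto_in_prob_add tendsto_in_prob_cmult tendsto_in_prob_const
        tendsto_in_prob_sum tendsto_mean_degree d)
  moreover have "approx_in_prob G (\<lambda>n. pressure 0) Y \<epsilon>"
  proof (rule approx_in_prob_ae)
    have "\<bar>pressure 0 g - Y n g\<bar> \<le> \<epsilon>" if n: "n \<ge> 1" and g: "g \<in> set_pmf (G n)" for n g
    proof -
      have "\<bar>pressure T g - pressure 0 g - (\<Sum>i<N. \<delta> * mean_mag (real i * \<delta>) g)\<bar> \<le> \<epsilon> / 2"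
        using pressure_riemann_sum[OF n g less_imp_le[OF \<delta>], of N] unfolding T_def[symmetric] by (simp add: \<delta>_def)
      then show ?thesis unfolding Y_def using pressure_ground_state[OF n g T] small by linarith
    qed
    then show "\<forall>\<^sub>F n in sequentially. \<forall>g\<in>set_pmf (G n). \<bar>pressure 0 g - Y n g\<bar> \<le> \<epsilon>"
      unfolding eventually_sequentially by blast
  qed (use \<epsilon> in simp)
  ultimately show "\<exists>Y d. tendsto_in_prob G Y d \<and> approx_in_prob G (\<lambda>n. pressure 0) Y \<epsilon>" by blast
qed

end

section \<open>Positivity of the fields in the two regimes, and the limit of the free energy\<close>

lemma (in tree_like_sequence) d_min_le_degree:
  assumes "n \<ge> 1" "g \<in> set_pmf (G n)" "v \<in> verts g"
  shows "d_min G \<le> degree g v"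
proof -
  have "d_min G \<le> (INF g\<in>set_pmf (G n). Min (degree g ` verts g))"
    unfolding d_min_def using assms(1) by (intro cINF_lower) auto
  also have "\<dots> \<le> Min (degree g ` verts g)" using assms(2) by (intro cINF_lower) auto
  also have "\<dots> \<le> degree g v" using graphs[OF assms(1,2)] assms(3) by (intro Min_le) (auto simp: finite_graph_def)
  finally show ?thesis .
qed

text \<open>The threshold on \<open>w\<close> is the inequality (q - 1) powr (2 / D) < (1 + w) / (1
  + w / (q - 1)) solved for \<open>w\<close>; taking logarithms gives the claim.
  \<open>D \<ge> 3\<close> makes the exponent 2 / D less than 1, so the denominator of the threshold
  is positive.\<close>

lemma low_temperature_field:
  fixes q w D :: real
  assumes q: "q > 2" and D: "D \<ge> 3" and w: "w > ((q - 1) powr (2 / D) - 1) / (1 - (q - 1) powr (2 / D - 1))"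
    and w0: "0 \<le> w"
  shows "1/2 * ln (q - 1) < 1/4 * ln ((1 + w) / (1 + w / (q - 1))) * D"
proof -
  define a where "a = (q - 1) powr (2 / D)"
  have a: "0 < a" "(q - 1) powr (2 / D - 1) = a / (q - 1)" using q by (simp_all add: a_def powr_diff)
  have "a < (q - 1) powr 1" unfolding a_def using q D by (intro powr_less_mono) auto
  then have "0 < 1 - a / (q - 1)" using q by simp
  then have "a - 1 < w * (1 - a / (q - 1))" using w unfolding a(2) a_def[symmetric] by (simp add: pos_divide_less_eq)
  then have "a * (1 + w / (q - 1)) < 1 + w" by (simp add: algebra_simps)
  moreover have pos: "0 < 1 + w / (q - 1)" using w0 q by (intro add_pos_nonneg) auto
  ultimately have "a < (1 + w) / (1 + w / (q - 1))" by (simp add: pos_less_divide_eq)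
  then have "ln a < ln ((1 + w) / (1 + w / (q - 1)))" using a(1) by (subst ln_less_cancel_iff) auto
  moreover have "ln a = 2 / D * ln (q - 1)" using q by (simp add: a_def ln_powr)
  ultimately have "2 / D * ln (q - 1) * D < ln ((1 + w) / (1 + w / (q - 1))) * D"
    using D by (intro mult_strict_right_mono) auto
  then show ?thesis using D by simp
qed

theorem corollary1p17:
  fixes G :: "nat \<Rightarrow> ('v, 'e) mgraph pmf"
    and P :: "'a measure"
    and R :: "'a \<Rightarrow> ('u, 'f) rooted"
    and q \<beta> w B k \<beta>s h :: real
  assumes graphs: "\<And>n g. n \<ge> 1 \<Longrightarrow> g \<in> set_pmf (G n) \<Longrightarrow> finite_graph g \<and> card (verts g) = n"
    and tree_like: "locally_tree_like G P R"
    and q: "q \<ge> 2"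
    and \<beta>: "\<beta> \<ge> 0"
    and w: "w = exp \<beta> - 1"
    and B: "B \<ge> 0"
    and k: "k = 1/4 * ln ((1 + w) / (1 + w / (q - 1)))"
    and \<beta>s: "\<beta>s = 1/4 * ln ((1 + w) * (1 + w / (q - 1)))"
    and h: "h = 1/2 * ln (exp B / (q - 1))"
    and regime: "B > ln (q - 1) \<or>
      (q > 2 \<and> d_min G \<ge> 3 \<and>
       w > ((q - 1) powr (2 / real (d_min G)) - 1) / (1 - (q - 1) powr (2 / real (d_min G) - 1)))"
  shows "\<exists>\<phi>::real.
      tendsto_in_prob G (\<lambda>n g. 1 / real n * ln (Z_eIsing \<beta>s k h g)) \<phi> \<and>
      tendsto_in_prob G (\<lambda>n g. 1 / real n * ln (Z_RC q w B g))
        (\<beta>s / 2 * (\<integral>x. real (degree (fst (R x)) (snd (R x))) \<partial>P)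
         + 1/2 * ln (exp (- B) * (q - 1)) + \<phi>)"
proof -
  interpret tree_like_sequence G P R by (unfold_locales) (use graphs tree_like in auto)
  have w0: "0 \<le> w" using \<beta> w by simp
  have wq: "0 \<le> w / (q - 1)" "w / (q - 1) \<le> w" using w0 q by (simp_all add: divide_le_eq mult_le_cancel_left1)
  have k0: "0 \<le> k" unfolding k using w0 wq by simp
  have J0: "0 \<le> \<beta>s" unfolding \<beta>s using w0 wq mult_mono[of 1 "1 + w" 1 "1 + w / (q - 1)"] by simp
  have h': "h = 1/2 * (B - ln (q - 1))" unfolding h using q by (simp add: ln_div)
  \<comment> \<open>At high field \<open>h\<close> itself is positive and \<open>k\<close> is
    nonnegative. At low temperature \<open>h\<close> may be negative, but it is at least - ln (q -
    1) / 2 because \<open>B \<ge> 0\<close>, and the degree term at \<open>d_min G\<close> exceeds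
    ln (q - 1) / 2.\<close>
  obtain c where c: "0 < c"
    "\<And>n g v. n \<ge> 1 \<Longrightarrow> g \<in> set_pmf (G n) \<Longrightarrow> v \<in> verts g \<Longrightarrow> c \<le> k * real (degree g v) + h"
    using regime
  proof
    assume "B > ln (q - 1)"
    then show ?thesis using that[of h] k0 by (simp add: h')
  next
    assume low: "q > 2 \<and> d_min G \<ge> 3 \<and>
       w > ((q - 1) powr (2 / real (d_min G)) - 1) / (1 - (q - 1) powr (2 / real (d_min G) - 1))"
    show ?thesis
    proof (rule that[of "k * real (d_min G) + h"])
      have "1/2 * ln (q - 1) < k * real (d_min G)"
        unfolding k using low w0 by (intro low_temperature_field) auto
      moreover have "0 < x + 1/2 * (B - y)" if "1/2 * y < x" for x y :: real
        using that B by (simp add: right_diff_distrib)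
      ultimately show "0 < k * real (d_min G) + h" unfolding h' by blast
      fix n g v assume "n \<ge> (1::nat)" "g \<in> set_pmf (G n)" "v \<in> verts g"
      then show "k * real (d_min G) + h \<le> k * real (degree g v) + h"
        using k0 d_min_le_degree by (simp add: mult_left_mono)
    qed
  qed
  interpret ising_sequence G P R \<beta>s k h c by unfold_locales (use J0 c in auto)
  obtain \<phi> where \<phi>: "tendsto_in_prob G (\<lambda>n. pressure 0) \<phi>" using tendsto_pressure by blast
  define p where "p = 1/2 * ln (exp (- B) * (q - 1))"
  \<comment> \<open>Exactly the logarithm of \<open>Z_rank2\<close> per vertex: the number of edges
    is half the sum of the degrees. Its limit already has the claimed form.\<close>
  define Y where "Y n g = \<beta>s / 2 * mean_degree g + p + pressure 0 g" for n :: nat and g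
  have Y: "tendsto_in_prob G Y (\<beta>s / 2 * (\<integral>x. limit_degree x \<partial>P) + p + \<phi>)"
    unfolding Y_def [abs_def]
    by (intro tendsto_in_prob_add tendsto_in_prob_cmult tendsto_in_prob_const tendsto_mean_degree \<phi>)
  have compare: "Y n g \<le> 1 / real n * ln (Z_RC q w B g)"
    "L > 0 \<Longrightarrow> 1 / real n * ln (Z_RC q w B g) \<le> Y n g + ln q * (1 / real L + cyclic_fraction (L * L) g)"
    if n: "n \<ge> 1" and g: "g \<in> set_pmf (G n)" for n g L
  proof -
    have G: "finite_graph g" and card: "card (verts g) = n" and wf: "wf_graph g" and fin: "finite (verts g)"
      using graphs[OF n g] by (auto simp: finite_graph_def)
    have Z: "0 < Z_eIsing \<beta>s k h g" unfolding Z_eIsing_spin_sum[OF wf] by (rule ising_sum_pos[OF fin])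
    have rank2: "Z_rank2 q w B g = exp (\<beta>s * real (card (edges g)) + real (card (verts g)) * p) * Z_eIsing \<beta>s k h g"
      unfolding p_def by (rule Z_rank2_eIsing[OF G q w0 k \<beta>s h])
    have pos: "0 < Z_rank2 q w B g" unfolding rank2 using Z by simp
    have "ln (Z_rank2 q w B g) = \<beta>s * real (card (edges g)) + real n * p + ln (Z_eIsing \<beta>s k h g)"
      unfolding rank2 card using Z by (simp add: ln_mult)
    then have Yg: "1 / real n * ln (Z_rank2 q w B g) = Y n g"
      using n by (simp add: Y_def mean_degree_def sum_degree_edges[OF G] pressure_def card field_simps)
    have "ln (Z_rank2 q w B g) \<le> ln (Z_RC q w B g)"
      using Z_RC_bounds(1)[OF G q B w0] pos by (intro ln_mono) auto
    then show "Y n g \<le> 1 / real n * ln (Z_RC q w B g)"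
      unfolding Yg[symmetric] by (intro mult_left_mono) auto
    assume L: "L > 0"
    let ?x = "real n / real L + real (card {v \<in> verts g. \<not> acyclic_graph (fst (nbhd (L * L) (g, v)))})"
    have "ln (Z_RC q w B g) \<le> ln (q powr ?x * Z_rank2 q w B g)"
      using Z_RC_bounds[OF G q B w0] L pos by (intro ln_mono) (auto simp: card)
    also have "\<dots> = ?x * ln q + ln (Z_rank2 q w B g)" using q pos by (simp add: ln_mult ln_powr)
    finally have "1 / real n * ln (Z_RC q w B g) \<le> 1 / real n * (?x * ln q + ln (Z_rank2 q w B g))"
      by (intro mult_left_mono) auto
    also have "\<dots> = Y n g + ln q * (1 / real L + cyclic_fraction (L * L) g)"
      unfolding Yg[symmetric] using n L by (simp add: cyclic_fraction_def card field_simps)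
    finally show "1 / real n * ln (Z_RC q w B g) \<le> Y n g + ln q * (1 / real L + cyclic_fraction (L * L) g)" .
  qed
  have RC: "tendsto_in_prob G (\<lambda>n g. 1 / real n * ln (Z_RC q w B g)) (\<beta>s / 2 * (\<integral>x. limit_degree x \<partial>P) + p + \<phi>)"
  proof (rule tendsto_in_prob_approx)
    fix \<epsilon> :: real assume \<epsilon>: "0 < \<epsilon>"
    have lnq: "0 < ln q" using q by simp
    \<comment> \<open>Large components cost \<open>ln q / real L\<close> per vertex, less than
      \<epsilon> for this \<open>L\<close>; the contribution of small cyclic components tends to 0
      in probability for \<open>L\<close> fixed.\<close>
    obtain L :: nat where L: "ln q / \<epsilon> < real L" using reals_Archimedean2 by blast
    moreover have "0 < ln q / \<epsilon>" using lnq \<epsilon> by simp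
    ultimately have L0: "L > 0" by (intro Nat.gr0I) auto
    have "approx_in_prob G (\<lambda>n g. 1 / real n * ln (Z_RC q w B g)) Y \<epsilon>"
    proof (rule approx_in_prob_dominated[OF _ _ \<epsilon>])
      show "tendsto_in_prob G (\<lambda>n g. ln q * (1 / real L + cyclic_fraction (L * L) g)) (ln q * (1 / real L + 0))"
        by (intro tendsto_in_prob_cmult tendsto_in_prob_add tendsto_in_prob_const tendsto_cyclic_fraction)
      show "ln q * (1 / real L + 0) < \<epsilon>" using L L0 \<epsilon> by (simp add: field_simps)
      fix n g assume "n \<ge> (1::nat)" "g \<in> set_pmf (G n)"
      from compare(1)[OF this] compare(2)[OF this L0]
      show "\<bar>1 / real n * ln (Z_RC q w B g) - Y n g\<bar> \<le> ln q * (1 / real L + cyclic_fraction (L * L) g)" by simp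
    qed
    with Y \<epsilon> show "\<exists>Y d. tendsto_in_prob G Y d \<and> \<bar>d - (\<beta>s / 2 * (\<integral>x. limit_degree x \<partial>P) + p + \<phi>)\<bar> \<le> \<epsilon> \<and>
        approx_in_prob G (\<lambda>n g. 1 / real n * ln (Z_RC q w B g)) Y \<epsilon>"
      by (intro exI[of _ Y] exI[of _ "\<beta>s / 2 * (\<integral>x. limit_degree x \<partial>P) + p + \<phi>"]) auto
  qed
  have "tendsto_in_prob G (\<lambda>n g. 1 / real n * ln (Z_eIsing \<beta>s k h g)) \<phi>"
    using \<phi>
  proof (rule tendsto_in_prob_cong)
    show "\<forall>\<^sub>F n in sequentially. \<forall>g\<in>set_pmf (G n). 1 / real n * ln (Z_eIsing \<beta>s k h g) = pressure 0 g"
      using eventually_ge_at_top[of 1] by eventually_elim (use graphs in \<open>auto simp: pressure_def\<close>)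
  qed
  with RC show ?thesis unfolding limit_degree_def p_def by blast
qed

end
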